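(* Let $N,d\geq 1$ and let $F_1,\ldots,F_N:\mathbb{R}^d\to\mathbb{R}^d$ and the random variable $X_0$ satisfy: (i) $E[|X_0|^2]<\infty$; (ii) there exist $c_1,c_2>0$ such that $\left\langle \frac1N\sum_{i=1}^N F_i(x),x\right\rangle\geq c_2|x|^2-c_1$ for all $x\in\mathbb{R}^d$; (iii) there is $M>0$ such that $|F_i(x)-F_i(y)|\leq M|x-y|$ for all $1\leq i\leq N$ and all $x,y\in\mathbb{R}^d$. For a step size $\eta>0$ let $(X_n,G_n)_{n\in\mathbb{N}}$ be the SAGA-LD process with step size $\eta$ (defined in the context). Then there is $\eta_0>0$ such that for every $0<\eta\leq\eta_0$ there exists a probability $\mu_*=\mu_*(\eta)$ on $\mathbb{R}^d\times\mathbb{R}^{Nd}$ such that $$d_{TV}(\mathrm{Law}(X_n,G_n),\mu_* )\to 0,\quad n\to\infty.$$ Moreover, for all measurable functions $\phi:\mathbb{R}^{(N+1)d}\to\mathbb{R}$ such that $|\phi(u)|\leq C(1+|u|)$ for all $u\in\mathbb{R}^{(N+1)d}$ with some $C>0$, $$E\left[\left|\frac{\phi(X_1,G_1)+\cdots+\phi(X_n,G_n)}{n}-\int_{\mathbb{R}^{(N+1)d}}\phi(u)\,\mu_*(du)\right|\right]\to 0,\quad n\to\infty.$$ A fortiori, the averages converge in probability.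
   Context: $\mathbb{N}=\{0,1,2,\ldots\}$; $\langle\cdot,\cdot\rangle$ is the scalar product of $\mathbb{R}^d$ and $|\cdot|$ the Euclidean norm of any $\mathbb{R}^m$. On a probability space $(\Omega,\mathcal{F},P)$ with expectation $E$, let $(\xi_n)_{n\in\mathbb{N}}$ be i.i.d. standard $d$-dimensional Gaussian random variables, $(S_n)_{n\in\mathbb{N}}$ i.i.d. random variables uniform on $\mathcal{N}:=\{1,\ldots,N\}$, and $X_0$ an $\mathbb{R}^d$-valued random variable; $X_0$, $(\xi_n)_{n\in\mathbb{N}}$, $(S_n)_{n\in\mathbb{N}}$ are independent. SAGA-LD process with step size $\eta>0$: the processes $X_n\in\mathbb{R}^d$ and $G_n=(G_n^1,\ldots,G_n^N)\in\mathbb{R}^{Nd}$ are given by $G_0^i:=F_i(X_0)$, $i=1,\ldots,N$, and, for $n\in\mathbb{N}$, $$G^i_{n+1}=1_{\{S_n\neq i\}}G^i_n+1_{\{S_n=i\}}F_i(X_n),\quad i=1,\ldots,N,$$ $$X_{n+1}=X_n-\frac{\eta}{N}\sum_{i=1}^N G_n^i-\eta\left(F_{S_n}(X_n)-G_n^{S_n}\right)+\sqrt{2\eta}\,\xi_{n+1}.$$ The total variation distance of two probabilities $\mu_1,\mu_2$ on the Borel sets of $\mathbb{R}^m$ is $d_{TV}(\mu_1,\mu_2):=\inf P(Y_1\neq Y_2)$, the infimum ranging over all pairs of random variables with $Y_1\sim\mu_1$, $Y_2\sim\mu_2$. *)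

theory Defs
  imports "HOL-Probability.Probability"
begin

text \<open>
  The type \<open>'n\<close> is the index set of the functions \<open>F\<close> (so \<open>N = CARD('n)\<close>), and
  \<open>real^'d^'n\<close> is the space of families \<open>(g\<^sup>i)\<close> of \<open>N\<close> vectors of dimension
  \<open>d = CARD('d)\<close>. The library norms on vectors and on pairs are both Euclidean, so \<open>norm\<close> on
  \<open>(real^'d) \<times> (real^'d^'n)\<close> is the Euclidean norm of dimension \<open>(N + 1) * d\<close>.
\<close>

primrec saga_ld ::
  "('n::finite \<Rightarrow> real^'d \<Rightarrow> real^'d) \<Rightarrow> real \<Rightarrow> ('w \<Rightarrow> real^'d) \<Rightarrow> (nat \<Rightarrow> 'w \<Rightarrow> real^'d)
    \<Rightarrow> (nat \<Rightarrow> 'w \<Rightarrow> 'n) \<Rightarrow> nat \<Rightarrow> 'w \<Rightarrow> (real^'d) \<times> (real^'d^'n)" where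
  "saga_ld F \<eta> X0 \<xi> S 0 = (\<lambda>\<omega>. (X0 \<omega>, \<chi> i. F i (X0 \<omega>)))"
| "saga_ld F \<eta> X0 \<xi> S (Suc n) = (\<lambda>\<omega>.
     let (x, g) = saga_ld F \<eta> X0 \<xi> S n \<omega>; s = S n \<omega> in
       (x - (\<eta> / real CARD('n)) *\<^sub>R (\<Sum>i\<in>UNIV. g $ i) - \<eta> *\<^sub>R (F s x - g $ s)
          + sqrt (2 * \<eta>) *\<^sub>R \<xi> (Suc n) \<omega>,
        \<chi> i. if s = i then F i x else g $ i))"

definition std_gaussian :: "'w measure \<Rightarrow> ('w \<Rightarrow> real^'d) \<Rightarrow> bool" where
  "std_gaussian P Z \<longleftrightarrow> distributed P lborel Z (\<lambda>x. ennreal (\<Prod>i\<in>UNIV. std_normal_density (x $ i)))"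

definition uniformly_distributed :: "'w measure \<Rightarrow> ('w \<Rightarrow> 'n::finite) \<Rightarrow> bool" where
  "uniformly_distributed P T \<longleftrightarrow>
     T \<in> measurable P (count_space UNIV) \<and>
     distr P (count_space UNIV) T = uniform_count_measure UNIV"

text \<open>
  Joint independence of a random vector and two random sequences. Each sequence enters through the
  sigma-algebra that it generates as a single variable with values in the product space.
  Independence within a sequence is not included.
\<close>

datatype source = Initial | Noise | Choice

definition independent_sources ::
  "'w measure \<Rightarrow> ('w \<Rightarrow> real^'d) \<Rightarrow> (nat \<Rightarrow> 'w \<Rightarrow> real^'d) \<Rightarrow> (nat \<Rightarrow> 'w \<Rightarrow> 'n) \<Rightarrow> bool" where
  "independent_sources P X0 \<xi> S \<longleftrightarrow> prob_space.indep_sets P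
     (case_source
        {X0 -` A \<inter> space P | A. A \<in> sets borel}
        {(\<lambda>\<omega> n. \<xi> n \<omega>) -` A \<inter> space P | A. A \<in> sets (Pi\<^sub>M UNIV (\<lambda>_::nat. borel))}
        {(\<lambda>\<omega> n. S n \<omega>) -` A \<inter> space P | A. A \<in> sets (Pi\<^sub>M UNIV (\<lambda>_::nat. count_space UNIV))})
     UNIV"

text \<open>
  The infimum ranges over all pairs of random variables with laws \<open>\<mu>1\<close> and \<open>\<mu>2\<close>. A definition
  cannot quantify over the type of sample points; samples in \<open>'a \<times> 'a\<close> suffice, because
  \<open>P (Y1 \<noteq> Y2)\<close> depends only on the joint law of the pair, which lives there.
\<close>

definition d_TV :: "'a::euclidean_space measure \<Rightarrow> 'a measure \<Rightarrow> real" where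
  "d_TV \<mu>1 \<mu>2 = Inf {measure Q {\<omega> \<in> space Q. Y1 \<omega> \<noteq> Y2 \<omega>} |
      (Q :: ('a \<times> 'a) measure) (Y1 :: 'a \<times> 'a \<Rightarrow> 'a) (Y2 :: 'a \<times> 'a \<Rightarrow> 'a).
      prob_space Q \<and> Y1 \<in> borel_measurable Q \<and> Y2 \<in> borel_measurable Q \<and>
      distr Q borel Y1 = \<mu>1 \<and> distr Q borel Y2 = \<mu>2}"

end

theory Submission
  imports Defs
begin

text \<open>
  The proof is Harris' theorem for the chain \<open>(X\<^sub>n, G\<^sub>n)\<close>. The Lyapunov function is
  \<open>W(x, g) = |x|\<^sup>2 + (1/N) \<Sum>\<^sub>i |g\<^sup>i - F\<^sub>i(x)|\<^sup>2\<close>: dissipativity contracts the first summand by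
  a factor \<open>1 - \<eta> c2\<close> in the mean, replacing one entry of the table contracts the second by
  \<open>1 - 1/(4N)\<close>, and the cross terms are of order \<open>\<eta>\<^sup>2\<close>. For the minorization, let the choices of
  \<open>N + 1\<close> consecutive steps visit every index after the first step. Then the table is a function of
  positions drawn on the way, whose joint density is bounded below on a product of balls, uniformly
  over starting points in a sublevel set of \<open>W\<close>.

  Drift and minorization give geometric contraction of functions bounded by \<open>1 + V\<close>, \<open>V = \<surd>W\<close>.
  Hence the laws are uniformly Cauchy on Borel sets, which yields the limit law, and the
  covariances of functions of linear growth along the chain decay geometrically, which bounds the
  second moment of the centred sums by a multiple of \<open>n\<close>.
\<close>

subsection \<open>Total variation distance and couplings\<close>

text \<open>The noise has dimension d and the state dimension (N + 1) d, so a single step never has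
  a density, and a minorization must wait until fresh randomness has reached every table entry. An
  entry receives the value of F_i at the position before the step; hence one preliminary step, which
  exchanges the given position for a random one, and then one visit to each index.

  All estimates are carried out on functions. Overlap reads: the m-step means of f at u and of g at
  v add up to at least \<alpha> whenever f + g >= 1. Contraction reads: the distance of the m-step
  mean of h from the constants shrinks. No transition kernel, minorizing measure or stationary law
  has to be constructed; the limit law comes out of the convergence itself.

  The square root of W is the right weight because it has linear growth, like \<phi>, while the
  product of two functions bounded by 1 + V is controlled by W. Covariances along the chain
  therefore ask for no moment of X_0 beyond the second.\<close>

definition sum_measure :: "'a measure \<Rightarrow> 'a measure \<Rightarrow> 'a measure" where
  "sum_measure M N = measure_of (space M) (sets M) (\<lambda>A. emeasure M A + emeasure N A)"

lemma space_sum_measure [simp]: "space (sum_measure M N) = space M"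
  and sets_sum_measure [simp, measurable_cong]: "sets (sum_measure M N) = sets M"
  by (simp_all add: sum_measure_def)

lemma emeasure_sum_measure:
  assumes "sets N = sets M" "A \<in> sets M"
  shows "emeasure (sum_measure M N) A = emeasure M A + emeasure N A"
  unfolding sum_measure_def
proof (rule emeasure_measure_of_sigma)
  show "sigma_algebra (space M) (sets M)" ..
  show "positive (sets M) (\<lambda>A. emeasure M A + emeasure N A)"
    by (simp add: positive_def)
  show "countably_additive (sets M) (\<lambda>A. emeasure M A + emeasure N A)"
    unfolding countably_additive_def
    using assms(1) by (auto simp: suminf_add[symmetric] suminf_emeasure)
qed fact

text \<open>The maximal coupling. With \<open>H\<close> a Hahn set of \<mu> - \<nu>, the common part
  \<open>L\<close> is \<nu> on \<open>H\<close> and \<mu> off \<open>H\<close>; the excess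
  \<open>\<alpha>\<close> of \<mu> on \<open>H\<close> and the excess \<open>\<beta>\<close> of
  \<nu> off \<open>H\<close> have the same mass \<open>p\<close>, at most \<epsilon>. Placing
  \<open>L\<close> on the diagonal and drawing the excesses independently, with total mass
  \<open>p\<close>, restores both marginals.\<close>

lemma exists_coupling:
  fixes \<mu> \<nu> :: "'a::euclidean_space measure"
  assumes mu: "prob_space \<mu>" "sets \<mu> = sets borel" and nu: "prob_space \<nu>" "sets \<nu> = sets borel"
    and close: "\<And>A. A \<in> sets borel \<Longrightarrow> \<bar>measure \<mu> A - measure \<nu> A\<bar> \<le> \<epsilon>"
  shows "\<exists>(Q :: ('a \<times> 'a) measure) Y1 Y2. prob_space Q \<and> Y1 \<in> borel_measurable Q \<and> Y2 \<in> borel_measurable Q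
    \<and> distr Q borel Y1 = \<mu> \<and> distr Q borel Y2 = \<nu> \<and> measure Q {\<omega>\<in>space Q. Y1 \<omega> \<noteq> Y2 \<omega>} \<le> \<epsilon>"
proof -
  interpret mu: prob_space \<mu> by fact
  interpret nu: prob_space \<nu> by fact
  note [measurable_cong] = mu(2) nu(2)
  have sp: "space \<mu> = UNIV" "space \<nu> = UNIV"
    using mu(2) nu(2) by (auto dest: sets_eq_imp_space_eq)
  obtain H where H: "H \<in> sets borel" and HM: "\<And>X. X \<in> sets borel \<Longrightarrow> X \<subseteq> H \<Longrightarrow> emeasure \<nu> X \<le> emeasure \<mu> X"
    and HN: "\<And>X. X \<in> sets borel \<Longrightarrow> X \<inter> H = {} \<Longrightarrow> emeasure \<mu> X \<le> emeasure \<nu> X"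
    using finite_unsigned_Hahn_decomposition[of \<mu> \<nu>] mu nu mu.finite_measure_axioms nu.finite_measure_axioms
    by auto
  note [measurable] = H
  let ?in = "\<lambda>M::'a measure. density M (indicator H)" and ?out = "\<lambda>M::'a measure. density M (indicator (- H))"
  have dens: "emeasure (density M (indicator B)) A = emeasure M (A \<inter> B)"
    if "sets M = sets borel" "A \<in> sets borel" "B \<in> sets borel" for M :: "'a measure" and A B
    using that by (simp add: emeasure_density measurable_cong_sets[OF that(1) refl] flip: indicator_inter_arith)
       (subst Int_commute, simp add: nn_integral_indicator)
  define L where "L = sum_measure (?in \<nu>) (?out \<mu>)"
  define \<alpha> where "\<alpha> = diff_measure (?in \<mu>) (?in \<nu>)"
  define \<beta> where "\<beta> = diff_measure (?out \<nu>) (?out \<mu>)"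
  have setsL [measurable_cong]: "sets L = sets borel" "sets \<alpha> = sets borel" "sets \<beta> = sets borel"
    by (simp_all add: L_def \<alpha>_def \<beta>_def mu nu)
  have eL: "emeasure L A = emeasure \<nu> (A \<inter> H) + emeasure \<mu> (A \<inter> - H)" if "A \<in> sets borel" for A
    unfolding L_def using that by (subst emeasure_sum_measure) (simp_all add: mu nu dens)
  have fin: "finite_measure (?in \<mu>)" "finite_measure (?in \<nu>)" "finite_measure (?out \<mu>)" "finite_measure (?out \<nu>)"
    by (auto intro!: finite_measureI simp: sp dens mu nu)
  have ea: "emeasure \<alpha> A = emeasure \<mu> (A \<inter> H) - emeasure \<nu> (A \<inter> H)" if "A \<in> sets borel" for A
    unfolding \<alpha>_def using that
    by (subst emeasure_diff_measure[OF fin(1) fin(2)]) (simp_all add: mu nu dens HM)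
  have eb: "emeasure \<beta> A = emeasure \<nu> (A \<inter> - H) - emeasure \<mu> (A \<inter> - H)" if "A \<in> sets borel" for A
    unfolding \<beta>_def using that
    by (subst emeasure_diff_measure[OF fin(4) fin(3)]) (simp_all add: mu nu dens, rule HN, auto)
  define p where "p = measure \<mu> H - measure \<nu> H"
  have p0: "p \<ge> 0"
    using HM[OF H order_refl] unfolding p_def by (simp add: mu.emeasure_eq_measure nu.emeasure_eq_measure)
  have pe: "p \<le> \<epsilon>" using close[OF H] p_def by simp
  have a1: "emeasure \<alpha> UNIV = ennreal p"
    unfolding p_def by (simp add: ea mu.emeasure_eq_measure nu.emeasure_eq_measure ennreal_minus)
  have b1: "emeasure \<beta> UNIV = ennreal p"
    unfolding p_def using mu.prob_compl[of H] nu.prob_compl[of H] H mu nu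
    by (simp add: eb mu.emeasure_eq_measure nu.emeasure_eq_measure ennreal_minus sp Compl_eq_Diff_UNIV)
  have fina: "finite_measure \<alpha>" "finite_measure \<beta>"
    using a1 b1 by (auto intro!: finite_measureI simp: sets_eq_imp_space_eq[OF setsL(2)] sets_eq_imp_space_eq[OF setsL(3)])
  interpret a: finite_measure \<alpha> by fact
  interpret b: finite_measure \<beta> by fact
  interpret ab: pair_sigma_finite \<alpha> \<beta> ..
  define Q :: "('a \<times> 'a) measure" where
    "Q = sum_measure (distr L (borel \<Otimes>\<^sub>M borel) (\<lambda>x. (x, x))) (scale_measure (1 / ennreal p) (\<alpha> \<Otimes>\<^sub>M \<beta>))"
  have setsQ [measurable_cong]: "sets Q = sets (borel \<Otimes>\<^sub>M borel)" by (simp add: Q_def)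
  have spQ: "space Q = UNIV" using sets_eq_imp_space_eq[OF setsQ] by (simp add: space_pair_measure)
  have eQ: "emeasure Q A = emeasure L ((\<lambda>x. (x, x)) -` A) + 1 / ennreal p * emeasure (\<alpha> \<Otimes>\<^sub>M \<beta>) A"
    if A: "A \<in> sets (borel \<Otimes>\<^sub>M borel)" for A
  proof -
    have "sets (\<alpha> \<Otimes>\<^sub>M \<beta>) = sets (borel \<Otimes>\<^sub>M borel)" by (intro sets_pair_measure_cong setsL)
    then show ?thesis
      unfolding Q_def using A
      by (subst emeasure_sum_measure) (simp_all add: emeasure_distr sets_eq_imp_space_eq[OF setsL(1)])
  qed
  \<comment> \<open>If \<open>p = 0\<close>, the factor \<open>1 / ennreal p\<close> is infinite,
    but it meets only vanishing masses, and infinity times 0 is 0. So one formula for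
    \<open>Q\<close> covers both cases.\<close>
  have cancel: "1 / ennreal p * (x * ennreal p) = x" if le: "x \<le> ennreal p" for x
  proof (cases "p = 0")
    case True
    with that show ?thesis by simp
  next
    case False
    with p0 have "p > 0" by simp
    obtain y where "0 \<le> y" "x = ennreal y"
      using le by (cases x) (auto simp: top_unique)
    then show ?thesis
      using \<open>p > 0\<close> divide_ennreal[of 1 p]
      by (simp add: ennreal_mult[symmetric])
  qed
  have split\<mu>: "emeasure M (A \<inter> H) + emeasure M (A \<inter> - H) = emeasure M A"
    if "sets M = sets borel" "A \<in> sets borel" for M :: "'a measure" and A
    using that plus_emeasure[of "A \<inter> H" M "A \<inter> - H"] by (simp add: Int_Un_distrib[symmetric] Int_assoc[symmetric])
  have le_p: "emeasure \<alpha> A \<le> ennreal p" "emeasure \<beta> A \<le> ennreal p" if "A \<in> sets borel" for A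
    using emeasure_mono[of A UNIV \<alpha>] emeasure_mono[of A UNIV \<beta>] setsL a1 b1 by auto
  have m1: "emeasure Q (A \<times> UNIV) = emeasure \<mu> A" if A: "A \<in> sets borel" for A
  proof -
    have "emeasure Q (A \<times> UNIV) = emeasure L A + emeasure \<alpha> A"
      using A le_p[OF A] by (simp add: eQ b.emeasure_pair_measure_Times setsL b1 cancel vimage_def)
    also have "\<dots> = (emeasure \<nu> (A \<inter> H) + (emeasure \<mu> (A \<inter> H) - emeasure \<nu> (A \<inter> H))) + emeasure \<mu> (A \<inter> - H)"
      using A by (simp add: eL ea ac_simps)
    also have "emeasure \<nu> (A \<inter> H) + (emeasure \<mu> (A \<inter> H) - emeasure \<nu> (A \<inter> H)) = emeasure \<mu> (A \<inter> H)"
      using A by (intro add_diff_inverse_ennreal HM) auto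
    finally show ?thesis using A by (simp add: split\<mu> mu)
  qed
  have m2: "emeasure Q (UNIV \<times> A) = emeasure \<nu> A" if A: "A \<in> sets borel" for A
  proof -
    have "emeasure Q (UNIV \<times> A) = emeasure L A + emeasure \<beta> A"
      using A le_p[OF A] by (simp add: eQ b.emeasure_pair_measure_Times setsL a1 cancel vimage_def mult.commute[of "ennreal p"])
    also have "\<dots> = emeasure \<nu> (A \<inter> H) + (emeasure \<mu> (A \<inter> - H) + (emeasure \<nu> (A \<inter> - H) - emeasure \<mu> (A \<inter> - H)))"
      using A by (simp add: eL eb ac_simps)
    also have "emeasure \<mu> (A \<inter> - H) + (emeasure \<nu> (A \<inter> - H) - emeasure \<mu> (A \<inter> - H)) = emeasure \<nu> (A \<inter> - H)"
      using A by (intro add_diff_inverse_ennreal HN) auto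
    finally show ?thesis using A by (simp add: split\<mu> nu)
  qed
  have D: "{x::'a \<times> 'a. fst x \<noteq> snd x} \<in> sets (borel \<Otimes>\<^sub>M borel)"
    unfolding borel_prod by (intro borel_open open_Collect_neq continuous_intros)
  have "emeasure Q {x. fst x \<noteq> snd x} \<le> ennreal p"
  proof -
    have "emeasure (\<alpha> \<Otimes>\<^sub>M \<beta>) {x. fst x \<noteq> snd x} \<le> emeasure (\<alpha> \<Otimes>\<^sub>M \<beta>) (UNIV \<times> UNIV)"
      by (rule emeasure_mono, simp, rule pair_measureI) (simp_all add: setsL)
    also have "\<dots> = ennreal p * ennreal p"
      by (subst b.emeasure_pair_measure_Times) (simp_all add: setsL a1 b1)
    finally have "1 / ennreal p * emeasure (\<alpha> \<Otimes>\<^sub>M \<beta>) {x. fst x \<noteq> snd x} \<le> 1 / ennreal p * (ennreal p * ennreal p)"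
      by (rule mult_left_mono) simp
    then show ?thesis using D by (simp add: eQ cancel vimage_def)
  qed
  moreover have "prob_space Q"
    using m1[of UNIV] mu.emeasure_space_1 by (intro prob_spaceI) (simp add: spQ sp)
  moreover have "distr Q borel fst = \<mu>" "distr Q borel snd = \<nu>"
  proof -
    have *: "fst -` A \<inter> space Q = A \<times> UNIV" "snd -` A \<inter> space Q = UNIV \<times> A" for A
      by (auto simp: spQ)
    show "distr Q borel fst = \<mu>" "distr Q borel snd = \<nu>"
      by (auto intro!: measure_eqI simp: mu nu emeasure_distr * m1 m2)
  qed
  moreover have "measure Q {\<omega>\<in>space Q. fst \<omega> \<noteq> snd \<omega>} \<le> \<epsilon>" if "emeasure Q {x. fst x \<noteq> snd x} \<le> ennreal p"
    using enn2real_mono[OF that] p0 pe by (simp add: spQ measure_def)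
  ultimately have "prob_space Q \<and> fst \<in> borel_measurable Q \<and> snd \<in> borel_measurable Q
    \<and> distr Q borel fst = \<mu> \<and> distr Q borel snd = \<nu> \<and> measure Q {\<omega>\<in>space Q. fst \<omega> \<noteq> snd \<omega>} \<le> \<epsilon>"
    by simp
  then show ?thesis by blast
qed

text \<open>The infimum is taken in the reals, so its bounds are meaningful only if some coupling
  exists; the trivial bound 1 for differences of probabilities yields one.\<close>

lemma d_TV_nonneg:
  fixes \<mu> \<nu> :: "'a::euclidean_space measure"
  assumes "prob_space \<mu>" "sets \<mu> = sets borel" "prob_space \<nu>" "sets \<nu> = sets borel"
  shows "0 \<le> d_TV \<mu> \<nu>"
proof -
  interpret mu: prob_space \<mu> by fact
  interpret nu: prob_space \<nu> by fact
  have "\<bar>measure \<mu> A - measure \<nu> A\<bar> \<le> 1" for A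
    using mu.prob_le_1[of A] nu.prob_le_1[of A] measure_nonneg[of \<mu> A] measure_nonneg[of \<nu> A] by linarith
  from exists_coupling[OF assms this] show ?thesis
    unfolding d_TV_def by (intro cInf_greatest) auto
qed

lemma d_TV_le:
  fixes \<mu> \<nu> :: "'a::euclidean_space measure"
  assumes "prob_space \<mu>" "sets \<mu> = sets borel" "prob_space \<nu>" "sets \<nu> = sets borel"
    and "\<And>A. A \<in> sets borel \<Longrightarrow> \<bar>measure \<mu> A - measure \<nu> A\<bar> \<le> \<epsilon>"
  shows "d_TV \<mu> \<nu> \<le> \<epsilon>"
proof -
  obtain Q :: "('a \<times> 'a) measure" and Y1 Y2 where Q: "prob_space Q" "Y1 \<in> borel_measurable Q" "Y2 \<in> borel_measurable Q"
    "distr Q borel Y1 = \<mu>" "distr Q borel Y2 = \<nu>" and le: "measure Q {\<omega>\<in>space Q. Y1 \<omega> \<noteq> Y2 \<omega>} \<le> \<epsilon>"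
    using exists_coupling[OF assms] by blast
  have "d_TV \<mu> \<nu> \<le> measure Q {\<omega>\<in>space Q. Y1 \<omega> \<noteq> Y2 \<omega>}"
    unfolding d_TV_def using Q by (intro cInf_lower bdd_belowI[of _ 0]) auto
  with le show ?thesis by simp
qed

text \<open>Under a coupling of the two laws the integrands agree except on an event of probability
  at most \<epsilon>, where they differ by at most 2 B.\<close>

lemma integral_diff_le_of_close:
  fixes \<mu> \<nu> :: "'a::euclidean_space measure" and h :: "'a \<Rightarrow> real"
  assumes "prob_space \<mu>" "sets \<mu> = sets borel" "prob_space \<nu>" "sets \<nu> = sets borel"
    and "\<And>A. A \<in> sets borel \<Longrightarrow> \<bar>measure \<mu> A - measure \<nu> A\<bar> \<le> \<epsilon>"
    and [measurable]: "h \<in> borel_measurable borel" and bound: "\<And>x. \<bar>h x\<bar> \<le> B"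
  shows "\<bar>(\<integral>x. h x \<partial>\<mu>) - (\<integral>x. h x \<partial>\<nu>)\<bar> \<le> 2 * B * \<epsilon>"
proof -
  obtain Q :: "('a \<times> 'a) measure" and Y1 Y2 where Q: "prob_space Q" and [measurable]: "Y1 \<in> borel_measurable Q" "Y2 \<in> borel_measurable Q"
    and Y: "distr Q borel Y1 = \<mu>" "distr Q borel Y2 = \<nu>" and le: "measure Q {\<omega>\<in>space Q. Y1 \<omega> \<noteq> Y2 \<omega>} \<le> \<epsilon>"
    using exists_coupling[OF assms(1-5)] by blast
  interpret Q: prob_space Q by fact
  have B: "B \<ge> 0" using bound[of undefined] by linarith
  have int [simp]: "integrable Q (\<lambda>x. h (Y1 x))" "integrable Q (\<lambda>x. h (Y2 x))"
    by (auto intro!: Q.integrable_const_bound[of _ B] simp: bound)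
  have eq: "(\<integral>x. h x \<partial>\<mu>) - (\<integral>x. h x \<partial>\<nu>) = (\<integral>\<omega>. h (Y1 \<omega>) - h (Y2 \<omega>) \<partial>Q)"
    unfolding Y[symmetric] by (simp add: integral_distr)
  have [measurable]: "{\<omega>\<in>space Q. Y1 \<omega> \<noteq> Y2 \<omega>} \<in> sets Q" by measurable
  have "\<bar>\<integral>\<omega>. h (Y1 \<omega>) - h (Y2 \<omega>) \<partial>Q\<bar> \<le> (\<integral>\<omega>. \<bar>h (Y1 \<omega>) - h (Y2 \<omega>)\<bar> \<partial>Q)"
    using integral_norm_bound[of Q "\<lambda>\<omega>. h (Y1 \<omega>) - h (Y2 \<omega>)"] by simp
  also have "\<dots> \<le> (\<integral>\<omega>. 2 * B * indicator {\<omega>\<in>space Q. Y1 \<omega> \<noteq> Y2 \<omega>} \<omega> \<partial>Q)"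
  proof (rule integral_mono)
    fix \<omega> assume "\<omega> \<in> space Q"
    then show "\<bar>h (Y1 \<omega>) - h (Y2 \<omega>)\<bar> \<le> 2 * B * indicator {\<omega>\<in>space Q. Y1 \<omega> \<noteq> Y2 \<omega>} \<omega>"
      using bound[of "Y1 \<omega>"] bound[of "Y2 \<omega>"] by (auto simp: indicator_def)
  qed (auto simp: less_top[symmetric])
  also have "\<dots> = 2 * B * measure Q {\<omega>\<in>space Q. Y1 \<omega> \<noteq> Y2 \<omega>}" by simp
  also have "\<dots> \<le> 2 * B * \<epsilon>" using B le by (intro mult_left_mono) auto
  finally show ?thesis using eq by simp
qed

text \<open>Setwise limits are finitely additive for free. The uniform rate supplies continuity at
  the empty set: one fixed \<open>\<mu> N\<close> is close to the limit on all sets at once, and the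
  continuity of that single measure takes over.\<close>

lemma uniformly_Cauchy_prob_limit:
  fixes \<mu> :: "nat \<Rightarrow> 'a measure"
  assumes prob: "\<And>n. prob_space (\<mu> n)" and sets: "\<And>n. sets (\<mu> n) = sets M"
    and cauchy: "\<And>n k A. A \<in> sets M \<Longrightarrow> \<bar>measure (\<mu> (n + k)) A - measure (\<mu> n) A\<bar> \<le> r n"
    and r: "r \<longlonglongrightarrow> 0"
  shows "\<exists>\<nu>. prob_space \<nu> \<and> sets \<nu> = sets M \<and> (\<forall>n. \<forall>A\<in>sets M. \<bar>measure (\<mu> n) A - measure \<nu> A\<bar> \<le> r n)"
proof -
  interpret mu: prob_space "\<mu> n" for n by fact
  have sp: "space (\<mu> n) = space M" for n using sets by (rule sets_eq_imp_space_eq)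
  define L where "L A = lim (\<lambda>n. measure (\<mu> n) A)" for A
  have lim: "(\<lambda>n. measure (\<mu> n) A) \<longlonglongrightarrow> L A" if A: "A \<in> sets M" for A
  proof -
    have "Cauchy (\<lambda>n. measure (\<mu> n) A)"
    proof (rule metric_CauchyI)
      fix e :: real assume "e > 0"
      then obtain N where N: "\<And>n. n \<ge> N \<Longrightarrow> \<bar>r n\<bar> < e / 2"
        using r[THEN LIMSEQ_D, of "e / 2"] by auto
      have "dist (measure (\<mu> m) A) (measure (\<mu> n) A) < e" if "m \<ge> N" "n \<ge> N" for m n
        using cauchy[OF A, of N "m - N"] cauchy[OF A, of N "n - N"] N[of N] that
        by (simp add: dist_real_def)
      then show "\<exists>N. \<forall>m\<ge>N. \<forall>n\<ge>N. dist (measure (\<mu> m) A) (measure (\<mu> n) A) < e" by blast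
    qed
    then show ?thesis unfolding L_def by (simp add: Cauchy_convergent_iff convergent_LIMSEQ_iff)
  qed
  have close: "\<bar>measure (\<mu> n) A - L A\<bar> \<le> r n" if A: "A \<in> sets M" for n A
  proof -
    have "(\<lambda>k. \<bar>measure (\<mu> n) A - measure (\<mu> (n + k)) A\<bar>) \<longlonglongrightarrow> \<bar>measure (\<mu> n) A - L A\<bar>"
      using LIMSEQ_ignore_initial_segment[OF lim[OF A], of n] by (intro tendsto_intros) (simp add: add.commute)
    then show ?thesis
      by (rule LIMSEQ_le_const2) (metis abs_minus_commute cauchy[OF A])
  qed
  have L0: "0 \<le> L A" if "A \<in> sets M" for A
    using lim[OF that] by (rule LIMSEQ_le_const) simp
  have L1: "L (space M) = 1"
    using lim[of "space M"] mu.prob_space by (simp add: sp LIMSEQ_const_iff)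
  have Ladd: "L (A \<union> B) = L A + L B" if "A \<in> sets M" "B \<in> sets M" "A \<inter> B = {}" for A B
  proof -
    have "(\<lambda>n. measure (\<mu> n) A + measure (\<mu> n) B) \<longlonglongrightarrow> L A + L B"
      using that by (intro tendsto_intros lim)
    moreover have "measure (\<mu> n) A + measure (\<mu> n) B = measure (\<mu> n) (A \<union> B)" for n
      using that by (simp add: mu.finite_measure_Union sets)
    ultimately show ?thesis
      using lim[of "A \<union> B"] that by (simp add: LIMSEQ_unique)
  qed
  define \<nu> where "\<nu> = measure_of (space M) (sets M) (\<lambda>A. ennreal (L A))"
  have pos: "positive (sets M) (\<lambda>A. ennreal (L A))"
    using lim[of "{}"] by (simp add: positive_def LIMSEQ_const_iff)
  have ca: "countably_additive (sets M) (\<lambda>A. ennreal (L A))"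
  proof (rule sets.empty_continuous_imp_countably_additive[OF pos])
    show "additive (sets M) (\<lambda>A. ennreal (L A))"
      by (auto simp: additive_def Ladd L0 ennreal_plus)
    fix A :: "nat \<Rightarrow> 'a set" assume A: "range A \<subseteq> sets M" "decseq A" "(\<Inter>i. A i) = {}"
    have "(\<lambda>i. L (A i)) \<longlonglongrightarrow> 0"
    proof (rule LIMSEQ_I)
      fix e :: real assume "e > 0"
      then obtain N where N: "\<bar>r N\<bar> < e / 2"
        using r[THEN LIMSEQ_D, of "e / 2"] by auto
      have "(\<lambda>i. measure (\<mu> N) (A i)) \<longlonglongrightarrow> measure (\<mu> N) (\<Inter>i. A i)"
        using A by (intro mu.finite_Lim_measure_decseq) (auto simp: sets)
      then have "(\<lambda>i. measure (\<mu> N) (A i)) \<longlonglongrightarrow> 0" by (simp add: A(3))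
      from LIMSEQ_D[OF this, of "e / 2"] \<open>e > 0\<close>
      obtain I where I: "\<And>i. i \<ge> I \<Longrightarrow> \<bar>measure (\<mu> N) (A i)\<bar> < e / 2"
        by (metis diff_zero half_gt_zero real_norm_def)
      have "norm (L (A i) - 0) < e" if "i \<ge> I" for i
      proof -
        have "A i \<in> sets M" using A(1) by auto
        from close[OF this, of N] L0[OF this] I[OF that] N show ?thesis by auto
      qed
      then show "\<exists>I. \<forall>i\<ge>I. norm (L (A i) - 0) < e" by blast
    qed
    then show "(\<lambda>i. ennreal (L (A i))) \<longlonglongrightarrow> 0"
      using tendsto_ennrealI by fastforce
  qed auto
  have e: "emeasure \<nu> A = ennreal (L A)" if "A \<in> sets M" for A
    unfolding \<nu>_def using that by (intro emeasure_measure_of_sigma pos ca) (auto intro: sets.sigma_algebra_axioms)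
  have m: "measure \<nu> A = L A" if "A \<in> sets M" for A
    using e[OF that] L0[OF that] by (simp add: measure_def)
  have "prob_space \<nu>"
    by (rule prob_spaceI) (simp add: e[of "space M"] L1 \<nu>_def[THEN arg_cong[where f=space]])
  moreover have "sets \<nu> = sets M" by (simp add: \<nu>_def)
  ultimately show ?thesis using close m by auto
qed

subsection \<open>Contraction for random dynamical systems\<close>

text \<open>Passes from oscillation to \<open>near_const\<close>: a bound on differences of values
  at two points becomes closeness to a single constant, the supremum of \<open>f\<close>.\<close>

lemma real_separation:
  fixes f g :: "'a \<Rightarrow> real"
  assumes "\<And>u v. f u \<le> g v"
  shows "\<exists>c. \<forall>u. f u \<le> c \<and> c \<le> g u"
proof (intro exI allI conjI)
  fix u
  show "f u \<le> (SUP u. f u)"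
    using assms by (intro cSUP_upper bdd_aboveI2[of _ _ "g u"]) auto
  show "(SUP u. f u) \<le> g u"
    using assms by (intro cSUP_least) auto
qed

text \<open>Jensen's inequality for the square, read off from the nonnegativity of the variance. It
  serves the drift of \<open>V\<close> and, later, the passage from second moments to L1
  convergence.\<close>

lemma (in prob_space) expectation_le_sqrt:
  fixes X :: "'a \<Rightarrow> real"
  assumes [simp]: "integrable M (\<lambda>x. (X x)\<^sup>2)" and [measurable]: "X \<in> borel_measurable M"
  shows "integrable M X" "expectation X \<le> sqrt (expectation (\<lambda>x. (X x)\<^sup>2))"
proof -
  show X [simp]: "integrable M X"
  proof (rule Bochner_Integration.integrable_bound[of M "\<lambda>x. 1 + (X x)\<^sup>2"])
    have "\<bar>X x\<bar> \<le> 1 + (X x)\<^sup>2" for x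
      using zero_le_power2[of "\<bar>X x\<bar> - 1"] by (simp add: power2_eq_square algebra_simps)
    then show "AE x in M. norm (X x) \<le> norm (1 + (X x)\<^sup>2)" by simp
  qed auto
  have "0 \<le> variance X" by simp
  also have "variance X = expectation (\<lambda>x. (X x)\<^sup>2) - (expectation X)\<^sup>2"
    by (rule variance_eq) auto
  finally show "expectation X \<le> sqrt (expectation (\<lambda>x. (X x)\<^sup>2))"
    by (intro real_le_rsqrt) simp
qed

text \<open>The transition kernel is the law of \<open>\<Phi> u z\<close> under \<zeta> and is never
  formed as a measure. The drift bounds a nonnegative integral, so integrability of \<open>W\<close>
  after one step is a consequence (\<open>W_step\<close>).\<close>

locale random_system = zeta: prob_space \<zeta> for \<zeta> :: "'z measure" +
  fixes \<Phi> :: "'a::euclidean_space \<Rightarrow> 'z \<Rightarrow> 'a" and W :: "'a \<Rightarrow> real" and lam b :: real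
  assumes Phi_measurable: "case_prod \<Phi> \<in> measurable (borel \<Otimes>\<^sub>M \<zeta>) borel"
    and W_measurable [measurable]: "W \<in> borel_measurable borel"
    and W_nonneg [simp]: "0 \<le> W u"
    and lam: "0 \<le> lam" "lam < 1" and b: "0 \<le> b"
    and drift: "(\<integral>\<^sup>+z. ennreal (W (\<Phi> u z)) \<partial>\<zeta>) \<le> ennreal (lam * W u + b)"
begin

definition V :: "'a \<Rightarrow> real" where "V u = sqrt (W u)"

definition T :: "('a \<Rightarrow> real) \<Rightarrow> 'a \<Rightarrow> real" where
  "T h u = (\<integral>z. h (\<Phi> u z) \<partial>\<zeta>)"

text \<open>The operator \<open>T\<close> with extended nonnegative values: it acts on all
  measurable functions of this kind without integrability conditions, which suits lower bounds;
  \<open>ennreal_funpow_T\<close> links the two.\<close>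

definition Tnn :: "('a \<Rightarrow> ennreal) \<Rightarrow> 'a \<Rightarrow> ennreal" where
  "Tnn h u = (\<integral>\<^sup>+z. h (\<Phi> u z) \<partial>\<zeta>)"

definition wbounded :: "('a \<Rightarrow> real) \<Rightarrow> bool" where
  "wbounded h \<longleftrightarrow> h \<in> borel_measurable borel \<and> (\<exists>k. \<forall>u. \<bar>h u\<bar> \<le> k * (1 + V u))"

lemma Phi_measurable' [measurable (raw)]:
  assumes "f \<in> measurable N borel" "g \<in> measurable N \<zeta>"
  shows "(\<lambda>x. \<Phi> (f x) (g x)) \<in> measurable N borel"
  using measurable_compose[OF measurable_Pair[OF assms] Phi_measurable] by simp

lemma V_measurable [measurable]: "V \<in> borel_measurable borel"
  unfolding V_def by measurable

lemma V_nonneg [simp]: "0 \<le> V u" by (simp add: V_def)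

lemma V_sq: "(V u)\<^sup>2 = W u" by (simp add: V_def)

lemma V_le: "V u \<le> 1 + W u"
  using zero_le_power2[of "V u - 1"] V_sq[of u] V_nonneg[of u] by (simp add: power2_diff del: V_nonneg)

lemma W_step: "integrable \<zeta> (\<lambda>z. W (\<Phi> u z))" "T W u \<le> lam * W u + b"
proof -
  show int: "integrable \<zeta> (\<lambda>z. W (\<Phi> u z))"
    using order.strict_trans1[OF drift[of u] ennreal_less_top]
    by (intro integrableI_nonneg) auto
  have "ennreal (T W u) \<le> ennreal (lam * W u + b)"
    using drift[of u] by (subst (asm) nn_integral_eq_integral[OF int]) (simp_all add: T_def)
  then show "T W u \<le> lam * W u + b"
    using lam b by (subst (asm) ennreal_le_iff) auto
qed

text \<open>Jensen moves the mean inside the square root, and subadditivity of the root splits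
  \<open>lam * W u + b\<close>; so \<open>V\<close> inherits the drift with the roots of both
  constants.\<close>

lemma V_step: "integrable \<zeta> (\<lambda>z. V (\<Phi> u z))" "T V u \<le> sqrt lam * V u + sqrt b"
proof -
  have *: "integrable \<zeta> (\<lambda>z. (V (\<Phi> u z))\<^sup>2)" by (simp add: V_sq W_step)
  show "integrable \<zeta> (\<lambda>z. V (\<Phi> u z))"
    by (rule zeta.expectation_le_sqrt[OF *]) simp
  have "T V u \<le> sqrt (\<integral>z. (V (\<Phi> u z))\<^sup>2 \<partial>\<zeta>)"
    unfolding T_def by (rule zeta.expectation_le_sqrt[OF *]) simp
  also have "\<dots> \<le> sqrt (lam * W u + b)"
    using W_step(2)[of u] by (simp add: V_sq T_def)
  also have "\<dots> \<le> sqrt (lam * W u) + sqrt b"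
    using lam b by (intro sqrt_add_le_add_sqrt) auto
  also have "sqrt (lam * W u) = sqrt lam * V u" by (simp add: V_def real_sqrt_mult)
  finally show "T V u \<le> sqrt lam * V u + sqrt b" .
qed

section \<open>The function class weighted by \<open>1 + V\<close> and the Markov operator on
  it\<close>

lemma wboundedI:
  "h \<in> borel_measurable borel \<Longrightarrow> (\<And>u. \<bar>h u\<bar> \<le> k * (1 + V u)) \<Longrightarrow> wbounded h"
  by (auto simp: wbounded_def)

lemma wbounded_measurable: "wbounded h \<Longrightarrow> h \<in> borel_measurable borel"
  by (simp add: wbounded_def)

lemma wboundedE:
  assumes "wbounded h"
  obtains k where "0 \<le> k" "\<And>u. \<bar>h u\<bar> \<le> k * (1 + V u)"
proof -
  obtain k where k: "\<And>u. \<bar>h u\<bar> \<le> k * (1 + V u)" using assms by (auto simp: wbounded_def)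
  have "0 \<le> k * (1 + V undefined)" using k[of undefined] by linarith
  then have "0 \<le> k" by (simp add: zero_le_mult_iff add_nonneg_eq_0_iff not_le)
    (metis V_nonneg add_nonneg_pos less_le_not_le zero_less_one add.commute)
  with k that show ?thesis by blast
qed

lemma wbounded_const [simp]: "wbounded (\<lambda>_. c)"
  by (rule wboundedI[of _ "\<bar>c\<bar>"]) (auto simp: mult_le_cancel_left1)

lemma wbounded_V [simp]: "wbounded V"
  by (rule wboundedI[of _ 1]) auto

lemma wbounded_cmult: "wbounded f \<Longrightarrow> wbounded (\<lambda>u. c * f u)"
  unfolding wbounded_def
proof (elim conjE exE, intro conjI)
  fix k assume "\<forall>u. \<bar>f u\<bar> \<le> k * (1 + V u)"
  then show "\<exists>k. \<forall>u. \<bar>c * f u\<bar> \<le> k * (1 + V u)"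
    by (intro exI[of _ "\<bar>c\<bar> * k"]) (auto simp: abs_mult mult.assoc intro!: mult_left_mono)
qed simp

lemma wbounded_add:
  assumes "wbounded f" "wbounded g" shows "wbounded (\<lambda>u. f u + g u)"
proof -
  obtain k l where kl: "\<And>u. \<bar>f u\<bar> \<le> k * (1 + V u)" "\<And>u. \<bar>g u\<bar> \<le> l * (1 + V u)"
    using assms by (metis wboundedE)
  note [measurable] = assms[THEN wbounded_measurable]
  show ?thesis
  proof (rule wboundedI[of _ "k + l"])
    show "\<bar>f u + g u\<bar> \<le> (k + l) * (1 + V u)" for u
      using kl[of u] by (simp add: distrib_right)
  qed simp
qed

lemma wbounded_diff: "wbounded f \<Longrightarrow> wbounded g \<Longrightarrow> wbounded (\<lambda>u. f u - g u)"
  using wbounded_add[of f "\<lambda>u. -1 * g u"] wbounded_cmult[of g "-1"] by simp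

lemma wbounded_integrable:
  assumes "wbounded h" shows "integrable \<zeta> (\<lambda>z. h (\<Phi> u z))"
proof -
  obtain k where k: "0 \<le> k" "\<And>u. \<bar>h u\<bar> \<le> k * (1 + V u)" using assms by (rule wboundedE) blast
  note [measurable] = wbounded_measurable[OF assms]
  show ?thesis
    by (rule Bochner_Integration.integrable_bound[of _ "\<lambda>z. k * (1 + V (\<Phi> u z))"])
       (use k in \<open>auto simp: V_step\<close>)
qed

lemma T_mono:
  assumes "wbounded f" "wbounded g" "\<And>u. f u \<le> g u" shows "T f u \<le> T g u"
  unfolding T_def using assms by (intro integral_mono wbounded_integrable) auto

lemma T_add: "wbounded f \<Longrightarrow> wbounded g \<Longrightarrow> T (\<lambda>u. f u + g u) = (\<lambda>u. T f u + T g u)"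
  by (auto simp: T_def wbounded_integrable)

lemma T_cmult: "T (\<lambda>u. c * f u) = (\<lambda>u. c * T f u)"
  by (auto simp: T_def)

lemma T_const [simp]: "T (\<lambda>_. c) = (\<lambda>_. c)"
  by (auto simp: T_def zeta.prob_space)

text \<open>The drift bounds \<open>T V\<close> by \<open>V\<close> plus a constant, so the class is
  preserved and all iterates of \<open>T\<close> are given by convergent integrals.\<close>

lemma wbounded_T:
  assumes "wbounded h" shows "wbounded (T h)"
proof -
  obtain k where k: "0 \<le> k" "\<And>u. \<bar>h u\<bar> \<le> k * (1 + V u)" using assms by (rule wboundedE) blast
  note [measurable] = wbounded_measurable[OF assms]
  have w: "wbounded (\<lambda>u. k * (1 + V u))" by (intro wbounded_cmult wbounded_add) auto
  have Tw: "T (\<lambda>u. k * (1 + V u)) u \<le> k * (1 + sqrt b) * (1 + V u)" for u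
  proof -
    have "sqrt lam * V u \<le> 1 * V u" using lam by (intro mult_right_mono) auto
    then have "T V u \<le> V u + sqrt b" using V_step(2)[of u] by linarith
    also have "\<dots> \<le> V u + sqrt b + sqrt b * V u" using b by simp
    finally have "k * (1 + T V u) \<le> k * ((1 + sqrt b) * (1 + V u))"
      using k(1) by (intro mult_left_mono) (auto simp: algebra_simps)
    then show ?thesis by (simp add: T_cmult T_add mult.assoc)
  qed
  show ?thesis
  proof (rule wboundedI[of _ "k * (1 + sqrt b)"])
    show "T h \<in> borel_measurable borel"
      unfolding T_def by (intro zeta.borel_measurable_lebesgue_integral) simp
    fix u
    have "T h u \<le> T (\<lambda>u. k * (1 + V u)) u"
      using k(2) by (intro T_mono assms w) (smt (verit))
    moreover have "T (\<lambda>u. - 1 * (k * (1 + V u))) u \<le> T h u"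
      using k(2) by (intro T_mono assms w wbounded_cmult) (smt (verit))
    ultimately show "\<bar>T h u\<bar> \<le> k * (1 + sqrt b) * (1 + V u)"
      using Tw[of u] unfolding T_cmult by linarith
  qed
qed

lemma wbounded_funpow_T: "wbounded h \<Longrightarrow> wbounded ((T ^^ n) h)"
  by (induction n) (auto intro: wbounded_T)

lemma funpow_T_mono:
  "wbounded f \<Longrightarrow> wbounded g \<Longrightarrow> (\<And>u. f u \<le> g u) \<Longrightarrow> (T ^^ n) f u \<le> (T ^^ n) g u"
  by (induction n arbitrary: u) (auto intro!: T_mono wbounded_funpow_T)

lemma funpow_T_add:
  "wbounded f \<Longrightarrow> wbounded g \<Longrightarrow> (T ^^ n) (\<lambda>u. f u + g u) = (\<lambda>u. (T ^^ n) f u + (T ^^ n) g u)"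
  by (induction n) (auto simp: T_add wbounded_funpow_T)

lemma funpow_T_cmult: "(T ^^ n) (\<lambda>u. c * f u) = (\<lambda>u. c * (T ^^ n) f u)"
  by (induction n) (auto simp: T_cmult)

lemma funpow_T_const [simp]: "(T ^^ n) (\<lambda>_. c) = (\<lambda>_. c)"
  by (induction n) auto

lemma funpow_T_affine:
  "wbounded f \<Longrightarrow> (T ^^ n) (\<lambda>u. c + s * f u) = (\<lambda>u. c + s * (T ^^ n) f u)"
  by (simp add: funpow_T_add funpow_T_cmult wbounded_cmult)

text \<open>The fixed point of the affine recursion t = sqrt lam * t + sqrt b behind
  \<open>V_step\<close>; it bounds the additive part of all iterates of \<open>V\<close> at
  once.\<close>

definition B where "B = sqrt b / (1 - sqrt lam)"

lemma sqrt_lam: "0 \<le> sqrt lam" "sqrt lam < 1" using lam by auto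

lemma B_nonneg: "0 \<le> B" unfolding B_def using sqrt_lam b by auto

lemma funpow_T_V: "(T ^^ n) V u \<le> sqrt lam ^ n * V u + B"
proof (induction n)
  case 0 then show ?case using B_nonneg by simp
next
  case (Suc n)
  have "(T ^^ Suc n) V u = (T ^^ n) (T V) u" by (simp add: funpow_swap1)
  also have "\<dots> \<le> (T ^^ n) (\<lambda>u. sqrt b + sqrt lam * V u) u"
    using V_step(2) by (intro funpow_T_mono wbounded_T wbounded_add wbounded_cmult) (auto simp: add.commute)
  also have "\<dots> = sqrt b + sqrt lam * (T ^^ n) V u"
    by (simp add: funpow_T_affine)
  also have "\<dots> \<le> sqrt b + sqrt lam * (sqrt lam ^ n * V u + B)"
    using Suc.IH sqrt_lam by (intro add_left_mono mult_left_mono) auto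
  also have "\<dots> = sqrt lam ^ Suc n * V u + (sqrt b + sqrt lam * B)"
    by (simp add: algebra_simps)
  also have "sqrt b + sqrt lam * B = B"
    using sqrt_lam unfolding B_def by (simp add: field_simps)
  finally show ?case .
qed

lemma ennreal_T:
  assumes "wbounded f" "\<And>u. 0 \<le> f u"
  shows "ennreal (T f u) = Tnn (\<lambda>u. ennreal (f u)) u"
  unfolding T_def Tnn_def using assms wbounded_integrable[OF assms(1)]
  by (intro nn_integral_eq_integral[symmetric]) auto

lemma ennreal_funpow_T:
  assumes "wbounded f" "\<And>u. 0 \<le> f u"
  shows "ennreal ((T ^^ n) f u) = (Tnn ^^ n) (\<lambda>u. ennreal (f u)) u"
proof (induction n arbitrary: u)
  case 0 then show ?case by simp
next
  case (Suc n)
  have "0 \<le> (T ^^ n) f u" for u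
    using funpow_T_mono[of "\<lambda>_. 0" f n u] assms by simp
  then have "ennreal (T ((T ^^ n) f) u) = Tnn (\<lambda>u. ennreal ((T ^^ n) f u)) u"
    by (intro ennreal_T wbounded_funpow_T assms)
  with Suc.IH show ?case by simp
qed

text \<open>The weighted supremum norm modulo constants: \<open>k\<close> bounds the distance of
  \<open>h\<close> from the constants. The operator fixes constants, so only in this quotient can it
  be a strict contraction.\<close>

definition near_const :: "real \<Rightarrow> ('a \<Rightarrow> real) \<Rightarrow> real \<Rightarrow> bool" where
  "near_const \<beta> h k \<longleftrightarrow> (\<exists>c. \<forall>u. \<bar>h u - c\<bar> \<le> k * (1 + \<beta> * V u))"

end

text \<open>Dual form of the overlap of the m-step laws from \<open>u\<close> and \<open>v\<close>.
  For \<open>f\<close> the indicator of a set and g = 1 - f it says that the two laws differ on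
  every set by at most 1 - \<alpha>. The weighted argument uses functions whose sum exceeds
  1.\<close>

locale harris_system = random_system +
  fixes m :: nat
  assumes m: "m \<ge> 1"
    and overlap: "\<And>R. \<exists>\<alpha>>0. \<forall>u v f g. W u \<le> R \<longrightarrow> W v \<le> R \<longrightarrow> f \<in> borel_measurable borel \<longrightarrow>
      g \<in> borel_measurable borel \<longrightarrow> (\<forall>x. 1 \<le> f x + g x) \<longrightarrow>
      ennreal \<alpha> \<le> (Tnn ^^ m) f u + (Tnn ^^ m) g v"
begin

lemma overlap_real:
  "\<exists>\<alpha>>0. \<forall>u v f g. V u \<le> R \<longrightarrow> V v \<le> R \<longrightarrow> wbounded f \<longrightarrow> wbounded g \<longrightarrow>
      (\<forall>x. 0 \<le> f x \<and> 0 \<le> g x \<and> 1 \<le> f x + g x) \<longrightarrow> \<alpha> \<le> (T ^^ m) f u + (T ^^ m) g v"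
proof -
  obtain \<alpha> where \<alpha>: "\<alpha> > 0" and ov: "\<And>u v f g. W u \<le> R\<^sup>2 \<Longrightarrow> W v \<le> R\<^sup>2 \<Longrightarrow> f \<in> borel_measurable borel \<Longrightarrow>
      g \<in> borel_measurable borel \<Longrightarrow> (\<forall>x. 1 \<le> f x + g x) \<Longrightarrow>
      ennreal \<alpha> \<le> (Tnn ^^ m) f u + (Tnn ^^ m) g v"
    using overlap[of "R\<^sup>2"] by blast
  have "\<alpha> \<le> (T ^^ m) f u + (T ^^ m) g v"
    if V: "V u \<le> R" "V v \<le> R" and wb: "wbounded f" "wbounded g"
      and fg: "\<forall>x. 0 \<le> f x \<and> 0 \<le> g x \<and> 1 \<le> f x + g x" for u v f g
  proof -
    have W: "W u \<le> R\<^sup>2" "W v \<le> R\<^sup>2"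
      using power_mono[OF V(1), of 2] power_mono[OF V(2), of 2] by (auto simp: V_sq)
    have nn: "0 \<le> (T ^^ m) f u" "0 \<le> (T ^^ m) g v"
      using funpow_T_mono[of "\<lambda>_. 0" f m u] funpow_T_mono[of "\<lambda>_. 0" g m v] wb fg by auto
    have "ennreal 1 \<le> ennreal (f x) + ennreal (g x)" for x
      using fg ennreal_leI[of 1 "f x + g x"] ennreal_plus[of "f x" "g x"] by simp
    then have "ennreal \<alpha> \<le> (Tnn ^^ m) (\<lambda>x. ennreal (f x)) u + (Tnn ^^ m) (\<lambda>x. ennreal (g x)) v"
      using wbounded_measurable[OF wb(1)] wbounded_measurable[OF wb(2)] by (intro ov W) auto
    also have "\<dots> = ennreal ((T ^^ m) f u + (T ^^ m) g v)"
      using wb fg nn by (simp add: ennreal_funpow_T ennreal_plus)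
    finally show ?thesis using nn by (subst (asm) ennreal_le_iff) auto
  qed
  with \<alpha> show ?thesis by blast
qed

text \<open>
  The contraction of Hairer and Mattingly, in terms of functions. The constant \<open>\<beta>\<close> is small enough
  for the overlap of the kernels to beat the drift on a sublevel set of \<open>V\<close>; off that set the drift
  alone contracts.
\<close>

lemma contraction:
  "\<exists>\<beta> a. 0 < \<beta> \<and> 0 < a \<and> a < 1 \<and> (\<forall>h k. wbounded h \<longrightarrow> 0 \<le> k \<longrightarrow> near_const \<beta> h k \<longrightarrow> near_const \<beta> ((T ^^ m) h) (a * k))"
proof -
  define \<gamma> where "\<gamma> = sqrt lam"
  have \<gamma>: "0 \<le> \<gamma>" "\<gamma> < 1" using sqrt_lam by (auto simp: \<gamma>_def)
  \<comment> \<open>Chosen so that \<open>4 * B \<le> (1 - \<gamma>) * R\<close>: above this level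
    the drift absorbs the additive constants of both points and still contracts at the rate
    \<gamma>', halfway between \<gamma> and 1. The summand 1 keeps \<open>R\<close> positive when
    \<open>B\<close> vanishes.\<close>
  define R where "R = 4 * B / (1 - \<gamma>) + 1"
  have R: "R > 0" "4 * B \<le> (1 - \<gamma>) * R"
    using \<gamma> B_nonneg by (auto simp: R_def distrib_left intro!: add_nonneg_pos)
  obtain \<alpha> where \<alpha>: "\<alpha> > 0" and ov: "\<And>u v f g. V u \<le> R \<Longrightarrow> V v \<le> R \<Longrightarrow> wbounded f \<Longrightarrow> wbounded g \<Longrightarrow>
      (\<forall>x. 0 \<le> f x \<and> 0 \<le> g x \<and> 1 \<le> f x + g x) \<Longrightarrow> \<alpha> \<le> (T ^^ m) f u + (T ^^ m) g v"
    using overlap_real[of R] by blast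
  \<comment> \<open>The overlap brings a gain of 2 \<alpha>; the additive drift constants of both
    points consume 2 \<beta> B of it, hence at most half.\<close>
  define \<beta> where "\<beta> = \<alpha> / (2 * B + 1)"
  have \<beta>: "0 < \<beta>" "2 * \<beta> * B \<le> \<alpha>"
    using \<alpha> B_nonneg by (auto simp: \<beta>_def field_simps)
  define \<gamma>' where "\<gamma>' = (1 + \<gamma>) / 2"
  have \<gamma>': "\<gamma>' < 1" "0 < \<gamma>'" using \<gamma> by (auto simp: \<gamma>'_def)
  \<comment> \<open>One term per source of contraction: the drift rate on the part weighted by
    \<beta>, the remaining gain \<alpha> of the overlap on the constant part 2 of
    \<open>w u + w v\<close>, and the ratio at the boundary of the region where the drift works
    alone.\<close>
  define a where "a = max \<gamma>' (max (1 - \<alpha> / 2) ((2 + \<beta> * \<gamma>' * R) / (2 + \<beta> * R)))"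
  have a: "0 < a" "a < 1" "\<gamma>' \<le> a" "1 - \<alpha> / 2 \<le> a" "(2 + \<beta> * \<gamma>' * R) / (2 + \<beta> * R) \<le> a"
    using \<gamma>' \<alpha> \<beta> R by (auto simp: a_def add_pos_pos)
  have "\<gamma> \<le> a" using a(3) \<gamma> by (simp add: \<gamma>'_def)
  define w where "w u = 1 + \<beta> * V u" for u
  have w1: "w u \<ge> 1" for u using \<beta> by (simp add: w_def)
  have wb_w: "wbounded w" unfolding w_def by (intro wbounded_add wbounded_cmult) auto
  have QV: "(T ^^ m) V u \<le> \<gamma> * V u + B" for u
  proof -
    have "\<gamma> ^ m \<le> \<gamma> ^ 1" using m \<gamma> by (intro power_decreasing) auto
    then have "\<gamma> ^ m * V u \<le> \<gamma> * V u" by (intro mult_right_mono) auto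
    then show ?thesis using funpow_T_V[of m u] by (simp add: \<gamma>_def)
  qed
  have Qw: "(T ^^ m) w u \<le> 1 + \<beta> * (\<gamma> * V u + B)" for u
    unfolding w_def using \<beta> QV by (subst funpow_T_affine) auto
  have osc: "(T ^^ m) h u - (T ^^ m) h v \<le> a * (w u + w v)"
    if wb: "wbounded h" and hw: "\<And>u. \<bar>h u\<bar> \<le> w u" for h u v
  proof (cases "V u + V v \<le> R")
    case True
    have wbf: "wbounded (\<lambda>x. 1 / 2 * (w x + s * h x))" for s
      by (intro wbounded_cmult wbounded_add wb wb_w)
    have Q: "(T ^^ m) (\<lambda>x. 1 / 2 * (w x + s * h x)) = (\<lambda>x. 1 / 2 * ((T ^^ m) w x + s * (T ^^ m) h x))" for s
      using wb wb_w by (simp only: funpow_T_cmult funpow_T_add wbounded_cmult)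
    \<comment> \<open>Since |h| <= w, the functions (w - h) / 2 and (w + h) / 2 are nonnegative with
      sum w >= 1. The overlap, applied to the first at \<open>u\<close> and to the second at
      \<open>v\<close>, saves 2 \<alpha> in the difference of the means of \<open>h\<close>.\<close>
    have "\<alpha> \<le> (T ^^ m) (\<lambda>x. 1 / 2 * (w x + (-1) * h x)) u + (T ^^ m) (\<lambda>x. 1 / 2 * (w x + 1 * h x)) v"
    proof (rule ov[OF _ _ wbf wbf], goal_cases)
      case 1 then show ?case using True V_nonneg[of v] by linarith
    next
      case 2 then show ?case using True V_nonneg[of u] by linarith
    next
      case 3
      have "0 \<le> w x - h x" "0 \<le> w x + h x" "1 \<le> w x" for x using hw[of x] w1[of x] by auto
      then show ?case by (auto simp: field_simps)
    qed
    then have "(T ^^ m) h u - (T ^^ m) h v \<le> (T ^^ m) w u + (T ^^ m) w v - 2 * \<alpha>"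
      unfolding Q by (simp add: field_simps)
    also have "\<dots> \<le> 2 - \<alpha> + \<beta> * \<gamma> * (V u + V v)"
      using Qw[of u] Qw[of v] \<beta>(2) by (simp add: algebra_simps)
    also have "\<dots> \<le> a * 2 + \<beta> * a * (V u + V v)"
      using a(4) \<open>\<gamma> \<le> a\<close> \<beta> by (intro add_mono mult_right_mono mult_left_mono) auto
    also have "\<dots> = a * (w u + w v)" by (simp add: w_def algebra_simps)
    finally show ?thesis .
  next
    case False
    define s where "s = V u + V v"
    have s: "s \<ge> R" using False s_def by simp
    have "(T ^^ m) h u \<le> (T ^^ m) w u"
      using hw by (intro funpow_T_mono wb wb_w) (smt (verit))
    moreover have "(T ^^ m) (\<lambda>u. -1 * w u) v \<le> (T ^^ m) h v"
      using hw by (intro funpow_T_mono wb wb_w wbounded_cmult) (smt (verit))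
    ultimately have "(T ^^ m) h u - (T ^^ m) h v \<le> (T ^^ m) w u + (T ^^ m) w v"
      unfolding funpow_T_cmult by simp
    also have "\<dots> \<le> 2 + \<beta> * (\<gamma> * s + 2 * B)"
      using Qw[of u] Qw[of v] by (simp add: s_def algebra_simps)
    also have "\<dots> \<le> 2 + \<beta> * (\<gamma>' * s)"
    proof -
      have "4 * B \<le> (1 - \<gamma>) * s"
        using R(2) mult_left_mono[OF s, of "1 - \<gamma>"] \<gamma> by linarith
      then have "\<gamma> * s + 2 * B \<le> \<gamma>' * s" by (simp add: \<gamma>'_def field_simps)
      then show ?thesis using \<beta> by simp
    qed
    \<comment> \<open>As \<gamma>' < 1, the quotient of \<open>2 + \<beta> * \<gamma>' * s\<close>
      by \<open>2 + \<beta> * s\<close> decreases in \<open>s\<close>, so its worst value is at s =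
      R.\<close>
    also have "\<dots> \<le> (2 + \<beta> * \<gamma>' * R) / (2 + \<beta> * R) * (2 + \<beta> * s)"
    proof -
      have "0 \<le> (1 - \<gamma>') * (s - R) * (2 * \<beta>)" using \<gamma>' s \<beta> by simp
      then have "(2 + \<beta> * (\<gamma>' * s)) * (2 + \<beta> * R) \<le> (2 + \<beta> * \<gamma>' * R) * (2 + \<beta> * s)"
        by (simp add: algebra_simps)
      moreover have "0 < 2 + \<beta> * R" using \<beta> R by (simp add: add_pos_pos)
      ultimately show ?thesis by (simp add: pos_le_divide_eq)
    qed
    also have "\<dots> \<le> a * (2 + \<beta> * s)"
      using a(5) \<beta> s R by (intro mult_right_mono) auto
    also have "\<dots> = a * (w u + w v)" by (simp add: w_def s_def algebra_simps)
    finally show ?thesis .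
  qed
  have "near_const \<beta> ((T ^^ m) h) (a * k)" if wb: "wbounded h" and k: "0 \<le> k" and nc: "near_const \<beta> h k" for h k
  proof -
    obtain c where c: "\<And>u. \<bar>h u - c\<bar> \<le> k * w u" using nc by (auto simp: near_const_def w_def)
    show ?thesis
    proof (cases "k = 0")
      case True
      then have "h = (\<lambda>_. c)" using c by auto
      then show ?thesis using True by (auto simp: near_const_def)
    next
      case False
      with k have k: "k > 0" by simp
      define h' where "h' u = (- c / k) + (1 / k) * h u" for u
      have wb': "wbounded h'" unfolding h'_def by (intro wbounded_add wbounded_cmult wb) auto
      have Qh': "(T ^^ m) h' u = (- c / k) + (1 / k) * (T ^^ m) h u" for u
        unfolding h'_def by (simp only: funpow_T_affine[OF wb])
      have h'w: "\<bar>h' u\<bar> \<le> w u" for u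
      proof -
        have "h' u = (h u - c) / k" by (simp add: h'_def diff_divide_distrib)
        then have "\<bar>h' u\<bar> = \<bar>h u - c\<bar> / k" using k by simp
        then show ?thesis using c[of u] k by (simp add: pos_divide_le_eq mult.commute)
      qed
      have "(T ^^ m) h u - a * k * w u \<le> (T ^^ m) h v + a * k * w v" for u v
      proof -
        have "1 / k * ((T ^^ m) h u - (T ^^ m) h v) \<le> a * (w u + w v)"
          using osc[OF wb' h'w, of u v] by (simp add: Qh' right_diff_distrib)
        then show ?thesis using k by (simp add: field_simps)
      qed
      from real_separation[of "\<lambda>u. (T ^^ m) h u - a * k * w u" "\<lambda>u. (T ^^ m) h u + a * k * w u", OF this]
      obtain c'
        where c': "\<And>u. (T ^^ m) h u - a * k * w u \<le> c'" "\<And>u. c' \<le> (T ^^ m) h u + a * k * w u" by blast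
      then have "\<bar>(T ^^ m) h u - c'\<bar> \<le> a * k * (1 + \<beta> * V u)" for u
        using c'(1)[of u] c'(2)[of u] unfolding w_def by linarith
      then show ?thesis unfolding near_const_def by blast
    qed
  qed
  with \<beta> a show ?thesis by blast
qed

text \<open>Writing n = m q + r, the r leftover steps are absorbed by the moment bound for
  \<open>V\<close>, and each of the q blocks contracts. The centre \<open>c\<close> may change with
  \<open>h\<close> and \<open>n\<close>; it is not yet tied to any limit law.\<close>

lemma geometric_ergodicity:
  "\<exists>C \<rho>. 0 \<le> C \<and> 0 < \<rho> \<and> \<rho> < 1 \<and> (\<forall>h k n. h \<in> borel_measurable borel \<longrightarrow> 0 \<le> k \<longrightarrow>
    (\<forall>u. \<bar>h u\<bar> \<le> k * (1 + V u)) \<longrightarrow> (\<exists>c. \<forall>u. \<bar>(T ^^ n) h u - c\<bar> \<le> C * k * \<rho> ^ n * (1 + V u)))"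
proof -
  obtain \<beta> a where \<beta>: "0 < \<beta>" and a: "0 < a" "a < 1"
    and contr: "\<And>h k. wbounded h \<Longrightarrow> 0 \<le> k \<Longrightarrow> near_const \<beta> h k \<Longrightarrow> near_const \<beta> ((T ^^ m) h) (a * k)"
    using contraction by blast
  define \<rho> where "\<rho> = root m a"
  have m0: "m > 0" using m by simp
  have \<rho>: "0 < \<rho>" "\<rho> < 1" "\<rho> ^ m = a" using a m0 by (auto simp: \<rho>_def)
  \<comment> \<open>The factor 1 + B pays for the leftover steps, (1 + 1 / \<beta>) (1 + \<beta>)
    for exchanging the weights 1 + V and 1 + \<beta> V, and 1 / a for the fewer than m steps that do
    not contract: a^q <= \<rho>^n / a.\<close>
  define C where "C = (1 + B) * (1 + 1 / \<beta>) * (1 + \<beta>) / a"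
  have iter: "near_const \<beta> ((T ^^ (m * q)) h) (a ^ q * k)" if "wbounded h" "0 \<le> k" "near_const \<beta> h k" for h k q
  proof (induction q)
    case 0 then show ?case using that by simp
  next
    case (Suc q)
    have "near_const \<beta> ((T ^^ m) ((T ^^ (m * q)) h)) (a * (a ^ q * k))"
      using that Suc a by (intro contr wbounded_funpow_T) auto
    then show ?case by (simp add: funpow_add mult.assoc)
  qed
  have "\<exists>c. \<forall>u. \<bar>(T ^^ n) h u - c\<bar> \<le> C * k * \<rho> ^ n * (1 + V u)"
    if h: "h \<in> borel_measurable borel" "0 \<le> k" "\<And>u. \<bar>h u\<bar> \<le> k * (1 + V u)" for h k n
  proof -
    define q r where "q = n div m" and "r = n mod m"
    have n: "n = m * q + r" by (simp add: q_def r_def)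
    have r: "r < m" using m0 by (simp add: r_def)
    have wb: "wbounded h" using h by (intro wboundedI)
    have wbk: "wbounded (\<lambda>u. k + k * V u)" by (intro wbounded_add wbounded_cmult) auto
    have hk: "- (k + k * V u) \<le> h u" "h u \<le> k + k * V u" for u
      using h(3)[of u] by (simp_all add: algebra_simps abs_le_iff)
    define K where "K = k * (1 + B) * (1 + 1 / \<beta>)"
    have Tr: "\<bar>(T ^^ r) h u - 0\<bar> \<le> K * (1 + \<beta> * V u)" for u
    proof -
      have "(T ^^ r) h u \<le> (T ^^ r) (\<lambda>u. k + k * V u) u"
        using hk by (intro funpow_T_mono wb wbk)
      moreover have "(T ^^ r) (\<lambda>u. -1 * (k + k * V u)) u \<le> (T ^^ r) h u"
        using hk by (intro funpow_T_mono wb wbk wbounded_cmult) simp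
      ultimately have "\<bar>(T ^^ r) h u\<bar> \<le> k + k * (T ^^ r) V u"
        unfolding funpow_T_cmult by (simp add: funpow_T_affine)
      also have "(T ^^ r) V u \<le> V u + B"
      proof -
        have "sqrt lam ^ r * V u \<le> 1 * V u"
          using sqrt_lam by (intro mult_right_mono power_le_one) auto
        then show ?thesis using funpow_T_V[of r u] by linarith
      qed
      also have "k + k * (V u + B) \<le> k * (1 + B) * (1 + V u)"
        using h(2) B_nonneg by (simp add: algebra_simps)
      also have "1 + V u \<le> (1 + 1 / \<beta>) * (1 + \<beta> * V u)"
        using \<beta> by (simp add: field_simps)
      finally show ?thesis using h(2) B_nonneg by (simp add: K_def mult_left_mono mult.assoc)
    qed
    have K0: "0 \<le> K" using h(2) B_nonneg \<beta> by (simp add: K_def)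
    have "near_const \<beta> ((T ^^ (m * q)) ((T ^^ r) h)) (a ^ q * K)"
      using Tr by (intro iter wbounded_funpow_T wb K0) (auto simp: near_const_def intro!: exI[of _ 0])
    then obtain c where c: "\<And>u. \<bar>(T ^^ n) h u - c\<bar> \<le> a ^ q * K * (1 + \<beta> * V u)"
      unfolding near_const_def n funpow_add comp_def by blast
    have aq: "a ^ q \<le> \<rho> ^ n / a"
    proof -
      have "a ^ q * a \<le> \<rho> ^ (m * q) * \<rho> ^ r"
        using \<rho> r unfolding power_mult \<rho>(3)[symmetric] by (intro mult_left_mono power_decreasing) auto
      then show ?thesis using a by (simp add: n power_add field_simps)
    qed
    have "a ^ q * K * (1 + \<beta> * V u) \<le> (\<rho> ^ n / a) * K * ((1 + \<beta>) * (1 + V u))" for u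
      using aq K0 \<beta> \<rho> a by (intro mult_mono) (auto simp: algebra_simps intro!: mult_nonneg_nonneg)
    also have "(\<rho> ^ n / a) * K * ((1 + \<beta>) * (1 + V u)) = C * k * \<rho> ^ n * (1 + V u)" for u
      by (simp add: C_def K_def)
    finally show ?thesis using c by (meson order_trans)
  qed
  moreover have "0 \<le> C" using a \<beta> B_nonneg by (simp add: C_def)
  ultimately show ?thesis using \<rho> by blast
qed

end

subsection \<open>Ergodicity of the chain\<close>

text \<open>\<open>joint\<close> says that \<open>Z n\<close> has law \<zeta> and is independent of
  the pair \<open>(U j, U n)\<close>. Pairs suffice, as only means at one or two times are computed;
  no filtration enters.\<close>

locale harris_chain = harris_system \<zeta> \<Phi> W lam b m + prob_space P
  for P :: "'w measure" and \<zeta> :: "'z measure" and \<Phi> :: "'a::euclidean_space \<Rightarrow> 'z \<Rightarrow> 'a"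
    and W :: "'a \<Rightarrow> real" and lam b :: real and m :: nat +
  fixes U :: "nat \<Rightarrow> 'w \<Rightarrow> 'a" and Z :: "nat \<Rightarrow> 'w \<Rightarrow> 'z"
  assumes U_rv [measurable]: "\<And>n. U n \<in> borel_measurable P"
    and Z_rv [measurable]: "\<And>n. Z n \<in> measurable P \<zeta>"
    and U_Suc: "\<And>n \<omega>. \<omega> \<in> space P \<Longrightarrow> U (Suc n) \<omega> = \<Phi> (U n \<omega>) (Z n \<omega>)"
    and joint: "\<And>j n. j \<le> n \<Longrightarrow> distr P ((borel \<Otimes>\<^sub>M borel) \<Otimes>\<^sub>M \<zeta>) (\<lambda>\<omega>. ((U j \<omega>, U n \<omega>), Z n \<omega>))
      = distr P (borel \<Otimes>\<^sub>M borel) (\<lambda>\<omega>. (U j \<omega>, U n \<omega>)) \<Otimes>\<^sub>M \<zeta>"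
    and W_U0: "integrable P (\<lambda>\<omega>. W (U 0 \<omega>))"
begin

section \<open>One-step formulas and moments along the chain\<close>

lemma nn_integral_step:
  assumes [measurable]: "h \<in> borel_measurable borel"
  shows "(\<integral>\<^sup>+\<omega>. h (U (Suc n) \<omega>) \<partial>P) = (\<integral>\<^sup>+\<omega>. Tnn h (U n \<omega>) \<partial>P)"
proof -
  have "(\<integral>\<^sup>+\<omega>. h (U (Suc n) \<omega>) \<partial>P)
      = (\<integral>\<^sup>+p. h (\<Phi> (snd (fst p)) (snd p)) \<partial>distr P ((borel \<Otimes>\<^sub>M borel) \<Otimes>\<^sub>M \<zeta>) (\<lambda>\<omega>. ((U n \<omega>, U n \<omega>), Z n \<omega>)))"
    by (subst nn_integral_distr) (auto intro!: nn_integral_cong simp: U_Suc)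
  also have "\<dots> = (\<integral>\<^sup>+q. \<integral>\<^sup>+z. h (\<Phi> (snd q) z) \<partial>\<zeta> \<partial>distr P (borel \<Otimes>\<^sub>M borel) (\<lambda>\<omega>. (U n \<omega>, U n \<omega>)))"
    unfolding joint[OF order_refl] by (subst zeta.nn_integral_fst[symmetric]) auto
  also have "\<dots> = (\<integral>\<^sup>+\<omega>. Tnn h (U n \<omega>) \<partial>P)"
    by (subst nn_integral_distr) (auto simp: Tnn_def)
  finally show ?thesis .
qed

lemma integral_step:
  assumes [measurable]: "g \<in> borel_measurable borel" "h \<in> borel_measurable borel"
    and "j \<le> n" and int: "integrable P (\<lambda>\<omega>. g (U j \<omega>) * h (U (Suc n) \<omega>) :: real)"
  shows "(\<integral>\<omega>. g (U j \<omega>) * h (U (Suc n) \<omega>) \<partial>P) = (\<integral>\<omega>. g (U j \<omega>) * T h (U n \<omega>) \<partial>P)"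
proof -
  define D where "D = distr P (borel \<Otimes>\<^sub>M borel) (\<lambda>\<omega>. (U j \<omega>, U n \<omega>))"
  interpret D: prob_space D unfolding D_def by (rule prob_space_distr) simp
  interpret pair_sigma_finite D \<zeta> ..
  have [measurable_cong]: "sets D = sets (borel \<Otimes>\<^sub>M borel)" by (simp add: D_def)
  have [measurable]: "T h \<in> borel_measurable borel"
    unfolding T_def by (intro zeta.borel_measurable_lebesgue_integral) simp
  let ?f = "\<lambda>p. g (fst (fst p)) * h (\<Phi> (snd (fst p)) (snd p))"
  have J: "D \<Otimes>\<^sub>M \<zeta> = distr P ((borel \<Otimes>\<^sub>M borel) \<Otimes>\<^sub>M \<zeta>) (\<lambda>\<omega>. ((U j \<omega>, U n \<omega>), Z n \<omega>))"
    unfolding D_def by (rule joint[OF \<open>j \<le> n\<close>, symmetric])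
  have "integrable P (\<lambda>\<omega>. ?f ((U j \<omega>, U n \<omega>), Z n \<omega>))"
    using int by (rule Bochner_Integration.integrable_cong[THEN iffD1, rotated -1]) (auto simp: U_Suc)
  then have int': "integrable (D \<Otimes>\<^sub>M \<zeta>) ?f"
    unfolding J by (subst integrable_distr_eq) auto
  have "(\<integral>\<omega>. g (U j \<omega>) * h (U (Suc n) \<omega>) \<partial>P) = (\<integral>p. ?f p \<partial>(D \<Otimes>\<^sub>M \<zeta>))"
    unfolding J by (subst integral_distr) (auto intro!: Bochner_Integration.integral_cong simp: U_Suc)
  also have "\<dots> = (\<integral>q. \<integral>z. ?f (q, z) \<partial>\<zeta> \<partial>D)"
    by (rule integral_fst'[OF int', symmetric])
  also have "\<dots> = (\<integral>q. g (fst q) * T h (snd q) \<partial>D)"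
    by (simp add: T_def)
  also have "\<dots> = (\<integral>\<omega>. g (U j \<omega>) * T h (U n \<omega>) \<partial>P)"
    unfolding D_def by (subst integral_distr) auto
  finally show ?thesis .
qed

text \<open>Besides the initial moment, the maximum contains the fixed point of t = lam * t + b, so
  that the drift recursion cannot leave the interval below \<open>w0\<close>.\<close>

definition w0 where "w0 = max (\<integral>\<omega>. W (U 0 \<omega>) \<partial>P) (b / (1 - lam))"

lemma w0_nonneg: "0 \<le> w0"
  unfolding w0_def by (intro max.coboundedI1) simp

lemma W_moment: "integrable P (\<lambda>\<omega>. W (U n \<omega>)) \<and> (\<integral>\<omega>. W (U n \<omega>) \<partial>P) \<le> w0"
proof (induction n)
  case 0 then show ?case using W_U0 by (simp add: w0_def)
next
  case (Suc n)
  have "(\<integral>\<^sup>+\<omega>. ennreal (W (U (Suc n) \<omega>)) \<partial>P) \<le> (\<integral>\<^sup>+\<omega>. ennreal (lam * W (U n \<omega>) + b) \<partial>P)"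
    by (subst nn_integral_step[of "\<lambda>u. ennreal (W u)"]) (auto intro!: nn_integral_mono drift simp: Tnn_def)
  also have "\<dots> = ennreal (lam * (\<integral>\<omega>. W (U n \<omega>) \<partial>P) + b)"
    using Suc lam b by (subst nn_integral_eq_integral) (auto simp: prob_space)
  also have "lam * (\<integral>\<omega>. W (U n \<omega>) \<partial>P) + b \<le> lam * w0 + b"
    using Suc lam by (simp add: mult_left_mono)
  also have "lam * w0 + b \<le> w0"
  proof -
    have "b / (1 - lam) \<le> w0" by (simp add: w0_def)
    then show ?thesis using lam by (simp add: pos_divide_le_eq algebra_simps)
  qed
  finally have le: "(\<integral>\<^sup>+\<omega>. ennreal (W (U (Suc n) \<omega>)) \<partial>P) \<le> ennreal w0" by (simp add: ennreal_leI)
  have int: "integrable P (\<lambda>\<omega>. W (U (Suc n) \<omega>))"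
    using order.strict_trans1[OF le ennreal_less_top] by (intro integrableI_nonneg) auto
  moreover have "(\<integral>\<omega>. W (U (Suc n) \<omega>) \<partial>P) \<le> w0"
    using le w0_nonneg by (subst (asm) nn_integral_eq_integral[OF int]) auto
  ultimately show ?case ..
qed

lemma W_integrable [simp]: "integrable P (\<lambda>\<omega>. W (U n \<omega>))" and W_bound: "(\<integral>\<omega>. W (U n \<omega>) \<partial>P) \<le> w0"
  using W_moment by auto

lemma V_integrable [simp]: "integrable P (\<lambda>\<omega>. V (U n \<omega>))"
  by (rule Bochner_Integration.integrable_bound[of _ "\<lambda>\<omega>. 1 + W (U n \<omega>)"])
     (auto simp: V_le abs_of_nonneg)

lemma V_bound: "(\<integral>\<omega>. V (U n \<omega>) \<partial>P) \<le> 1 + w0"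
proof -
  have "(\<integral>\<omega>. V (U n \<omega>) \<partial>P) \<le> (\<integral>\<omega>. 1 + W (U n \<omega>) \<partial>P)"
    by (intro integral_mono) (auto simp: V_le)
  also have "\<dots> \<le> 1 + w0" using W_bound by (simp add: prob_space)
  finally show ?thesis .
qed

lemma integrable_U:
  assumes "wbounded h" shows "integrable P (\<lambda>\<omega>. h (U n \<omega>))"
proof -
  obtain k where k: "0 \<le> k" "\<And>u. \<bar>h u\<bar> \<le> k * (1 + V u)" using assms by (rule wboundedE) blast
  note [measurable] = wbounded_measurable[OF assms]
  show ?thesis
    by (rule Bochner_Integration.integrable_bound[of _ "\<lambda>\<omega>. k * (1 + V (U n \<omega>))"]) (use k in auto)
qed

text \<open>Two factors of size 1 + V multiply to the size of \<open>W\<close>, whose means are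
  bounded along the chain; so products of two functions of the class have finite means.\<close>

lemma abs_mult_le_W:
  assumes "0 \<le> k" "0 \<le> l" "\<bar>x\<bar> \<le> k * (1 + V u)" "\<bar>y\<bar> \<le> l * (1 + V v)"
  shows "\<bar>x * y\<bar> \<le> 2 * k * l * (1 + W u + W v)"
proof -
  have "2 * V u \<le> 1 + W u" "2 * V v \<le> 1 + W v"
    using V_sq[of u] V_sq[of v] zero_le_power2[of "V u - 1"] zero_le_power2[of "V v - 1"]
    by (simp_all add: power2_diff del: zero_le_power2)
  moreover have "2 * (V u * V v) \<le> W u + W v"
    using zero_le_power2[of "V u - V v"] V_sq[of u] V_sq[of v]
    by (simp add: power2_diff del: zero_le_power2)
  ultimately have "(1 + V u) * (1 + V v) \<le> 2 * (1 + W u + W v)"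
    using W_nonneg[of u] W_nonneg[of v] by (simp add: algebra_simps del: W_nonneg)
  then have "(k * l) * ((1 + V u) * (1 + V v)) \<le> (k * l) * (2 * (1 + W u + W v))"
    using assms by (intro mult_left_mono) auto
  moreover have "\<bar>x * y\<bar> \<le> (k * (1 + V u)) * (l * (1 + V v))"
    unfolding abs_mult using assms by (intro mult_mono) auto
  ultimately show ?thesis by (simp add: mult_ac)
qed

lemma integrable_U_mult:
  assumes "wbounded g" "wbounded h" shows "integrable P (\<lambda>\<omega>. g (U i \<omega>) * h (U j \<omega>))"
proof -
  obtain k where k: "0 \<le> k" "\<And>u. \<bar>g u\<bar> \<le> k * (1 + V u)" using assms(1) by (rule wboundedE) blast
  obtain l where l: "0 \<le> l" "\<And>u. \<bar>h u\<bar> \<le> l * (1 + V u)" using assms(2) by (rule wboundedE) blast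
  note [measurable] = assms[THEN wbounded_measurable]
  show ?thesis
  proof (rule Bochner_Integration.integrable_bound[of _ "\<lambda>\<omega>. 2 * k * l * (1 + W (U i \<omega>) + W (U j \<omega>))"])
    show "AE \<omega> in P. norm (g (U i \<omega>) * h (U j \<omega>)) \<le> norm (2 * k * l * (1 + W (U i \<omega>) + W (U j \<omega>)))"
      using abs_mult_le_W[OF k(1) l(1) k(2) l(2)] by (auto intro: order_trans[OF _ abs_ge_self])
  qed auto
qed

lemma integral_steps:
  assumes "wbounded g" "wbounded h"
  shows "(\<integral>\<omega>. g (U j \<omega>) * h (U (j + l) \<omega>) \<partial>P) = (\<integral>\<omega>. g (U j \<omega>) * (T ^^ l) h (U j \<omega>) \<partial>P)"
  using assms(2)
proof (induction l arbitrary: h)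
  case 0 then show ?case by simp
next
  case (Suc l)
  have "(\<integral>\<omega>. g (U j \<omega>) * h (U (Suc (j + l)) \<omega>) \<partial>P) = (\<integral>\<omega>. g (U j \<omega>) * T h (U (j + l) \<omega>) \<partial>P)"
    using assms(1) Suc.prems by (intro integral_step integrable_U_mult wbounded_measurable) auto
  also have "\<dots> = (\<integral>\<omega>. g (U j \<omega>) * (T ^^ l) (T h) (U j \<omega>) \<partial>P)"
    by (intro Suc.IH wbounded_T Suc.prems)
  finally show ?case by (simp add: funpow_swap1)
qed

lemma integral_steps_single:
  assumes "wbounded h"
  shows "(\<integral>\<omega>. h (U (j + l) \<omega>) \<partial>P) = (\<integral>\<omega>. (T ^^ l) h (U j \<omega>) \<partial>P)"
  using integral_steps[of "\<lambda>_. 1" h j l] assms by simp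

lemma abs_expectation_diff_le:
  assumes "wbounded h" "0 \<le> k" "\<And>u. \<bar>h u - c\<bar> \<le> k * (1 + V u)"
  shows "\<bar>(\<integral>\<omega>. h (U n \<omega>) \<partial>P) - c\<bar> \<le> k * (2 + w0)"
proof -
  have "(\<integral>\<omega>. h (U n \<omega>) \<partial>P) - c = (\<integral>\<omega>. h (U n \<omega>) - c \<partial>P)"
    using integrable_U[OF assms(1)] by (simp add: prob_space)
  also have "\<bar>\<dots>\<bar> \<le> (\<integral>\<omega>. \<bar>h (U n \<omega>) - c\<bar> \<partial>P)"
    using integral_norm_bound[of P "\<lambda>\<omega>. h (U n \<omega>) - c"] by simp
  also have "\<dots> \<le> (\<integral>\<omega>. k * (1 + V (U n \<omega>)) \<partial>P)"
    using integrable_U[OF assms(1)] assms(3) by (intro integral_mono) auto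
  also have "\<dots> = k * (1 + (\<integral>\<omega>. V (U n \<omega>) \<partial>P))" by (simp add: prob_space)
  also have "\<dots> \<le> k * (2 + w0)" using V_bound[of n] assms(2) by (intro mult_left_mono) auto
  finally show ?thesis .
qed

text \<open>Unbounded functions are reached by truncation, which yields convergence of means without
  a rate. The geometric rate of the covariances comes from \<open>geo\<close>; the limit only serves
  to see that the centring constants are small when the mean under the limit law is 0.\<close>

theorem ergodic:
  "\<exists>\<mu>. prob_space \<mu> \<and> sets \<mu> = sets borel \<and> (\<lambda>n. d_TV (distr P borel (U n)) \<mu>) \<longlonglongrightarrow> 0 \<and>
    (\<forall>\<phi>. wbounded \<phi> \<longrightarrow> integrable \<mu> \<phi> \<and>
      (\<exists>K. \<forall>n. (\<integral>\<omega>. (\<Sum>k=1..n. \<phi> (U k \<omega>) - (\<integral>u. \<phi> u \<partial>\<mu>))\<^sup>2 \<partial>P) \<le> K * real n))"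
proof -
  obtain C \<rho> where C: "0 \<le> C" and \<rho>: "0 < \<rho>" "\<rho> < 1"
    and geo: "\<And>h k n. h \<in> borel_measurable borel \<Longrightarrow> 0 \<le> k \<Longrightarrow>
      (\<And>u. \<bar>h u\<bar> \<le> k * (1 + V u)) \<Longrightarrow> \<exists>c. \<forall>u. \<bar>(T ^^ n) h u - c\<bar> \<le> C * k * \<rho> ^ n * (1 + V u)"
    using geometric_ergodicity by blast
  \<comment> \<open>Averaging the pointwise bound over the law of \<open>U j\<close> costs only the
    uniform moment of \<open>V\<close>. As \<open>c\<close> does not depend on \<open>j\<close>, all
    means from time \<open>n\<close> on are close to the same number, which takes the place of a
    stationary mean.\<close>
  have geoE: "\<exists>c. (\<forall>u. \<bar>(T ^^ n) h u - c\<bar> \<le> C * k * \<rho> ^ n * (1 + V u)) \<and>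
      (\<forall>j. \<bar>(\<integral>\<omega>. h (U (j + n) \<omega>) \<partial>P) - c\<bar> \<le> C * k * \<rho> ^ n * (2 + w0))"
    if h: "h \<in> borel_measurable borel" "0 \<le> k" "\<And>u. \<bar>h u\<bar> \<le> k * (1 + V u)" for h k n
  proof -
    have wb: "wbounded h" using h by (intro wboundedI)
    obtain c where c: "\<And>u. \<bar>(T ^^ n) h u - c\<bar> \<le> C * k * \<rho> ^ n * (1 + V u)"
      using geo[OF h, of n] by blast
    moreover have "\<bar>(\<integral>\<omega>. h (U (j + n) \<omega>) \<partial>P) - c\<bar> \<le> C * k * \<rho> ^ n * (2 + w0)" for j
      unfolding integral_steps_single[OF wb]
      using C h(2) \<rho> by (intro abs_expectation_diff_le wbounded_funpow_T wb c) auto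
    ultimately show ?thesis by blast
  qed
  define r where "r n = 2 * C * (2 + w0) * \<rho> ^ n" for n
  have r0: "r \<longlonglongrightarrow> 0"
    unfolding r_def using \<rho> by (intro tendsto_mult_right_zero LIMSEQ_realpow_zero) auto
  define \<mu> where "\<mu> n = distr P borel (U n)" for n
  have mu: "prob_space (\<mu> n)" "sets (\<mu> n) = sets borel" for n
    unfolding \<mu>_def by (auto intro: prob_space_distr)
  have "\<bar>measure (\<mu> (n + k)) A - measure (\<mu> n) A\<bar> \<le> r n" if [measurable]: "A \<in> sets borel" for n k A
  proof -
    have "\<bar>indicator A u\<bar> \<le> 1 * (1 + V u)" for u by (auto simp: indicator_def)
    from geoE[OF _ _ this, of n] obtain c where
      c: "\<And>j. \<bar>(\<integral>\<omega>. indicator A (U (j + n) \<omega>) \<partial>P) - c\<bar> \<le> C * \<rho> ^ n * (2 + w0)" by auto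
    have "r n = 2 * (C * \<rho> ^ n * (2 + w0))" by (simp add: r_def)
    then have "\<bar>(\<integral>\<omega>. indicator A (U (n + k) \<omega>) \<partial>P) - (\<integral>\<omega>. indicator A (U n \<omega>) \<partial>P)\<bar> \<le> r n"
      using c[of k] c[of 0] unfolding add.commute[of k n] add_0_left by linarith
    moreover have "measure (\<mu> i) A = (\<integral>\<omega>. indicator A (U i \<omega>) \<partial>P)" for i
    proof -
      have "(\<integral>\<omega>. indicator A (U i \<omega>) \<partial>P) = (\<integral>u. indicat_real A u \<partial>distr P borel (U i))"
        by (rule integral_distr[symmetric]) auto
      then show ?thesis by (simp add: \<mu>_def)
    qed
    ultimately show ?thesis by simp
  qed
  from uniformly_Cauchy_prob_limit[of \<mu> borel r, OF mu this r0]
  obtain \<nu> where nu: "prob_space \<nu>" "sets \<nu> = sets borel"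
    and close: "\<And>n A. A \<in> sets borel \<Longrightarrow> \<bar>measure (\<mu> n) A - measure \<nu> A\<bar> \<le> r n" by auto
  interpret nu: prob_space \<nu> by fact
  note [measurable_cong] = nu(2)
  have tv: "(\<lambda>n. d_TV (distr P borel (U n)) \<nu>) \<longlonglongrightarrow> 0"
  proof (rule tendsto_sandwich[OF _ _ tendsto_const r0])
    show "\<forall>\<^sub>F n in sequentially. 0 \<le> d_TV (distr P borel (U n)) \<nu>"
      using d_TV_nonneg[OF mu nu] by (simp add: \<mu>_def)
    show "\<forall>\<^sub>F n in sequentially. d_TV (distr P borel (U n)) \<nu> \<le> r n"
      using d_TV_le[OF mu nu close] by (simp add: \<mu>_def)
  qed
  have bdd: "\<bar>(\<integral>\<omega>. h (U n \<omega>) \<partial>P) - (\<integral>u. h u \<partial>\<nu>)\<bar> \<le> 2 * K * r n"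
    if "h \<in> borel_measurable borel" "\<And>u. \<bar>h u\<bar> \<le> K" for h K n
    using integral_diff_le_of_close[OF mu nu close that] that(1)
    unfolding \<mu>_def by (simp add: integral_distr)
  \<comment> \<open>Truncations of \<open>W\<close> are bounded, so their means converge and stay
    below \<open>w0\<close>; Fatou's lemma removes the truncation.\<close>
  have W_nu: "integrable \<nu> W" "(\<integral>u. W u \<partial>\<nu>) \<le> w0"
  proof -
    have "(\<integral>\<^sup>+u. ennreal (min (W u) (real i)) \<partial>\<nu>) \<le> ennreal w0" for i
    proof -
      have "(\<integral>u. min (W u) (real i) \<partial>\<nu>) \<le> w0 + 2 * real i * r n" for n
      proof -
        have "(\<integral>\<omega>. min (W (U n \<omega>)) (real i) \<partial>P) \<le> (\<integral>\<omega>. W (U n \<omega>) \<partial>P)"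
          by (intro integral_mono) (auto intro!: integrable_const_bound[of _ "real i"])
        then show ?thesis
          using bdd[of "\<lambda>u. min (W u) (real i)" "real i" n] W_bound[of n] by auto
      qed
      moreover have "(\<lambda>n. w0 + 2 * real i * r n) \<longlonglongrightarrow> w0 + 2 * real i * 0"
        by (intro tendsto_intros r0)
      ultimately have "(\<integral>u. min (W u) (real i) \<partial>\<nu>) \<le> w0"
        using LIMSEQ_le_const by fastforce
      moreover have "(\<integral>\<^sup>+u. ennreal (min (W u) (real i)) \<partial>\<nu>) = ennreal (\<integral>u. min (W u) (real i) \<partial>\<nu>)"
        by (intro nn_integral_eq_integral) (auto intro!: nu.integrable_const_bound[of _ "real i"])
      ultimately show ?thesis by (simp add: ennreal_leI)
    qed
    moreover have "(\<integral>\<^sup>+u. ennreal (W u) \<partial>\<nu>) \<le> liminf (\<lambda>i. \<integral>\<^sup>+u. ennreal (min (W u) (real i)) \<partial>\<nu>)"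
    proof -
      have lim_min: "(\<lambda>i. ennreal (min (W u) (real i))) \<longlonglongrightarrow> ennreal (W u)" for u
      proof (rule tendsto_eventually)
        have "\<forall>\<^sub>F i in sequentially. W u \<le> real i"
          by (metis eventually_sequentiallyI nat_ceiling_le_eq)
        then show "\<forall>\<^sub>F i in sequentially. ennreal (min (W u) (real i)) = ennreal (W u)"
          by eventually_elim (simp add: min_absorb1)
      qed
      have "(\<integral>\<^sup>+u. ennreal (W u) \<partial>\<nu>) = (\<integral>\<^sup>+u. liminf (\<lambda>i. ennreal (min (W u) (real i))) \<partial>\<nu>)"
        by (intro nn_integral_cong lim_imp_Liminf[OF _ lim_min, symmetric]) simp
      also have "\<dots> \<le> liminf (\<lambda>i. \<integral>\<^sup>+u. ennreal (min (W u) (real i)) \<partial>\<nu>)"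
        by (intro nn_integral_liminf) auto
      finally show ?thesis .
    qed
    moreover have "liminf (\<lambda>i. \<integral>\<^sup>+u. ennreal (min (W u) (real i)) \<partial>\<nu>) \<le> ennreal w0"
      using calculation(1) by (intro Liminf_le) (auto intro: always_eventually)
    ultimately have le: "(\<integral>\<^sup>+u. ennreal (W u) \<partial>\<nu>) \<le> ennreal w0" by simp
    then show int: "integrable \<nu> W"
      using order.strict_trans1[OF le ennreal_less_top] by (intro integrableI_nonneg) auto
    show "(\<integral>u. W u \<partial>\<nu>) \<le> w0"
      using le w0_nonneg by (subst (asm) nn_integral_eq_integral[OF int]) auto
  qed
  have nu_int: "integrable \<nu> h" if wb: "wbounded h" for h
  proof -
    obtain k where k: "0 \<le> k" "\<And>u. \<bar>h u\<bar> \<le> k * (1 + V u)" using wb by (rule wboundedE) blast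
    have "\<bar>h u\<bar> \<le> k * (2 + W u)" for u
      using k(2)[of u] mult_left_mono[OF add_left_mono[OF V_le[of u], of 1] k(1)] by simp
    then have "norm (h u) \<le> norm (k * (2 + W u))" for u
      unfolding real_norm_def by (rule order_trans[OF _ abs_ge_self])
    then show ?thesis
      using wbounded_measurable[OF wb] W_nu(1)
      by (intro Bochner_Integration.integrable_bound[of \<nu> "\<lambda>u. k * (2 + W u)" h] always_eventually allI
          integrable_mult_right Bochner_Integration.integrable_add nu.integrable_const) (simp_all add: measurable_cong_sets[OF nu(2) refl])
  qed
  have conv: "(\<lambda>n. \<integral>\<omega>. h (U n \<omega>) \<partial>P) \<longlonglongrightarrow> (\<integral>u. h u \<partial>\<nu>)" if wb: "wbounded h" for h
  proof (rule LIMSEQ_I)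
    fix e :: real assume e: "e > 0"
    obtain k where k: "0 \<le> k" "\<And>u. \<bar>h u\<bar> \<le> k * (1 + V u)" using wb by (rule wboundedE) blast
    note [measurable] = wbounded_measurable[OF wb]
    \<comment> \<open>The part beyond level \<open>R\<close> then contributes at most e / 4 for the
      chain and again for \<nu>; the truncated function takes a third quarter.\<close>
    define R where "R = 4 * k * (1 + 2 * w0) / e + 1"
    have R: "R > 0" "k * (1 + 2 * w0) / R \<le> e / 4"
    proof -
      show R0: "R > 0" using e k w0_nonneg by (auto simp: R_def intro!: add_nonneg_pos)
      have "4 * k * (1 + 2 * w0) \<le> R * e" using e by (simp add: R_def distrib_right)
      then show "k * (1 + 2 * w0) / R \<le> e / 4" using R0 by (simp add: pos_divide_le_eq mult.commute)
    qed
    define g where "g u = (if V u \<le> R then h u else 0)" for u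
    have [measurable]: "g \<in> borel_measurable borel" unfolding g_def by measurable
    have g_bdd: "\<bar>g u\<bar> \<le> k * (1 + R)" for u
      using k(2)[of u] mult_left_mono[OF add_left_mono[of "V u" R 1] k(1)] k(1) R(1)
      by (auto simp: g_def)
    \<comment> \<open>Where V u > R, a factor \<open>R\<close> is gained from R (1 + V) <= V (1 + V)
      <= 1 + 2 W.\<close>
    have hg: "\<bar>h u - g u\<bar> \<le> k / R * (1 + 2 * W u)" for u
    proof (cases "V u \<le> R")
      case True then show ?thesis using k R by (simp add: g_def)
    next
      case False
      then have "R * (1 + V u) \<le> V u * (1 + V u)" using R by (intro mult_right_mono) auto
      also have "\<dots> \<le> 1 + 2 * W u" using V_le[of u] V_sq[of u] by (simp add: power2_eq_square distrib_left)
      finally have "k / R * (R * (1 + V u)) \<le> k / R * (1 + 2 * W u)"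
        using k R by (intro mult_left_mono) auto
      then show ?thesis using False k(2)[of u] R by (simp add: g_def)
    qed
    \<comment> \<open>Formulated on an arbitrary probability space, so as to serve both the chain at
      time \<open>n\<close> and the limit \<nu>.\<close>
    have tail: "\<bar>(\<integral>\<omega>. h (X \<omega>) \<partial>N) - (\<integral>\<omega>. g (X \<omega>) \<partial>N)\<bar> \<le> e / 4"
      if N: "prob_space N" and [measurable]: "X \<in> borel_measurable N" and WX: "integrable N (\<lambda>\<omega>. W (X \<omega>))" "(\<integral>\<omega>. W (X \<omega>) \<partial>N) \<le> w0"
        and hX: "integrable N (\<lambda>\<omega>. h (X \<omega>))" for N :: "'x measure" and X
    proof -
      interpret N: prob_space N by fact
      have gX: "integrable N (\<lambda>\<omega>. g (X \<omega>))"
        by (rule N.integrable_const_bound[of _ "k * (1 + R)"]) (auto simp: g_bdd)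
      have "\<bar>(\<integral>\<omega>. h (X \<omega>) \<partial>N) - (\<integral>\<omega>. g (X \<omega>) \<partial>N)\<bar> = \<bar>\<integral>\<omega>. h (X \<omega>) - g (X \<omega>) \<partial>N\<bar>"
        using hX gX by simp
      also have "\<dots> \<le> (\<integral>\<omega>. \<bar>h (X \<omega>) - g (X \<omega>)\<bar> \<partial>N)"
        using integral_norm_bound[of N "\<lambda>\<omega>. h (X \<omega>) - g (X \<omega>)"] by simp
      also have "\<dots> \<le> (\<integral>\<omega>. k / R * (1 + 2 * W (X \<omega>)) \<partial>N)"
        using hX gX WX hg by (intro integral_mono) auto
      also have "\<dots> = k / R * (1 + 2 * (\<integral>\<omega>. W (X \<omega>) \<partial>N))" using WX by (simp add: N.prob_space)
      also have "\<dots> \<le> k / R * (1 + 2 * w0)" using WX k R by (intro mult_left_mono) auto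
      also have "\<dots> \<le> e / 4" using R by simp
      finally show ?thesis .
    qed
    have "(\<lambda>n. 2 * (k * (1 + R)) * r n) \<longlonglongrightarrow> 0" by (intro tendsto_mult_right_zero r0)
    from LIMSEQ_D[OF this, of "e / 4"] e obtain n0
      where n0: "\<And>n. n \<ge> n0 \<Longrightarrow> \<bar>2 * (k * (1 + R)) * r n\<bar> < e / 4" by auto
    have "norm ((\<integral>\<omega>. h (U n \<omega>) \<partial>P) - (\<integral>u. h u \<partial>\<nu>)) < e" if n: "n \<ge> n0" for n
    proof -
      have "\<bar>(\<integral>\<omega>. h (U n \<omega>) \<partial>P) - (\<integral>\<omega>. g (U n \<omega>) \<partial>P)\<bar> \<le> e / 4"
        by (rule tail[OF prob_space_axioms U_rv W_integrable W_bound integrable_U[OF wb]])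
      moreover have "\<bar>(\<integral>u. h u \<partial>\<nu>) - (\<integral>u. g u \<partial>\<nu>)\<bar> \<le> e / 4"
        using tail[of \<nu> "\<lambda>u. u", OF nu(1) _ W_nu nu_int[OF wb]] by simp
      moreover have "\<bar>(\<integral>\<omega>. g (U n \<omega>) \<partial>P) - (\<integral>u. g u \<partial>\<nu>)\<bar> < e / 4"
      proof -
        have "\<bar>(\<integral>\<omega>. g (U n \<omega>) \<partial>P) - (\<integral>u. g u \<partial>\<nu>)\<bar> \<le> 2 * (k * (1 + R)) * r n"
          by (rule bdd[OF _ g_bdd]) simp
        also have "\<dots> \<le> \<bar>2 * (k * (1 + R)) * r n\<bar>" by (rule abs_ge_self)
        also have "\<dots> < e / 4" by (rule n0[OF n])
        finally show ?thesis .
      qed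
      ultimately show ?thesis using e unfolding real_norm_def by linarith
    qed
    then show "\<exists>n0. \<forall>n\<ge>n0. norm ((\<integral>\<omega>. h (U n \<omega>) \<partial>P) - (\<integral>u. h u \<partial>\<nu>)) < e" by blast
  qed
  have lln: "\<exists>K. \<forall>n. (\<integral>\<omega>. (\<Sum>k=1..n. h (U k \<omega>))\<^sup>2 \<partial>P) \<le> K * real n"
    if wb: "wbounded h" and mean0: "(\<integral>u. h u \<partial>\<nu>) = 0" for h
  proof -
    obtain k where k: "0 \<le> k" "\<And>u. \<bar>h u\<bar> \<le> k * (1 + V u)" using wb by (rule wboundedE) blast
    define D where "D = 2 * k * (C * k * (3 + w0)) * (1 + 2 * w0) + 2 * k * k * (1 + 2 * w0)"
    have Tl: "\<bar>(T ^^ l) h u\<bar> \<le> C * k * (3 + w0) * \<rho> ^ l * (1 + V u)" for l u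
    proof -
      obtain c where c: "\<And>u. \<bar>(T ^^ l) h u - c\<bar> \<le> C * k * \<rho> ^ l * (1 + V u)"
          "\<And>j. \<bar>(\<integral>\<omega>. h (U (j + l) \<omega>) \<partial>P) - c\<bar> \<le> C * k * \<rho> ^ l * (2 + w0)"
        using geoE[OF wbounded_measurable[OF wb] k, of l] by blast
      \<comment> \<open>With limit mean 0, letting \<open>j\<close> tend to infinity bounds the
        centre itself. It can then be dropped, and the constant grows from 1 to 1 + (2 +
        w0).\<close>
      have "(\<lambda>j. \<bar>(\<integral>\<omega>. h (U (j + l) \<omega>) \<partial>P) - c\<bar>) \<longlonglongrightarrow> \<bar>(\<integral>u. h u \<partial>\<nu>) - c\<bar>"
        by (intro tendsto_intros LIMSEQ_ignore_initial_segment conv wb)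
      then have "\<bar>c\<bar> \<le> C * k * \<rho> ^ l * (2 + w0)"
        using c(2) LIMSEQ_le_const2 mean0 by fastforce
      also have "\<dots> * 1 \<le> C * k * \<rho> ^ l * (2 + w0) * (1 + V u)"
        using C k \<rho> w0_nonneg by (intro mult_left_mono) auto
      finally show ?thesis using c(1)[of u] by (simp add: algebra_simps)
    qed
    have cov: "(\<integral>\<omega>. h (U j \<omega>) * h (U (j + l) \<omega>) \<partial>P) \<le> D * \<rho> ^ l" for j l
    proof -
      let ?K = "C * k * (3 + w0) * \<rho> ^ l"
      have K0: "0 \<le> ?K" using C k \<rho> w0_nonneg by simp
      have "(\<integral>\<omega>. h (U j \<omega>) * h (U (j + l) \<omega>) \<partial>P) = (\<integral>\<omega>. h (U j \<omega>) * (T ^^ l) h (U j \<omega>) \<partial>P)"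
        by (rule integral_steps[OF wb wb])
      also have "\<dots> \<le> (\<integral>\<omega>. 2 * k * ?K * (1 + W (U j \<omega>) + W (U j \<omega>)) \<partial>P)"
      proof (rule integral_mono)
        show "h (U j \<omega>) * (T ^^ l) h (U j \<omega>) \<le> 2 * k * ?K * (1 + W (U j \<omega>) + W (U j \<omega>))" for \<omega>
          by (rule abs_le_D1[OF abs_mult_le_W[OF k(1) K0 k(2) Tl]])
      qed (auto intro!: integrable_U_mult wb wbounded_funpow_T)
      also have "\<dots> = 2 * k * ?K * (1 + 2 * (\<integral>\<omega>. W (U j \<omega>) \<partial>P))"
        by (simp add: prob_space)
      also have "\<dots> \<le> 2 * k * ?K * (1 + 2 * w0)"
        using W_bound[of j] k K0 by (intro mult_left_mono) auto
      also have "\<dots> = (2 * k * (C * k * (3 + w0)) * (1 + 2 * w0)) * \<rho> ^ l" by simp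
      also have "\<dots> \<le> D * \<rho> ^ l"
        unfolding D_def using k \<rho> w0_nonneg by (intro mult_right_mono) auto
      finally show ?thesis .
    qed
    have D0: "0 \<le> D" unfolding D_def using C k w0_nonneg by simp
    define q where "q = \<rho> / (1 - \<rho>)"
    have sum_geo: "(\<Sum>i=1..n. \<rho> ^ (Suc n - i)) \<le> q" for n
    proof -
      have "(\<Sum>i=1..n. \<rho> ^ (Suc n - i)) = (\<Sum>i=1..n. \<rho> ^ i)"
        by (rule sum.reindex_bij_witness[of _ "\<lambda>i. Suc n - i" "\<lambda>i. Suc n - i"]) auto
      also have "\<dots> = \<rho> * (\<Sum>i<n. \<rho> ^ i)"
        by (simp add: sum_distrib_left sum.atLeast1_atMost_eq)
      also have "\<dots> = \<rho> * ((1 - \<rho> ^ n) / (1 - \<rho>))"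
        using \<rho> by (subst sum_gp_strict) auto
      also have "\<dots> \<le> q" unfolding q_def using \<rho> by (simp add: divide_right_mono)
      finally show ?thesis .
    qed
    have int2: "integrable P (\<lambda>\<omega>. (\<Sum>k=1..n. h (U k \<omega>)) * h (U i \<omega>))" for n i
      unfolding sum_distrib_right by (intro Bochner_Integration.integrable_sum integrable_U_mult wb)
    have int3: "integrable P (\<lambda>\<omega>. (\<Sum>k=1..n. h (U k \<omega>))\<^sup>2)" for n
      unfolding power2_eq_square sum_product by (intro Bochner_Integration.integrable_sum integrable_U_mult wb)
    \<comment> \<open>Each new summand adds its own square, at most \<open>D\<close>, and twice its
      covariances with all predecessors, at most 2 D q by the geometric series.\<close>
    have "(\<integral>\<omega>. (\<Sum>k=1..n. h (U k \<omega>))\<^sup>2 \<partial>P) \<le> (2 * D * q + D) * real n" for n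
    proof (induction n)
      case 0 then show ?case by simp
    next
      case (Suc n)
      have "(\<integral>\<omega>. (\<Sum>k=1..Suc n. h (U k \<omega>))\<^sup>2 \<partial>P)
          = (\<integral>\<omega>. (\<Sum>k=1..n. h (U k \<omega>))\<^sup>2 + 2 * ((\<Sum>k=1..n. h (U k \<omega>)) * h (U (Suc n) \<omega>)) + h (U (Suc n) \<omega>) * h (U (Suc n) \<omega>) \<partial>P)"
        by (intro Bochner_Integration.integral_cong) (auto simp: power2_eq_square algebra_simps)
      also have "\<dots> = (\<integral>\<omega>. (\<Sum>k=1..n. h (U k \<omega>))\<^sup>2 \<partial>P)
          + 2 * (\<integral>\<omega>. (\<Sum>k=1..n. h (U k \<omega>)) * h (U (Suc n) \<omega>) \<partial>P) + (\<integral>\<omega>. h (U (Suc n) \<omega>) * h (U (Suc n) \<omega>) \<partial>P)"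
        using int2[of n "Suc n"] int3[of n] integrable_U_mult[OF wb wb, of "Suc n" "Suc n"] by simp
      also have "(\<integral>\<omega>. h (U (Suc n) \<omega>) * h (U (Suc n) \<omega>) \<partial>P) \<le> D"
        using cov[of "Suc n" 0] by simp
      also have "(\<integral>\<omega>. (\<Sum>k=1..n. h (U k \<omega>)) * h (U (Suc n) \<omega>) \<partial>P) \<le> D * q"
      proof -
        have "(\<integral>\<omega>. (\<Sum>k=1..n. h (U k \<omega>)) * h (U (Suc n) \<omega>) \<partial>P) = (\<Sum>k=1..n. \<integral>\<omega>. h (U k \<omega>) * h (U (Suc n) \<omega>) \<partial>P)"
          unfolding sum_distrib_right by (intro Bochner_Integration.integral_sum integrable_U_mult wb)
        also have "\<dots> \<le> (\<Sum>k=1..n. D * \<rho> ^ (Suc n - k))"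
          using cov[of _ "Suc n - _"] by (intro sum_mono) (metis atLeastAtMost_iff cov le_SucI le_add_diff_inverse)
        also have "\<dots> = D * (\<Sum>k=1..n. \<rho> ^ (Suc n - k))" by (simp add: sum_distrib_left)
        also have "\<dots> \<le> D * q" by (intro mult_left_mono sum_geo D0)
        finally show ?thesis .
      qed
      finally show ?case using Suc.IH by (simp add: algebra_simps)
    qed
    then show ?thesis by blast
  qed
  have "\<exists>K. \<forall>n. (\<integral>\<omega>. (\<Sum>k=1..n. \<phi> (U k \<omega>) - (\<integral>u. \<phi> u \<partial>\<nu>))\<^sup>2 \<partial>P) \<le> K * real n" if wb: "wbounded \<phi>" for \<phi>
    using nu_int[OF wb] by (intro lln wbounded_diff wb wbounded_const) (simp add: nu.prob_space)
  with nu tv nu_int show ?thesis by blast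
qed

end

subsection \<open>Gaussian measure\<close>

lemma borel_measurable_vec_nth_comp [measurable (raw)]:
  fixes g :: "'a \<Rightarrow> ('b::euclidean_space)^'i::finite"
  assumes "g \<in> borel_measurable M"
  shows "(\<lambda>x. g x $ i) \<in> borel_measurable M"
  by (rule measurable_compose[OF assms]) (intro borel_measurable_continuous_onI continuous_intros)

lemma borel_measurable_vec_lambda [measurable (raw)]:
  fixes h :: "'i::finite \<Rightarrow> 'a \<Rightarrow> real^'d"
  assumes "\<And>i. h i \<in> borel_measurable M"
  shows "(\<lambda>x. \<chi> i. h i x) \<in> borel_measurable M"
  using assms by (subst borel_measurable_euclidean_space) (auto simp: Basis_vec_def inner_axis intro!: borel_measurable_vec_nth_comp)

lemma nn_integral_lborel_vec_prod:
  fixes f :: "real \<Rightarrow> ennreal"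
  assumes [measurable]: "f \<in> borel_measurable borel"
  shows "(\<integral>\<^sup>+x. (\<Prod>i\<in>UNIV. f (x $ i)) \<partial>(lborel :: (real^'d::finite) measure)) = (\<integral>\<^sup>+t. f t \<partial>lborel) ^ CARD('d)"
proof -
  have B: "(Basis :: (real^'d) set) = (\<lambda>i. axis i 1) ` UNIV" by (auto simp: Basis_vec_def)
  have inj: "inj (\<lambda>i::'d. axis i (1::real))" by (auto simp: inj_def axis_eq_axis)
  have "(\<Prod>i\<in>UNIV. f (x $ i)) = (\<Prod>b\<in>Basis. f (x \<bullet> b))" for x :: "real^'d"
    unfolding B by (subst prod.reindex[OF inj]) (simp add: cart_eq_inner_axis)
  then have "(\<integral>\<^sup>+x. (\<Prod>i\<in>UNIV. f (x $ i)) \<partial>(lborel :: (real^'d) measure)) = (\<Prod>b\<in>(Basis :: (real^'d) set). \<integral>\<^sup>+t. f t \<partial>lborel)"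
    using nn_integral_lborel_prod[of "\<lambda>_ :: real^'d. f"] by simp
  then show ?thesis by simp
qed

definition gauss :: "(real^'d::finite) measure" where
  "gauss = density lborel (\<lambda>x. ennreal (\<Prod>i\<in>UNIV. std_normal_density (x $ i)))"

lemma sets_gauss [simp, measurable_cong]: "sets gauss = sets borel"
  and space_gauss [simp]: "space gauss = UNIV"
  by (simp_all add: gauss_def)

lemma prob_space_gauss: "prob_space (gauss :: (real^'d::finite) measure)"
proof (rule prob_spaceI)
  have 1: "(\<integral>\<^sup>+t. ennreal (std_normal_density t) \<partial>lborel) = 1"
    by (subst nn_integral_eq_integral) auto
  have "emeasure (gauss :: (real^'d) measure) (space gauss)
      = (\<integral>\<^sup>+x. (\<Prod>i\<in>UNIV. ennreal (std_normal_density (x $ i))) \<partial>(lborel :: (real^'d) measure))"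
    unfolding gauss_def by (subst emeasure_density) (auto simp: prod_ennreal)
  also have "\<dots> = 1" by (subst nn_integral_lborel_vec_prod) (auto simp: 1)
  finally show "emeasure (gauss :: (real^'d) measure) (space gauss) = 1" .
qed

interpretation gauss: prob_space "gauss :: (real^'d::finite) measure"
  by (rule prob_space_gauss)

text \<open>Serves to dominate |w|^2 by the product of the factors 1 + w_i^2, so that the Gaussian
  second moment is bounded by a power of a one-dimensional integral.\<close>

lemma one_plus_sum_le_prod:
  fixes a :: "'i \<Rightarrow> real"
  assumes "finite I" "\<And>i. 0 \<le> a i"
  shows "1 + (\<Sum>i\<in>I. a i) \<le> (\<Prod>i\<in>I. 1 + a i)"
  using assms(1)
proof induction
  case empty then show ?case by simp
next
  case (insert i I)
  have "1 + (\<Sum>i\<in>insert i I. a i) \<le> (1 + a i) * (1 + (\<Sum>i\<in>I. a i))"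
    using insert assms(2) by (simp add: algebra_simps sum_nonneg)
  also have "\<dots> \<le> (1 + a i) * (\<Prod>i\<in>I. 1 + a i)"
    using insert assms(2) by (intro mult_left_mono) (auto intro: add_nonneg_nonneg)
  finally show ?case using insert by simp
qed

lemma norm_vec_sq: "(norm (x :: ('b::real_inner)^'i::finite))\<^sup>2 = (\<Sum>i\<in>UNIV. (norm (x $ i))\<^sup>2)"
  by (simp add: power2_norm_eq_inner inner_vec_def)

lemma gauss_second_moment: "integrable gauss (\<lambda>w :: real^'d::finite. (norm w)\<^sup>2)"
proof (rule integrableI_nonneg)
  have int: "integrable lborel (\<lambda>t. std_normal_density t * (1 + t\<^sup>2))"
    using integrable_normal_density[of 1 0] integrable_normal_moment[of 1 0 2]
    by (simp add: distrib_left)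
  have fin: "(\<integral>\<^sup>+t. ennreal (std_normal_density t * (1 + t\<^sup>2)) \<partial>lborel) < \<infinity>"
    using int by (subst nn_integral_eq_integral) (auto intro!: AE_I2)
  have "(\<integral>\<^sup>+w. ennreal ((norm (w :: real^'d))\<^sup>2) \<partial>gauss)
      \<le> (\<integral>\<^sup>+w. (\<Prod>i\<in>UNIV. ennreal (std_normal_density (w $ i) * (1 + (w $ i)\<^sup>2))) \<partial>(lborel :: (real^'d) measure))"
    unfolding gauss_def
  proof (subst nn_integral_density, goal_cases)
    case 3
    show ?case
    proof (rule nn_integral_mono)
      fix w :: "real^'d"
      have "(norm w)\<^sup>2 \<le> (\<Prod>i\<in>UNIV. 1 + (w $ i)\<^sup>2)"
        using one_plus_sum_le_prod[of UNIV "\<lambda>i. (w $ i)\<^sup>2"] by (simp add: norm_vec_sq)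
      then have "(\<Prod>i\<in>UNIV. std_normal_density (w $ i)) * (norm w)\<^sup>2
          \<le> (\<Prod>i\<in>UNIV. std_normal_density (w $ i)) * (\<Prod>i\<in>UNIV. 1 + (w $ i)\<^sup>2)"
        by (intro mult_left_mono) (auto intro: prod_nonneg)
      then show "ennreal (\<Prod>i\<in>UNIV. std_normal_density (w $ i)) * ennreal ((norm w)\<^sup>2)
          \<le> (\<Prod>i\<in>UNIV. ennreal (std_normal_density (w $ i) * (1 + (w $ i)\<^sup>2)))"
        by (subst prod_ennreal) (auto simp: ennreal_mult[symmetric] prod_nonneg prod.distrib intro!: ennreal_leI)
    qed
  qed auto
  also have "\<dots> = (\<integral>\<^sup>+t. ennreal (std_normal_density t * (1 + t\<^sup>2)) \<partial>lborel) ^ CARD('d)"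
    by (subst nn_integral_lborel_vec_prod) auto
  also have "\<dots> < \<infinity>" using fin by (simp add: power_less_top_ennreal)
  finally show "(\<integral>\<^sup>+w. ennreal ((norm (w :: real^'d))\<^sup>2) \<partial>gauss) < \<infinity>" .
qed auto

text \<open>After the substitution y = t + \<sigma> w only those w matter with |t + \<sigma> w| <=
  1, and for |t| <= r they lie in one compact ball. The minimum of the density there, divided by the
  Jacobian \<sigma>^d, is \<open>c\<close>. The unit ball on the left does not move with
  \<open>t\<close>, which is what makes starting points comparable.\<close>

lemma gauss_lower_bound:
  fixes r \<sigma> :: real
  assumes "\<sigma> > 0"
  shows "\<exists>c>0. \<forall>t::real^'d::finite. norm t \<le> r \<longrightarrow> (\<forall>f\<in>borel_measurable borel.
    ennreal c * (\<integral>\<^sup>+y. f y * indicator (cball 0 1) y \<partial>lborel) \<le> (\<integral>\<^sup>+w. f (t + \<sigma> *\<^sub>R w) \<partial>gauss))"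
proof -
  define p where "p w = (\<Prod>i\<in>UNIV. std_normal_density (w $ i))" for w :: "real^'d"
  have p0: "p w > 0" for w unfolding p_def by (intro prod_pos) (auto intro: normal_density_pos)
  \<comment> \<open>The radius comes from |\<sigma> w| <= 1 + r; the maximum with 0 keeps the ball
    nonempty for negative \<open>r\<close>, so that a minimum exists.\<close>
  define K where "K = cball (0::real^'d) (max 0 ((1 + r) / \<sigma>))"
  have "continuous_on K p"
    unfolding p_def std_normal_density_def by (intro continuous_intros) auto
  moreover have "compact K" "K \<noteq> {}" by (auto simp: K_def)
  ultimately obtain w0 where w0: "\<And>w. w \<in> K \<Longrightarrow> p w0 \<le> p w"
    using continuous_attains_inf by metis
  have [measurable]: "cball (0::real^'d) 1 \<in> sets borel" by simp
  define c where "c = p w0 / \<sigma> ^ CARD('d)"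
  have c: "c > 0" using p0 assms by (simp add: c_def)
  have "ennreal c * (\<integral>\<^sup>+y. f y * indicator (cball 0 1) y \<partial>lborel) \<le> (\<integral>\<^sup>+w. f (t + \<sigma> *\<^sub>R w) \<partial>gauss)"
    if t: "norm t \<le> r" and f [measurable]: "f \<in> borel_measurable borel" for t :: "real^'d" and f
  proof -
    have "(\<integral>\<^sup>+y. f y * indicator (cball 0 1) y \<partial>lborel)
        = (\<integral>\<^sup>+w. ennreal (\<sigma> ^ CARD('d)) * (f (t + \<sigma> *\<^sub>R w) * indicator (cball 0 1) (t + \<sigma> *\<^sub>R w)) \<partial>lborel)"
    proof -
      have "(\<integral>\<^sup>+y. f y * indicator (cball 0 1) y \<partial>lborel)
          = (\<integral>\<^sup>+y. f y * indicator (cball 0 1) y \<partial>density (distr lborel borel (\<lambda>w. t + \<sigma> *\<^sub>R w)) (\<lambda>_. ennreal (\<sigma> ^ CARD('d))))"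
        using lborel_affine[of \<sigma> t] assms by simp
      also have "\<dots> = (\<integral>\<^sup>+y. ennreal (\<sigma> ^ CARD('d)) * (f y * indicator (cball 0 1) y) \<partial>distr lborel borel (\<lambda>w. t + \<sigma> *\<^sub>R w))"
        by (rule nn_integral_density) measurable
      finally show ?thesis by (subst (asm) nn_integral_distr) measurable
    qed
    also have "\<dots> = ennreal (\<sigma> ^ CARD('d)) * (\<integral>\<^sup>+w. f (t + \<sigma> *\<^sub>R w) * indicator (cball 0 1) (t + \<sigma> *\<^sub>R w) \<partial>lborel)"
      by (rule nn_integral_cmult) measurable
    finally have "ennreal c * (\<integral>\<^sup>+y. f y * indicator (cball 0 1) y \<partial>lborel)
        = ennreal (p w0) * (\<integral>\<^sup>+w. f (t + \<sigma> *\<^sub>R w) * indicator (cball 0 1) (t + \<sigma> *\<^sub>R w) \<partial>lborel)"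
      using assms p0[of w0] by (simp add: c_def mult.assoc[symmetric] ennreal_mult'[symmetric])
    also have "\<dots> = (\<integral>\<^sup>+w. ennreal (p w0) * (f (t + \<sigma> *\<^sub>R w) * indicator (cball 0 1) (t + \<sigma> *\<^sub>R w)) \<partial>lborel)"
      by (rule nn_integral_cmult[symmetric]) measurable
    also have "\<dots> \<le> (\<integral>\<^sup>+w. ennreal (p w) * f (t + \<sigma> *\<^sub>R w) \<partial>lborel)"
    proof (rule nn_integral_mono)
      fix w :: "real^'d"
      show "ennreal (p w0) * (f (t + \<sigma> *\<^sub>R w) * indicator (cball 0 1) (t + \<sigma> *\<^sub>R w)) \<le> ennreal (p w) * f (t + \<sigma> *\<^sub>R w)"
      proof (cases "t + \<sigma> *\<^sub>R w \<in> cball 0 1")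
        case True
        have "\<sigma> * norm w = norm (\<sigma> *\<^sub>R w)" using assms by simp
        also have "\<dots> \<le> norm (t + \<sigma> *\<^sub>R w) + norm t"
          using norm_triangle_ineq4[of "t + \<sigma> *\<^sub>R w" t] by simp
        also have "\<dots> \<le> 1 + r" using True t by simp
        finally have "w \<in> K" using assms by (simp add: K_def pos_le_divide_eq mult.commute le_max_iff_disj)
        with w0 True show ?thesis by (auto intro!: mult_right_mono ennreal_leI)
      qed simp
    qed
    also have "\<dots> = (\<integral>\<^sup>+w. f (t + \<sigma> *\<^sub>R w) \<partial>gauss)"
      unfolding gauss_def p_def by (subst nn_integral_density) auto
    finally show ?thesis .
  qed
  with c show ?thesis by blast
qed

section \<open>The joint law of one Gaussian vector and one index\<close>

definition noise :: "((real^'d::finite) \<times> 'n::finite) measure" where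
  "noise = gauss \<Otimes>\<^sub>M uniform_count_measure UNIV"

lemma prob_space_uniform: "prob_space (uniform_count_measure (UNIV :: 'n::finite set))"
  by (rule prob_space_uniform_count_measure) auto

lemma prob_space_noise: "prob_space (noise :: ((real^'d::finite) \<times> 'n::finite) measure)"
  unfolding noise_def by (intro prob_space_pair prob_space_gauss prob_space_uniform)

lemma sets_noise [measurable_cong]: "sets (noise :: ((real^'d::finite) \<times> 'n::finite) measure) = sets (borel \<Otimes>\<^sub>M count_space UNIV)"
  unfolding noise_def by (intro sets_pair_measure_cong) (simp_all add: sets_uniform_count_measure)

lemma nn_integral_noise:
  fixes f :: "(real^'d::finite) \<times> 'n::finite \<Rightarrow> ennreal"
  assumes [measurable]: "f \<in> borel_measurable noise"
  shows "(\<integral>\<^sup>+z. f z \<partial>noise) = (\<Sum>s\<in>UNIV. ennreal (1 / real CARD('n)) * (\<integral>\<^sup>+w. f (w, s) \<partial>gauss))"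
proof -
  interpret u: prob_space "uniform_count_measure (UNIV :: 'n set)" by (rule prob_space_uniform)
  interpret pair_sigma_finite "gauss :: (real^'d) measure" "uniform_count_measure (UNIV :: 'n set)" ..
  have "(\<integral>\<^sup>+z. f z \<partial>noise) = (\<integral>\<^sup>+s. \<integral>\<^sup>+w. f (w, s) \<partial>gauss \<partial>uniform_count_measure UNIV)"
    using assms unfolding noise_def by (rule nn_integral_snd[symmetric])
  then show ?thesis
    unfolding uniform_count_measure_def by (simp add: nn_integral_point_measure_finite)
qed

subsection \<open>Drift of the SAGA-LD step\<close>

definition saga_step ::
  "('n::finite \<Rightarrow> real^'d::finite \<Rightarrow> real^'d) \<Rightarrow> real \<Rightarrow> (real^'d) \<times> (real^'d^'n) \<Rightarrow> (real^'d) \<times> 'n \<Rightarrow> (real^'d) \<times> (real^'d^'n)" where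
  "saga_step F \<eta> u z = (case u of (x, g) \<Rightarrow> case z of (w, s) \<Rightarrow>
     (x - (\<eta> / real CARD('n)) *\<^sub>R (\<Sum>i\<in>UNIV. g $ i) - \<eta> *\<^sub>R (F s x - g $ s) + sqrt (2 * \<eta>) *\<^sub>R w,
      \<chi> i. if s = i then F i x else g $ i))"

lemma saga_ld_Suc: "saga_ld F \<eta> X0 \<xi> S (Suc n) \<omega> = saga_step F \<eta> (saga_ld F \<eta> X0 \<xi> S n \<omega>) (\<xi> (Suc n) \<omega>, S n \<omega>)"
  by (simp add: saga_step_def Let_def split: prod.split)

text \<open>Young's inequality with a free weight: a small \<theta> nearly keeps the first square
  and charges 1 / \<theta> to the second.\<close>

lemma norm_add_sq_le:
  fixes a b :: "'a::real_inner" and \<theta> :: real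
  assumes "\<theta> > 0"
  shows "(norm (a + b))\<^sup>2 \<le> (1 + \<theta>) * (norm a)\<^sup>2 + (1 + 1 / \<theta>) * (norm b)\<^sup>2"
proof -
  have "0 \<le> (sqrt \<theta> * norm a - norm b / sqrt \<theta>)\<^sup>2" by simp
  also have "\<dots> = \<theta> * (norm a)\<^sup>2 - 2 * (norm a * norm b) + (norm b)\<^sup>2 / \<theta>"
    using assms by (simp add: power2_diff power_mult_distrib power_divide)
  finally have "2 * (norm a * norm b) \<le> \<theta> * (norm a)\<^sup>2 + (norm b)\<^sup>2 / \<theta>" by simp
  moreover have "(norm (a + b))\<^sup>2 \<le> (norm a + norm b)\<^sup>2"
    by (intro power_mono norm_triangle_ineq) auto
  ultimately show ?thesis by (simp add: power2_sum algebra_simps)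
qed

text \<open>For errors of mean 0 the cross term vanishes: bias and variance separate, and the
  variance carries the factor \<eta>^2.\<close>

lemma sum_norm_sq_centered:
  fixes p :: "'a::real_inner" and e :: "'n::finite \<Rightarrow> 'a"
  assumes "(\<Sum>s\<in>UNIV. e s) = 0"
  shows "(\<Sum>s\<in>UNIV. (norm (p - \<eta> *\<^sub>R e s))\<^sup>2) = real CARD('n) * (norm p)\<^sup>2 + \<eta>\<^sup>2 * (\<Sum>s\<in>UNIV. (norm (e s))\<^sup>2)"
proof -
  have "(norm (p - \<eta> *\<^sub>R e s))\<^sup>2 = (norm p)\<^sup>2 - 2 * \<eta> * (p \<bullet> e s) + \<eta>\<^sup>2 * (norm (e s))\<^sup>2" for s
    unfolding power2_norm_eq_inner by (simp add: inner_diff inner_commute power2_eq_square)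
  then have "(\<Sum>s\<in>UNIV. (norm (p - \<eta> *\<^sub>R e s))\<^sup>2)
      = (\<Sum>s\<in>(UNIV::'n set). (norm p)\<^sup>2) - 2 * \<eta> * (p \<bullet> (\<Sum>s\<in>UNIV. e s)) + \<eta>\<^sup>2 * (\<Sum>s\<in>UNIV. (norm (e s))\<^sup>2)"
    by (simp add: sum.distrib sum_subtractf sum_distrib_left inner_sum_right)
  then show ?thesis by (simp add: assms)
qed

text \<open>The error of a SAGA step is the mean table deviation minus the deviation of the chosen
  entry. It is centred over the uniform choice whatever the table, so a stale table adds variance
  but no bias.\<close>

lemma variance_le_second_moment:
  fixes D :: "'n::finite \<Rightarrow> 'a::real_inner"
  defines "m \<equiv> (1 / real CARD('n)) *\<^sub>R (\<Sum>i\<in>UNIV. D i)"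
  shows "(\<Sum>s\<in>UNIV. m - D s) = 0" "(\<Sum>s\<in>UNIV. (norm (m - D s))\<^sup>2) \<le> (\<Sum>s\<in>UNIV. (norm (D s))\<^sup>2)"
proof -
  have m: "(\<Sum>i\<in>UNIV. D i) = real CARD('n) *\<^sub>R m" by (simp add: m_def)
  show e0: "(\<Sum>s\<in>UNIV. m - D s) = 0" by (simp add: sum_subtractf m sum_constant_scaleR)
  have "(\<Sum>s\<in>UNIV. (norm (D s))\<^sup>2) = (\<Sum>s\<in>UNIV. (norm (m - 1 *\<^sub>R (m - D s)))\<^sup>2)" by simp
  also have "\<dots> = real CARD('n) * (norm m)\<^sup>2 + (\<Sum>s\<in>UNIV. (norm (m - D s))\<^sup>2)"
    using sum_norm_sq_centered[OF e0, of m 1] by simp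
  finally show "(\<Sum>s\<in>UNIV. (norm (m - D s))\<^sup>2) \<le> (\<Sum>s\<in>UNIV. (norm (D s))\<^sup>2)" by simp
qed


text \<open>In \<open>small\<close> the factor 2 + 2 (1 + 2 N) M^2 collects all terms of order
  \<eta>^2: 2 from the position, the rest from the motion of \<open>F i\<close> in the table part of
  the Lyapunov function. The first condition charges the growth of the mean drift to dissipativity,
  the second charges the step variance to the refreshing of the table. The bound
  \<open>\<eta> * c2 \<le> 2\<close> keeps the Young weight \<eta> c2 / 2 at most 1.\<close>

locale saga =
  fixes F :: "'n::finite \<Rightarrow> real^'d::finite \<Rightarrow> real^'d" and c1 c2 M \<eta> :: real
  assumes c: "c1 > 0" "c2 > 0" and M: "M > 0" and \<eta>: "\<eta> > 0" "\<eta> * c2 \<le> 2"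
    and small: "(2 + 2 * (1 + 2 * real CARD('n)) * M\<^sup>2) * (\<eta> * (2 * M\<^sup>2)) \<le> c2 / 2"
      "(2 + 2 * (1 + 2 * real CARD('n)) * M\<^sup>2) * \<eta>\<^sup>2 \<le> 1 / (4 * real CARD('n))"
    and dissipative: "\<And>x. ((1 / real CARD('n)) *\<^sub>R (\<Sum>i\<in>UNIV. F i x)) \<bullet> x \<ge> c2 * (norm x)\<^sup>2 - c1"
    and lipschitz: "\<And>i x y. norm (F i x - F i y) \<le> M * norm (x - y)"
begin

lemma N1: "real CARD('n) \<ge> 1"
  using zero_less_card_finite[where 'a='n] by simp

definition fbar :: "real^'d \<Rightarrow> real^'d" where "fbar x = (1 / real CARD('n)) *\<^sub>R (\<Sum>i\<in>UNIV. F i x)"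

text \<open>The table is measured against the values \<open>F i\<close> at the current position:
  refreshing an entry sets its deviation to 0 before the move, and the variance of a step depends on
  the table through these deviations alone.\<close>

definition W :: "(real^'d) \<times> (real^'d^'n) \<Rightarrow> real" where
  "W u = (norm (fst u))\<^sup>2 + (1 / real CARD('n)) * (\<Sum>i\<in>UNIV. (norm (snd u $ i - F i (fst u)))\<^sup>2)"

lemma W_nonneg: "0 \<le> W u" by (simp add: W_def sum_nonneg)

lemma F_measurable: "F i \<in> borel_measurable borel"
proof (intro borel_measurable_continuous_onI continuous_onI)
  fix x :: "real^'d" and e :: real assume "e > 0"
  then show "\<exists>d>0. \<forall>x'\<in>UNIV. dist x' x < d \<longrightarrow> dist (F i x') (F i x) \<le> e"
    using M order_trans[OF lipschitz]
    by (intro exI[of _ "e / M"]) (auto simp: dist_norm field_simps)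
qed

lemma F_measurable' [measurable (raw)]: "f \<in> borel_measurable Q \<Longrightarrow> (\<lambda>x. F i (f x)) \<in> borel_measurable Q"
  by (rule measurable_compose[OF _ F_measurable])

lemma W_measurable [measurable]: "W \<in> borel_measurable borel"
proof -
  have [measurable]: "fst \<in> borel_measurable (borel :: ((real^'d) \<times> (real^'d^'n)) measure)"
    "snd \<in> borel_measurable (borel :: ((real^'d) \<times> (real^'d^'n)) measure)"
    by (simp_all add: borel_prod[symmetric])
  show ?thesis unfolding W_def by measurable
qed

lemma fbar_lipschitz: "norm (fbar x - fbar y) \<le> M * norm (x - y)"
proof -
  have "norm (fbar x - fbar y) = norm (\<Sum>i\<in>UNIV. F i x - F i y) / real CARD('n)"
    by (simp add: fbar_def scaleR_diff_right[symmetric] sum_subtractf)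
  moreover have "norm (\<Sum>i\<in>UNIV. F i x - F i y) \<le> (\<Sum>i\<in>(UNIV::'n set). M * norm (x - y))"
    by (intro order_trans[OF norm_sum] sum_mono lipschitz)
  ultimately show ?thesis using N1 by (simp add: pos_divide_le_eq mult.commute)
qed

lemma fbar_sq: "(norm (fbar x))\<^sup>2 \<le> 2 * M\<^sup>2 * (norm x)\<^sup>2 + 2 * (norm (fbar 0))\<^sup>2"
proof -
  have "norm (fbar x) \<le> M * norm x + norm (fbar 0)"
    using fbar_lipschitz[of x 0] norm_triangle_ineq2[of "fbar x" "fbar 0"] by simp
  then have "(norm (fbar x))\<^sup>2 \<le> (M * norm x + norm (fbar 0))\<^sup>2" by (intro power_mono) auto
  also have "\<dots> \<le> 2 * (M * norm x)\<^sup>2 + 2 * (norm (fbar 0))\<^sup>2"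
    using zero_le_power2[of "M * norm x - norm (fbar 0)"] by (simp add: power2_sum power2_diff)
  finally show ?thesis by (simp add: power_mult_distrib)
qed

text \<open>For a fixed index the step is a Borel function; the finitely many indices are then glued
  along the discrete argument.\<close>

lemma saga_step_measurable:
  "case_prod (saga_step F \<eta>) \<in> measurable (borel \<Otimes>\<^sub>M noise) borel"
proof -
  let ?h = "\<lambda>s (p :: ((real^'d) \<times> (real^'d^'n)) \<times> ((real^'d) \<times> 'n)). saga_step F \<eta> (fst p) (fst (snd p), s)"
  have "(\<lambda>p. ?h (snd (snd p)) p) \<in> measurable (borel \<Otimes>\<^sub>M noise) borel"
  proof (rule measurable_compose_countable'[where f="?h" and g="\<lambda>p. snd (snd p)" and I=UNIV])
    fix s :: 'n
    have [measurable]: "(\<lambda>p. fst (fst p)) \<in> borel_measurable ((borel :: ((real^'d) \<times> (real^'d^'n)) measure) \<Otimes>\<^sub>M (noise :: ((real^'d) \<times> 'n) measure))"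
      "(\<lambda>p. snd (fst p)) \<in> borel_measurable ((borel :: ((real^'d) \<times> (real^'d^'n)) measure) \<Otimes>\<^sub>M (noise :: ((real^'d) \<times> 'n) measure))"
      by (simp_all add: borel_prod[symmetric])
    have "(\<lambda>p. (fst (fst p) - (\<eta> / real CARD('n)) *\<^sub>R (\<Sum>i\<in>UNIV. snd (fst p) $ i) - \<eta> *\<^sub>R (F s (fst (fst p)) - snd (fst p) $ s) + sqrt (2 * \<eta>) *\<^sub>R fst (snd p),
      \<chi> i. if s = i then F i (fst (fst p)) else snd (fst p) $ i))
      \<in> measurable ((borel :: ((real^'d) \<times> (real^'d^'n)) measure) \<Otimes>\<^sub>M (noise :: ((real^'d) \<times> 'n) measure)) (borel \<Otimes>\<^sub>M borel)"
      by measurable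
    then show "?h s \<in> measurable (borel \<Otimes>\<^sub>M noise) borel"
      unfolding saga_step_def case_prod_beta fst_conv snd_conv borel_prod .
  qed (auto intro: countable_finite)
  then show ?thesis by (simp add: case_prod_beta')
qed

text \<open>The Young weights are \<eta> c2 / 2 for splitting off the noise and 1 / (2 N) for the
  change of \<open>F i\<close> along the move, each a fraction of the contraction that averaging
  over \<open>s\<close> will supply. The noise is split off in norm, so only its second moment will
  enter. The factor in \<open>1 *\<^sub>R e s\<close> keeps the shape of
  \<open>sum_norm_sq_centered\<close>.\<close>

lemma W_step_pointwise:
  fixes x :: "real^'d" and g :: "real^'d^'n" and w :: "real^'d" and s :: 'n
  defines "D \<equiv> \<lambda>i. g $ i - F i x"
  defines "e \<equiv> \<lambda>s. (1 / real CARD('n)) *\<^sub>R (\<Sum>i\<in>UNIV. D i) - D s"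
  shows "W (saga_step F \<eta> (x, g) (w, s)) \<le>
    (1 + \<eta> * c2 / 2) * (norm (x - \<eta> *\<^sub>R fbar x - \<eta> *\<^sub>R e s))\<^sup>2
    + (1 + 1 / (2 * real CARD('n))) * ((1 / real CARD('n)) * (\<Sum>i\<in>UNIV. if i = s then 0 else (norm (D i))\<^sup>2))
    + 2 * (1 + 2 * real CARD('n)) * M\<^sup>2 * \<eta>\<^sup>2 * (norm (- fbar x - 1 *\<^sub>R e s))\<^sup>2
    + ((1 + 2 / (\<eta> * c2)) * (2 * \<eta>) + 2 * (1 + 2 * real CARD('n)) * M\<^sup>2 * (2 * \<eta>)) * (norm w)\<^sup>2"
proof -
  define y where "y = x - \<eta> *\<^sub>R fbar x - \<eta> *\<^sub>R e s"
  define x' where "x' = y + sqrt (2 * \<eta>) *\<^sub>R w"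
  define g' where "g' = (\<chi> i. if s = i then F i x else g $ i)"
  have "(1 / real CARD('n)) *\<^sub>R (\<Sum>i\<in>UNIV. D i) = (1 / real CARD('n)) *\<^sub>R (\<Sum>i\<in>UNIV. g $ i) - fbar x"
    by (simp add: D_def sum_subtractf fbar_def scaleR_diff_right)
  then have "e s = (1 / real CARD('n)) *\<^sub>R (\<Sum>i\<in>UNIV. g $ i) - fbar x - (g $ s - F s x)"
    unfolding e_def by (simp only: D_def)
  then have "\<eta> *\<^sub>R e s = (\<eta> / real CARD('n)) *\<^sub>R (\<Sum>i\<in>UNIV. g $ i) - \<eta> *\<^sub>R fbar x - \<eta> *\<^sub>R g $ s + \<eta> *\<^sub>R F s x"
    by (simp add: scaleR_diff_right)
  then have step: "saga_step F \<eta> (x, g) (w, s) = (x', g')"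
    by (simp add: saga_step_def x'_def y_def g'_def algebra_simps)
  have \<sigma>w: "(norm (sqrt (2 * \<eta>) *\<^sub>R w))\<^sup>2 = 2 * \<eta> * (norm w)\<^sup>2"
    using \<eta> by (simp add: power_mult_distrib)
  have "(norm x')\<^sup>2 \<le> (1 + \<eta> * c2 / 2) * (norm y)\<^sup>2 + (1 + 1 / (\<eta> * c2 / 2)) * (2 * \<eta> * (norm w)\<^sup>2)"
    unfolding \<sigma>w[symmetric] x'_def using \<eta> c by (intro norm_add_sq_le) auto
  then have A: "(norm x')\<^sup>2 \<le> (1 + \<eta> * c2 / 2) * (norm y)\<^sup>2 + (1 + 2 / (\<eta> * c2)) * (2 * \<eta>) * (norm w)\<^sup>2"
    by (simp add: mult.assoc)
  have "x' - x = \<eta> *\<^sub>R (- fbar x - 1 *\<^sub>R e s) + sqrt (2 * \<eta>) *\<^sub>R w"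
    by (simp add: x'_def y_def algebra_simps)
  then have "(norm (x' - x))\<^sup>2 \<le> (1 + 1) * (norm (\<eta> *\<^sub>R (- fbar x - 1 *\<^sub>R e s)))\<^sup>2 + (1 + 1 / 1) * (2 * \<eta> * (norm w)\<^sup>2)"
    unfolding \<sigma>w[symmetric] by (simp only:) (rule norm_add_sq_le, simp)
  then have move: "(norm (x' - x))\<^sup>2 \<le> 2 * (\<eta>\<^sup>2 * (norm (- fbar x - 1 *\<^sub>R e s))\<^sup>2 + 2 * \<eta> * (norm w)\<^sup>2)"
    by (simp add: power_mult_distrib)
  \<comment> \<open>The new deviation is the old one, or 0 for the refreshed entry, plus the change
    of \<open>F i\<close> between the two positions, which the Lipschitz bound controls by the
    move.\<close>
  have "(norm (g' $ i - F i x'))\<^sup>2 \<le> (1 + 1 / (2 * real CARD('n))) * (if i = s then 0 else (norm (D i))\<^sup>2) + (1 + 2 * real CARD('n)) * (M\<^sup>2 * (norm (x' - x))\<^sup>2)" for i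
  proof -
    define q where "q = F i x - F i x'"
    have "norm q \<le> M * norm (x - x')" unfolding q_def by (rule lipschitz)
    then have "(norm q)\<^sup>2 \<le> (M * norm (x - x'))\<^sup>2" by (intro power_mono) auto
    then have q2: "(norm q)\<^sup>2 \<le> M\<^sup>2 * (norm (x' - x))\<^sup>2" by (simp add: power_mult_distrib norm_minus_commute)
    have "(norm (g' $ i - F i x'))\<^sup>2 = (norm ((if i = s then 0 else D i) + q))\<^sup>2"
      by (auto simp: g'_def q_def D_def)
    also have "\<dots> \<le> (1 + 1 / (2 * real CARD('n))) * (norm (if i = s then 0 else D i))\<^sup>2 + (1 + 1 / (1 / (2 * real CARD('n)))) * (norm q)\<^sup>2"
      using N1 by (intro norm_add_sq_le) auto
    also have "\<dots> \<le> (1 + 1 / (2 * real CARD('n))) * (norm (if i = s then 0 else D i))\<^sup>2 + (1 + 2 * real CARD('n)) * (M\<^sup>2 * (norm (x' - x))\<^sup>2)"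
      using q2 by (auto intro!: mult_left_mono)
    finally show ?thesis by (auto split: if_splits)
  qed
  then have "(\<Sum>i\<in>UNIV. (norm (g' $ i - F i x'))\<^sup>2)
      \<le> (\<Sum>i\<in>UNIV. (1 + 1 / (2 * real CARD('n))) * (if i = s then 0 else (norm (D i))\<^sup>2) + (1 + 2 * real CARD('n)) * (M\<^sup>2 * (norm (x' - x))\<^sup>2))"
    by (rule sum_mono)
  also have "\<dots> = (1 + 1 / (2 * real CARD('n))) * (\<Sum>i\<in>UNIV. if i = s then 0 else (norm (D i))\<^sup>2) + real CARD('n) * ((1 + 2 * real CARD('n)) * (M\<^sup>2 * (norm (x' - x))\<^sup>2))"
    by (simp add: sum.distrib sum_distrib_left)
  finally have "(1 / real CARD('n)) * (\<Sum>i\<in>UNIV. (norm (g' $ i - F i x'))\<^sup>2)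
      \<le> (1 / real CARD('n)) * ((1 + 1 / (2 * real CARD('n))) * (\<Sum>i\<in>UNIV. if i = s then 0 else (norm (D i))\<^sup>2) + real CARD('n) * ((1 + 2 * real CARD('n)) * (M\<^sup>2 * (norm (x' - x))\<^sup>2)))"
    by (rule mult_left_mono) simp
  also have "\<dots> = (1 + 1 / (2 * real CARD('n))) * ((1 / real CARD('n)) * (\<Sum>i\<in>UNIV. if i = s then 0 else (norm (D i))\<^sup>2)) + (1 + 2 * real CARD('n)) * (M\<^sup>2 * (norm (x' - x))\<^sup>2)"
    using N1 by (simp add: distrib_left)
  also have "(1 + 2 * real CARD('n)) * (M\<^sup>2 * (norm (x' - x))\<^sup>2) \<le> (1 + 2 * real CARD('n)) * (M\<^sup>2 * (2 * (\<eta>\<^sup>2 * (norm (- fbar x - 1 *\<^sub>R e s))\<^sup>2 + 2 * \<eta> * (norm w)\<^sup>2)))"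
    using move by (intro mult_left_mono) auto
  finally have B: "(1 / real CARD('n)) * (\<Sum>i\<in>UNIV. (norm (g' $ i - F i x'))\<^sup>2) \<le>
    (1 + 1 / (2 * real CARD('n))) * ((1 / real CARD('n)) * (\<Sum>i\<in>UNIV. if i = s then 0 else (norm (D i))\<^sup>2))
    + (1 + 2 * real CARD('n)) * (M\<^sup>2 * (2 * (\<eta>\<^sup>2 * (norm (- fbar x - 1 *\<^sub>R e s))\<^sup>2 + 2 * \<eta> * (norm w)\<^sup>2)))" by simp
  have "W (x', g') = (norm x')\<^sup>2 + (1 / real CARD('n)) * (\<Sum>i\<in>UNIV. (norm (g' $ i - F i x'))\<^sup>2)" by (simp add: W_def)
  also note add_mono[OF A B]
  finally show ?thesis unfolding step y_def by (simp add: algebra_simps)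
qed

text \<open>The budget. The position starts from the rate 1 - 2 \<eta> c2; the Young weight costs
  \<eta> c2 / 2 and the growth of the mean drift as much again. A table entry survives N - 1 of the
  N choices, so the table starts from 1 - 1 / N; the Young weight leaves 1 - 1 / (2 N), and the step
  variance takes another 1 / (4 N). The rates 1 - \<eta> c2 and 1 - 1 / (4 N) remain.\<close>

lemma mean_step:
  fixes x :: "real^'d" and g :: "real^'d^'n"
  defines "D \<equiv> \<lambda>i. g $ i - F i x"
  defines "e \<equiv> \<lambda>s. (1 / real CARD('n)) *\<^sub>R (\<Sum>i\<in>UNIV. D i) - D s"
  defines "L \<equiv> 2 * (1 + 2 * real CARD('n)) * M\<^sup>2"
  defines "lam \<equiv> max (1 - \<eta> * c2) (1 - 1 / (4 * real CARD('n)))"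
  shows "(1 / real CARD('n)) * (\<Sum>s\<in>UNIV. (1 + \<eta> * c2 / 2) * (norm (x - \<eta> *\<^sub>R fbar x - \<eta> *\<^sub>R e s))\<^sup>2
    + (1 + 1 / (2 * real CARD('n))) * ((1 / real CARD('n)) * (\<Sum>i\<in>UNIV. if i = s then 0 else (norm (D i))\<^sup>2))
    + L * \<eta>\<^sup>2 * (norm (- fbar x - 1 *\<^sub>R e s))\<^sup>2)
    \<le> lam * W (x, g) + (4 * \<eta> * c1 + (2 + L) * \<eta>\<^sup>2 * (2 * (norm (fbar 0))\<^sup>2))"
proof -
  define X where "X = (norm x)\<^sup>2"
  define Y where "Y = (norm (fbar x))\<^sup>2"
  define mD where "mD = (1 / real CARD('n)) * (\<Sum>i\<in>UNIV. (norm (D i))\<^sup>2)"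
  define vr where "vr = (1 / real CARD('n)) * (\<Sum>s\<in>UNIV. (norm (e s))\<^sup>2)"
  define \<theta> where "\<theta> = \<eta> * c2 / 2"
  have \<theta>: "0 < \<theta>" "\<theta> \<le> 1" using \<eta> c by (auto simp: \<theta>_def)
  have L: "L \<ge> 0" using N1 by (simp add: L_def)
  have nonneg: "0 \<le> X" "0 \<le> Y" "0 \<le> mD" "0 \<le> vr"
    by (auto simp: X_def Y_def mD_def vr_def sum_nonneg)
  have e0: "(\<Sum>s\<in>UNIV. e s) = 0" unfolding e_def by (rule variance_le_second_moment(1))
  have vr: "vr \<le> mD" unfolding vr_def mD_def e_def
    by (intro mult_left_mono variance_le_second_moment(2)) simp
  have 1: "(1 / real CARD('n)) * (\<Sum>s\<in>UNIV. (norm (x - \<eta> *\<^sub>R fbar x - \<eta> *\<^sub>R e s))\<^sup>2) = (norm (x - \<eta> *\<^sub>R fbar x))\<^sup>2 + \<eta>\<^sup>2 * vr"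
    unfolding sum_norm_sq_centered[OF e0] using N1 by (simp add: vr_def distrib_left)
  have 2: "(1 / real CARD('n)) * (\<Sum>s\<in>UNIV. (norm (- fbar x - 1 *\<^sub>R e s))\<^sup>2) = Y + vr"
    unfolding sum_norm_sq_centered[OF e0] using N1 by (simp add: vr_def Y_def distrib_left)
  have "(\<Sum>s\<in>UNIV. \<Sum>i\<in>UNIV. if i = s then 0 else (norm (D i))\<^sup>2) = (real CARD('n) - 1) * (\<Sum>i\<in>UNIV. (norm (D i))\<^sup>2)"
  proof -
    have "(\<Sum>i\<in>UNIV. if i = s then 0 else (norm (D i))\<^sup>2) = (\<Sum>i\<in>UNIV. (norm (D i))\<^sup>2) - (norm (D s))\<^sup>2" for s
    proof -
      have "(\<Sum>i\<in>UNIV. if i = s then 0 else (norm (D i))\<^sup>2) = (\<Sum>i\<in>UNIV. (norm (D i))\<^sup>2 - (if i = s then (norm (D i))\<^sup>2 else 0))"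
        by (intro sum.cong) auto
      then show ?thesis by (simp add: sum_subtractf)
    qed
    then show ?thesis by (simp add: sum_subtractf left_diff_distrib)
  qed
  note miss = this
  have 3: "(1 / real CARD('n)) * (\<Sum>s\<in>UNIV. (1 / real CARD('n)) * (\<Sum>i\<in>UNIV. if i = s then 0 else (norm (D i))\<^sup>2)) = (1 - 1 / real CARD('n)) * mD"
    unfolding sum_distrib_left[symmetric] miss using N1 by (simp add: mD_def field_simps)
  have "(norm (x - \<eta> *\<^sub>R fbar x))\<^sup>2 = X - 2 * \<eta> * (fbar x \<bullet> x) + \<eta>\<^sup>2 * Y"
    unfolding X_def Y_def power2_norm_eq_inner by (simp add: inner_diff inner_commute power2_eq_square)
  moreover have "\<eta> * (c2 * X - c1) \<le> \<eta> * (fbar x \<bullet> x)"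
    using dissipative[of x] \<eta> by (intro mult_left_mono) (auto simp: X_def fbar_def)
  ultimately have 4: "(norm (x - \<eta> *\<^sub>R fbar x))\<^sup>2 \<le> X - 2 * (\<eta> * c2) * X + 2 * \<eta> * c1 + \<eta>\<^sup>2 * Y"
    by (simp add: algebra_simps)
  have fb: "Y \<le> 2 * M\<^sup>2 * X + 2 * (norm (fbar 0))\<^sup>2" using fbar_sq by (simp add: X_def Y_def)
  have "(1 / real CARD('n)) * (\<Sum>s\<in>UNIV. (1 + \<theta>) * (norm (x - \<eta> *\<^sub>R fbar x - \<eta> *\<^sub>R e s))\<^sup>2
    + (1 + 1 / (2 * real CARD('n))) * ((1 / real CARD('n)) * (\<Sum>i\<in>UNIV. if i = s then 0 else (norm (D i))\<^sup>2))
    + L * \<eta>\<^sup>2 * (norm (- fbar x - 1 *\<^sub>R e s))\<^sup>2)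
    = (1 + \<theta>) * ((1 / real CARD('n)) * (\<Sum>s\<in>UNIV. (norm (x - \<eta> *\<^sub>R fbar x - \<eta> *\<^sub>R e s))\<^sup>2))
    + (1 + 1 / (2 * real CARD('n))) * ((1 / real CARD('n)) * (\<Sum>s\<in>UNIV. (1 / real CARD('n)) * (\<Sum>i\<in>UNIV. if i = s then 0 else (norm (D i))\<^sup>2)))
    + L * \<eta>\<^sup>2 * ((1 / real CARD('n)) * (\<Sum>s\<in>UNIV. (norm (- fbar x - 1 *\<^sub>R e s))\<^sup>2))"
    unfolding sum.distrib sum_distrib_left[symmetric] by (simp only: distrib_left mult_ac)
  also have "\<dots> = (1 + \<theta>) * ((norm (x - \<eta> *\<^sub>R fbar x))\<^sup>2 + \<eta>\<^sup>2 * vr)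
    + (1 + 1 / (2 * real CARD('n))) * ((1 - 1 / real CARD('n)) * mD) + L * \<eta>\<^sup>2 * (Y + vr)"
    unfolding 1 2 3 ..
  also have "\<dots> \<le> (1 - \<eta> * c2) * X + (1 - 1 / (4 * real CARD('n))) * mD + (4 * \<eta> * c1 + (2 + L) * \<eta>\<^sup>2 * (2 * (norm (fbar 0))\<^sup>2))"
  proof -
    have "(1 + \<theta>) * ((norm (x - \<eta> *\<^sub>R fbar x))\<^sup>2 + \<eta>\<^sup>2 * vr)
        \<le> (1 + \<theta>) * (X - 2 * (\<eta> * c2) * X + 2 * \<eta> * c1 + \<eta>\<^sup>2 * Y + \<eta>\<^sup>2 * mD)"
      using 4 vr \<theta> by (intro mult_left_mono add_mono) (auto intro!: mult_left_mono)
    also have "\<dots> = (1 + \<theta>) * (X - 2 * (\<eta> * c2) * X) + (1 + \<theta>) * (2 * \<eta> * c1 + \<eta>\<^sup>2 * (Y + mD))"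
      by (simp add: algebra_simps)
    also have "\<dots> \<le> (1 - 3 / 2 * (\<eta> * c2)) * X + 2 * (2 * \<eta> * c1 + \<eta>\<^sup>2 * (Y + mD))"
    proof (rule add_mono)
      have "0 \<le> \<theta> * (2 * (\<eta> * c2) * X)" using \<theta> \<eta> c nonneg by simp
      then show "(1 + \<theta>) * (X - 2 * (\<eta> * c2) * X) \<le> (1 - 3 / 2 * (\<eta> * c2)) * X"
        unfolding \<theta>_def by (simp add: algebra_simps)
      show "(1 + \<theta>) * (2 * \<eta> * c1 + \<eta>\<^sup>2 * (Y + mD)) \<le> 2 * (2 * \<eta> * c1 + \<eta>\<^sup>2 * (Y + mD))"
        using \<theta> \<eta> c nonneg by (intro mult_right_mono) auto
    qed
    finally have a: "(1 + \<theta>) * ((norm (x - \<eta> *\<^sub>R fbar x))\<^sup>2 + \<eta>\<^sup>2 * vr)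
        \<le> (1 - 3 / 2 * (\<eta> * c2)) * X + 2 * (2 * \<eta> * c1 + \<eta>\<^sup>2 * (Y + mD))" .
    have "(1 + 1 / (2 * real CARD('n))) * (1 - 1 / real CARD('n)) \<le> 1 - 1 / (2 * real CARD('n))"
      using N1 by (simp add: field_simps)
    from mult_right_mono[OF this nonneg(3)]
    have b: "(1 + 1 / (2 * real CARD('n))) * ((1 - 1 / real CARD('n)) * mD) \<le> (1 - 1 / (2 * real CARD('n))) * mD" by (simp only: mult.assoc)
    have c': "L * \<eta>\<^sup>2 * (Y + vr) \<le> L * \<eta>\<^sup>2 * (Y + mD)"
      using vr L by (intro mult_left_mono) auto
    have d: "(2 + L) * \<eta>\<^sup>2 * Y \<le> \<eta> * c2 / 2 * X + (2 + L) * \<eta>\<^sup>2 * (2 * (norm (fbar 0))\<^sup>2)"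
    proof -
      have "(2 + L) * \<eta>\<^sup>2 * Y \<le> (2 + L) * \<eta>\<^sup>2 * (2 * M\<^sup>2 * X + 2 * (norm (fbar 0))\<^sup>2)"
        using fb L by (intro mult_left_mono) auto
      also have "\<dots> = ((2 + L) * (\<eta> * (2 * M\<^sup>2))) * (\<eta> * X) + (2 + L) * \<eta>\<^sup>2 * (2 * (norm (fbar 0))\<^sup>2)"
        by (simp add: power2_eq_square algebra_simps)
      also have "((2 + L) * (\<eta> * (2 * M\<^sup>2))) * (\<eta> * X) \<le> c2 / 2 * (\<eta> * X)"
        using small(1) \<eta> nonneg unfolding L_def by (intro mult_right_mono) auto
      finally show ?thesis by (simp add: mult_ac)
    qed
    have f: "(2 + L) * \<eta>\<^sup>2 * mD \<le> 1 / (4 * real CARD('n)) * mD"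
      using small(2) nonneg unfolding L_def by (intro mult_right_mono) auto
    have half: "1 / (2 * real CARD('n)) = 2 * (1 / (4 * real CARD('n)))" by simp
    show ?thesis
      using a b c' d f unfolding half by (simp add: algebra_simps)
  qed
  also have "(1 - \<eta> * c2) * X + (1 - 1 / (4 * real CARD('n))) * mD \<le> lam * X + lam * mD"
    using nonneg by (intro add_mono mult_right_mono) (auto simp: lam_def)
  also have "lam * X + lam * mD = lam * W (x, g)"
    by (simp add: W_def X_def mD_def D_def distrib_left)
  finally show ?thesis unfolding \<theta>_def by simp
qed

definition b :: real where
  "b = 4 * \<eta> * c1 + (2 + 2 * (1 + 2 * real CARD('n)) * M\<^sup>2) * \<eta>\<^sup>2 * (2 * (norm (fbar 0))\<^sup>2)
    + ((1 + 2 / (\<eta> * c2)) * (2 * \<eta>) + 2 * (1 + 2 * real CARD('n)) * M\<^sup>2 * (2 * \<eta>)) * (\<integral>w. (norm w)\<^sup>2 \<partial>(gauss :: (real^'d) measure))"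

lemma drift:
  defines "lam \<equiv> max (1 - \<eta> * c2) (1 - 1 / (4 * real CARD('n)))"
  shows "(\<integral>\<^sup>+z. ennreal (W (saga_step F \<eta> u z)) \<partial>noise) \<le> ennreal (lam * W u + b)"
proof -
  obtain x g where u: "u = (x, g)" by (cases u)
  define D where "D i = g $ i - F i x" for i
  define e where "e s = (1 / real CARD('n)) *\<^sub>R (\<Sum>i\<in>UNIV. D i) - D s" for s
  define A where "A s = (1 + \<eta> * c2 / 2) * (norm (x - \<eta> *\<^sub>R fbar x - \<eta> *\<^sub>R e s))\<^sup>2
    + (1 + 1 / (2 * real CARD('n))) * ((1 / real CARD('n)) * (\<Sum>i\<in>UNIV. if i = s then 0 else (norm (D i))\<^sup>2))
    + 2 * (1 + 2 * real CARD('n)) * M\<^sup>2 * \<eta>\<^sup>2 * (norm (- fbar x - 1 *\<^sub>R e s))\<^sup>2" for s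
  define K where "K = (1 + 2 / (\<eta> * c2)) * (2 * \<eta>) + 2 * (1 + 2 * real CARD('n)) * M\<^sup>2 * (2 * \<eta>)"
  have K: "K \<ge> 0" using \<eta> c by (auto simp: K_def)
  have A0: "A s \<ge> 0" for s using \<eta> c by (auto simp: A_def intro!: add_nonneg_nonneg mult_nonneg_nonneg divide_nonneg_nonneg sum_nonneg)
  have le: "W (saga_step F \<eta> u (w, s)) \<le> A s + K * (norm w)\<^sup>2" for w s
    using W_step_pointwise[of x g w s] unfolding u A_def K_def e_def D_def .
  have meas: "(\<lambda>z. ennreal (W (saga_step F \<eta> u z))) \<in> borel_measurable noise"
  proof -
    have "(\<lambda>z. saga_step F \<eta> u z) \<in> measurable noise borel"
      using measurable_compose[OF measurable_Pair1' saga_step_measurable, of u] by simp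
    then show ?thesis by measurable
  qed
  have "(\<integral>\<^sup>+z. ennreal (W (saga_step F \<eta> u z)) \<partial>noise)
      = (\<Sum>s\<in>UNIV. ennreal (1 / real CARD('n)) * (\<integral>\<^sup>+w. ennreal (W (saga_step F \<eta> u (w, s))) \<partial>gauss))"
    by (rule nn_integral_noise[OF meas])
  also have "\<dots> \<le> (\<Sum>s\<in>UNIV. ennreal (1 / real CARD('n)) * (\<integral>\<^sup>+w. ennreal (A s + K * (norm w)\<^sup>2) \<partial>(gauss :: (real^'d) measure)))"
    by (intro sum_mono mult_left_mono nn_integral_mono ennreal_leI le) auto
  also have "\<dots> = (\<Sum>s\<in>UNIV. ennreal ((1 / real CARD('n)) * (A s + K * (\<integral>w. (norm w)\<^sup>2 \<partial>(gauss :: (real^'d) measure)))))"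
  proof (rule sum.cong[OF refl])
    fix s
    have "(\<integral>\<^sup>+w. ennreal (A s + K * (norm w)\<^sup>2) \<partial>(gauss :: (real^'d) measure)) = ennreal (A s + K * (\<integral>w. (norm w)\<^sup>2 \<partial>(gauss :: (real^'d) measure)))"
      using gauss_second_moment A0[of s] K
      by (subst nn_integral_eq_integral) (auto simp: gauss.prob_space[simplified])
    then show "ennreal (1 / real CARD('n)) * (\<integral>\<^sup>+w. ennreal (A s + K * (norm w)\<^sup>2) \<partial>(gauss :: (real^'d) measure))
      = ennreal ((1 / real CARD('n)) * (A s + K * (\<integral>w. (norm w)\<^sup>2 \<partial>(gauss :: (real^'d) measure))))"
      by (simp add: ennreal_mult'[symmetric])
  qed
  also have "\<dots> = ennreal (\<Sum>s\<in>UNIV. (1 / real CARD('n)) * (A s + K * (\<integral>w. (norm w)\<^sup>2 \<partial>(gauss :: (real^'d) measure))))"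
    using A0 K by (intro sum_ennreal) (auto intro!: mult_nonneg_nonneg add_nonneg_nonneg)
  also have "(\<Sum>s\<in>UNIV. (1 / real CARD('n)) * (A s + K * (\<integral>w. (norm w)\<^sup>2 \<partial>(gauss :: (real^'d) measure))))
      = (1 / real CARD('n)) * (\<Sum>s\<in>UNIV. A s) + K * (\<integral>w. (norm w)\<^sup>2 \<partial>(gauss :: (real^'d) measure))"
    using N1 by (simp add: sum_divide_distrib sum.distrib distrib_left)
  also have "\<dots> \<le> lam * W u + b"
    using mean_step[of x g] unfolding u b_def A_def e_def D_def K_def lam_def by simp
  finally show ?thesis by (simp add: ennreal_leI)
qed

lemma lam:
  defines "lam \<equiv> max (1 - \<eta> * c2) (1 - 1 / (4 * real CARD('n)))"
  shows "0 \<le> lam" "lam < 1"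
proof -
  have "1 / (4 * real CARD('n)) \<le> 1" using N1 by (subst pos_divide_le_eq; linarith)
  then show "0 \<le> lam" by (simp add: lam_def le_max_iff_disj)
  show "lam < 1" using \<eta> c by (simp add: lam_def)
qed

lemma b_nonneg: "0 \<le> b"
  using \<eta> c unfolding b_def by (intro add_nonneg_nonneg mult_nonneg_nonneg) auto

end

sublocale saga \<subseteq> rs: random_system noise "saga_step F \<eta>" W "max (1 - \<eta> * c2) (1 - 1 / (4 * real CARD('n)))" b
proof (intro random_system.intro random_system_axioms.intro)
  show "prob_space noise" by (rule prob_space_noise)
qed (fact saga_step_measurable W_measurable W_nonneg lam b_nonneg drift)+

subsection \<open>Minorization\<close>

context saga
begin

definition refresh :: "'n \<Rightarrow> (real^'d) \<times> (real^'d^'n) \<Rightarrow> real^'d^'n" where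
  "refresh s u = (\<chi> i. if s = i then F i (fst u) else snd u $ i)"

text \<open>
  One step with choice \<open>s\<close>, bounded below up to a constant: the new position is drawn from
  (unnormalized) Lebesgue measure on the unit ball.
\<close>

definition ball_step :: "'n \<Rightarrow> ((real^'d) \<times> (real^'d^'n) \<Rightarrow> ennreal) \<Rightarrow> (real^'d) \<times> (real^'d^'n) \<Rightarrow> ennreal" where
  "ball_step s h u = (\<integral>\<^sup>+y. h (y, refresh s u) * indicator (cball 0 1) y \<partial>lborel)"

text \<open>Boxes are easier to follow through a refresh than sublevel sets of \<open>W\<close>,
  which involve \<open>F\<close> at the new position.\<close>

definition in_box :: "real \<Rightarrow> (real^'d) \<times> (real^'d^'n) \<Rightarrow> bool" where
  "in_box R u \<longleftrightarrow> norm (fst u) \<le> R \<and> (\<forall>i. norm (snd u $ i) \<le> R)"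

lemma ball_step_measurable:
  assumes [measurable]: "h \<in> borel_measurable borel"
  shows "ball_step s h \<in> borel_measurable borel"
proof -
  have [measurable]: "cball (0::real^'d) 1 \<in> sets borel" by simp
  have "(\<lambda>p. (snd p, refresh s (fst p))) \<in> measurable (((borel :: (real^'d) measure) \<Otimes>\<^sub>M (borel :: (real^'d^'n) measure)) \<Otimes>\<^sub>M (borel :: (real^'d) measure)) (borel \<Otimes>\<^sub>M borel)"
    unfolding refresh_def by measurable
  then have [measurable]: "(\<lambda>p. (snd p, refresh s (fst p))) \<in> measurable (borel \<Otimes>\<^sub>M (lborel :: (real^'d) measure)) borel"
    by (subst measurable_cong_sets[OF sets_pair_measure_cong[OF refl sets_lborel] refl]) (simp add: borel_prod)
  have "(\<lambda>p. h (snd p, refresh s (fst p)) * indicator (cball 0 1) (snd p)) \<in> borel_measurable (borel \<Otimes>\<^sub>M lborel)"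
    by measurable
  from lborel.borel_measurable_nn_integral_fst[OF this] show ?thesis
    unfolding ball_step_def by simp
qed

lemma saga_step_eq:
  "saga_step F \<eta> u (w, s) = (fst u - (\<eta> / real CARD('n)) *\<^sub>R (\<Sum>i\<in>UNIV. snd u $ i) - \<eta> *\<^sub>R (F s (fst u) - snd u $ s) + sqrt (2 * \<eta>) *\<^sub>R w, refresh s u)"
  by (simp add: saga_step_def refresh_def case_prod_beta)

lemma F_le: "norm (F i x) \<le> norm (F i 0) + M * norm x"
  using lipschitz[of i x 0] norm_triangle_ineq2[of "F i x" "F i 0"] by simp

definition F0 :: real where "F0 = (\<Sum>i\<in>UNIV. norm (F i 0))"

lemma F_le': "norm (F i x) \<le> F0 + M * norm x"
proof -
  have "norm (F i 0) \<le> F0" unfolding F0_def by (rule member_le_sum) auto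
  with F_le[of i x] show ?thesis by linarith
qed

lemma F0_nonneg: "0 \<le> F0" by (simp add: F0_def sum_nonneg)

text \<open>All choices but \<open>s\<close> are dropped from the average, at the price 1 / N, and
  the Gaussian is bounded below by Lebesgue measure on the unit ball. The box bounds the centre of
  the Gaussian, so one constant serves all its points and all choices.\<close>

lemma Tnn_ge_ball_step:
  "\<exists>c>0. \<forall>u s. in_box R u \<longrightarrow> (\<forall>h\<in>borel_measurable borel. ennreal c * ball_step s h u \<le> rs.Tnn h u)"
proof -
  \<comment> \<open>Bounds the deterministic part of the new position on the box term by term:
    position, table mean, correction by the chosen entry.\<close>
  define r where "r = R + (\<eta> / real CARD('n)) * (real CARD('n) * R) + \<eta> * (F0 + M * R + R)"
  obtain c' where c': "c' > 0" and low: "\<And>t f. norm (t::real^'d) \<le> r \<Longrightarrow> f \<in> borel_measurable borel \<Longrightarrow>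
      ennreal c' * (\<integral>\<^sup>+y. f y * indicator (cball 0 1) y \<partial>lborel) \<le> (\<integral>\<^sup>+w. f (t + sqrt (2 * \<eta>) *\<^sub>R w) \<partial>gauss)"
    using gauss_lower_bound[of "sqrt (2 * \<eta>)" r, where 'd='d] \<eta> by auto
  have "ennreal (c' / real CARD('n)) * ball_step s h u \<le> rs.Tnn h u"
    if u: "in_box R u" and h [measurable]: "h \<in> borel_measurable borel" for u s h
  proof -
    define t where "t = fst u - (\<eta> / real CARD('n)) *\<^sub>R (\<Sum>i\<in>UNIV. snd u $ i) - \<eta> *\<^sub>R (F s (fst u) - snd u $ s)"
    have R: "norm (fst u) \<le> R" "norm (snd u $ i) \<le> R" for i using u by (auto simp: in_box_def)
    have "norm t \<le> norm (fst u) + norm ((\<eta> / real CARD('n)) *\<^sub>R (\<Sum>i\<in>UNIV. snd u $ i)) + norm (\<eta> *\<^sub>R (F s (fst u) - snd u $ s))"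
      unfolding t_def by (intro order_trans[OF norm_triangle_ineq4] add_mono order_refl)
    also have "\<dots> \<le> r"
      unfolding r_def
    proof (intro add_mono)
      have "norm (\<Sum>i\<in>UNIV. snd u $ i) \<le> (\<Sum>i\<in>(UNIV::'n set). R)"
        by (intro order_trans[OF norm_sum] sum_mono R)
      then show "norm ((\<eta> / real CARD('n)) *\<^sub>R (\<Sum>i\<in>UNIV. snd u $ i)) \<le> (\<eta> / real CARD('n)) * (real CARD('n) * R)"
      proof -
        assume le: "norm (\<Sum>i\<in>UNIV. snd u $ i) \<le> (\<Sum>i\<in>(UNIV::'n set). R)"
        have "norm ((\<eta> / real CARD('n)) *\<^sub>R (\<Sum>i\<in>UNIV. snd u $ i)) = (\<eta> / real CARD('n)) * norm (\<Sum>i\<in>UNIV. snd u $ i)"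
          using \<eta> by simp
        also have "\<dots> \<le> (\<eta> / real CARD('n)) * (\<Sum>i\<in>(UNIV::'n set). R)"
          using \<eta> by (intro mult_left_mono le) auto
        finally show ?thesis by simp
      qed
      have "norm (F s (fst u) - snd u $ s) \<le> norm (F s (fst u)) + norm (snd u $ s)"
        by (rule norm_triangle_ineq4)
      also have "\<dots> \<le> F0 + M * R + R"
        using F_le'[of s "fst u"] R(1) R(2)[of s] M mult_left_mono[OF R(1), of M] by linarith
      finally show "norm (\<eta> *\<^sub>R (F s (fst u) - snd u $ s)) \<le> \<eta> * (F0 + M * R + R)"
        using \<eta> by (simp add: mult_left_mono)
    qed (rule R)
    finally have t: "norm t \<le> r" .
    have Pm: "(\<lambda>y. (y, refresh s u)) \<in> measurable borel (borel :: ((real^'d) \<times> (real^'d^'n)) measure)"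
      unfolding borel_prod[symmetric] by measurable
    have meas: "(\<lambda>z. h (saga_step F \<eta> u z)) \<in> borel_measurable noise"
      using measurable_compose[OF measurable_compose[OF measurable_Pair1' saga_step_measurable] h, of u] by simp
    have "ennreal (1 / real CARD('n)) * (ennreal c' * ball_step s h u)
        \<le> ennreal (1 / real CARD('n)) * (\<integral>\<^sup>+w. h (saga_step F \<eta> u (w, s)) \<partial>gauss)"
      unfolding ball_step_def saga_step_eq t_def[symmetric]
      by (intro mult_left_mono low[OF t] measurable_compose[OF Pm h]) auto
    also have "\<dots> \<le> (\<Sum>s\<in>UNIV. ennreal (1 / real CARD('n)) * (\<integral>\<^sup>+w. h (saga_step F \<eta> u (w, s)) \<partial>gauss))"
      by (rule member_le_sum) auto
    also have "\<dots> = rs.Tnn h u"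
      unfolding rs.Tnn_def by (rule nn_integral_noise[OF meas, symmetric])
    finally show ?thesis
      using c' by (simp add: mult.assoc[symmetric] ennreal_mult'[symmetric])
  qed
  moreover have "c' / real CARD('n) > 0" using c' by simp
  ultimately show ?thesis by blast
qed

text \<open>The new position lies in the unit ball, the replaced entry is at most F0 + M R and the
  others at most R; the sum \<open>1 + F0 + M * R + R\<close> dominates all three. So
  \<open>f\<close> and \<open>g\<close> have to be compared on that larger box only.\<close>

lemma ball_step_mono:
  assumes "in_box R u" "\<And>v. in_box (1 + F0 + M * R + R) v \<Longrightarrow> f v \<le> g v"
  shows "ball_step s f u \<le> ball_step s g u"
  unfolding ball_step_def
proof (rule nn_integral_mono)
  fix y :: "real^'d"
  show "f (y, refresh s u) * indicator (cball 0 1) y \<le> g (y, refresh s u) * indicator (cball 0 1) y"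
  proof (cases "y \<in> cball 0 1")
    case True
    have R: "norm (fst u) \<le> R" "norm (snd u $ i) \<le> R" for i using assms(1) by (auto simp: in_box_def)
    have "0 \<le> R" using R(1) norm_ge_zero order_trans by blast
    have MR: "0 \<le> M * R" using M \<open>0 \<le> R\<close> by simp
    have "norm (F i (fst u)) \<le> 1 + F0 + M * R + R" for i
      using F_le'[of i "fst u"] mult_left_mono[OF R(1), of M] M \<open>0 \<le> R\<close> by linarith
    moreover have "norm (snd u $ i) \<le> 1 + F0 + M * R + R" for i
      using R(2)[of i] MR F0_nonneg by linarith
    moreover have "norm y \<le> 1 + F0 + M * R + R"
      using True MR F0_nonneg \<open>0 \<le> R\<close> by simp
    ultimately have "in_box (1 + F0 + M * R + R) (y, refresh s u)"
      by (auto simp: in_box_def refresh_def)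
    then show ?thesis by (intro mult_right_mono assms(2)) auto
  qed simp
qed

section \<open>Iterated ball steps\<close>

lemma Tnn_measurable:
  assumes [measurable]: "h \<in> borel_measurable borel"
  shows "rs.Tnn h \<in> borel_measurable borel"
proof -
  have "(\<lambda>p. h (case_prod (saga_step F \<eta>) p)) \<in> borel_measurable (borel \<Otimes>\<^sub>M noise)"
    by (rule measurable_compose[OF saga_step_measurable assms])
  from rs.zeta.borel_measurable_nn_integral_fst[OF this] show ?thesis
    unfolding rs.Tnn_def by simp
qed

lemma funpow_Tnn_measurable: "h \<in> borel_measurable borel \<Longrightarrow> (rs.Tnn ^^ n) h \<in> borel_measurable borel"
  by (induction n) (auto intro: Tnn_measurable)

lemma ball_steps_measurable: "h \<in> borel_measurable borel \<Longrightarrow> foldr ball_step l h \<in> borel_measurable borel"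
  by (induction l) (auto intro: ball_step_measurable)

lemma ball_step_cmult:
  assumes "h \<in> borel_measurable borel"
  shows "ball_step s (\<lambda>v. c * h v) u = c * ball_step s h u"
proof -
  have Pm: "(\<lambda>y. (y, refresh s u)) \<in> measurable borel (borel :: ((real^'d) \<times> (real^'d^'n)) measure)"
    unfolding borel_prod[symmetric] by measurable
  have [measurable]: "(\<lambda>y. h (y, refresh s u)) \<in> borel_measurable borel" "cball (0::real^'d) 1 \<in> sets borel"
    using measurable_compose[OF Pm assms] by auto
  show ?thesis
    unfolding ball_step_def mult.assoc by (rule nn_integral_cmult) measurable
qed

lemma ball_step_add:
  assumes "f \<in> borel_measurable borel" "g \<in> borel_measurable borel"
  shows "ball_step s (\<lambda>v. f v + g v) u = ball_step s f u + ball_step s g u"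
proof -
  have Pm: "(\<lambda>y. (y, refresh s u)) \<in> measurable borel (borel :: ((real^'d) \<times> (real^'d^'n)) measure)"
    unfolding borel_prod[symmetric] by measurable
  have [measurable]: "(\<lambda>y. f (y, refresh s u)) \<in> borel_measurable borel" "(\<lambda>y. g (y, refresh s u)) \<in> borel_measurable borel"
      "cball (0::real^'d) 1 \<in> sets borel"
    using measurable_compose[OF Pm assms(1)] measurable_compose[OF Pm assms(2)] by auto
  show ?thesis
    unfolding ball_step_def distrib_right by (rule nn_integral_add) measurable
qed

lemma ball_steps_add:
  assumes "f \<in> borel_measurable borel" "g \<in> borel_measurable borel"
  shows "foldr ball_step l (\<lambda>v. f v + g v) = (\<lambda>u. foldr ball_step l f u + foldr ball_step l g u)"
proof (induction l)
  case (Cons s l)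
  have "ball_step s (\<lambda>u. foldr ball_step l f u + foldr ball_step l g u)
      = (\<lambda>u. ball_step s (foldr ball_step l f) u + ball_step s (foldr ball_step l g) u)"
    by (rule ext) (intro ball_step_add ball_steps_measurable assms)
  then show ?case by (simp add: Cons.IH)
qed simp

lemma ball_steps_ge_one:
  assumes "\<And>v. 1 \<le> h v"
  shows "emeasure lborel (cball (0::real^'d) 1) ^ length l \<le> foldr ball_step l h u"
proof (induction l arbitrary: u)
  case Nil then show ?case using assms by simp
next
  case (Cons s l)
  let ?c = "emeasure lborel (cball (0::real^'d) 1) ^ length l"
  have "emeasure lborel (cball (0::real^'d) 1) ^ length (s # l) = (\<integral>\<^sup>+y. ?c * indicator (cball (0::real^'d) 1) y \<partial>lborel)"
    by (subst nn_integral_cmult_indicator) (auto simp: mult.commute)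
  also have "\<dots> \<le> foldr ball_step (s # l) h u"
    unfolding foldr.simps comp_def ball_step_def
    by (intro nn_integral_mono mult_right_mono) (use Cons.IH in \<open>auto simp: ball_step_def[abs_def]\<close>)
  finally show ?case .
qed

text \<open>The radius is generalized in the induction because the box grows with each step; the
  constants of the single steps multiply.\<close>

lemma Tnns_ge_ball_steps:
  "\<exists>c>0. \<forall>u. in_box R u \<longrightarrow> (\<forall>h\<in>borel_measurable borel. ennreal c * foldr ball_step l h u \<le> (rs.Tnn ^^ length l) h u)"
proof (induction l arbitrary: R)
  case Nil then show ?case by (intro exI[of _ 1]) auto
next
  case (Cons s l)
  obtain c1 where c1: "c1 > 0" "\<And>u h. in_box R u \<Longrightarrow> h \<in> borel_measurable borel \<Longrightarrow> ennreal c1 * ball_step s h u \<le> rs.Tnn h u"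
    using Tnn_ge_ball_step[of R] by blast
  obtain c2 where c2: "c2 > 0" "\<And>u h. in_box (1 + F0 + M * R + R) u \<Longrightarrow> h \<in> borel_measurable borel \<Longrightarrow>
      ennreal c2 * foldr ball_step l h u \<le> (rs.Tnn ^^ length l) h u"
    using Cons.IH[of "1 + F0 + M * R + R"] by blast
  have "ennreal (c1 * c2) * foldr ball_step (s # l) h u \<le> (rs.Tnn ^^ length (s # l)) h u"
    if u: "in_box R u" and h: "h \<in> borel_measurable borel" for u h
  proof -
    have "ennreal (c1 * c2) * foldr ball_step (s # l) h u = ennreal c1 * ball_step s (\<lambda>v. ennreal c2 * foldr ball_step l h v) u"
      using c1 c2 by (simp add: ball_step_cmult ball_steps_measurable[OF h] ennreal_mult mult.assoc)
    also have "\<dots> \<le> ennreal c1 * ball_step s ((rs.Tnn ^^ length l) h) u"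
      by (intro mult_left_mono ball_step_mono[OF u] c2 h) auto
    also have "\<dots> \<le> rs.Tnn ((rs.Tnn ^^ length l) h) u"
      by (intro c1 u funpow_Tnn_measurable h)
    finally show ?thesis by simp
  qed
  with c1 c2 show ?case by (intro exI[of _ "c1 * c2"]) auto
qed

text \<open>Once every index has been chosen, no trace of the initial gradient table is left.\<close>

lemma ball_steps_forget:
  assumes "\<And>i. i \<notin> set l \<Longrightarrow> g $ i = g' $ i"
  shows "foldr ball_step l h (x, g) = foldr ball_step l h (x, g')"
  using assms
proof (induction l arbitrary: x g g')
  case Nil
  then have "g = g'" by (simp add: vec_eq_iff)
  then show ?case by simp
next
  case (Cons s l)
  have "foldr ball_step l h (y, refresh s (x, g)) = foldr ball_step l h (y, refresh s (x, g'))" for y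
    using Cons.prems by (intro Cons.IH) (auto simp: refresh_def)
  then show ?case by (simp add: ball_step_def[of s "foldr ball_step l h"])
qed

text \<open>The lower bound by ball steps does not depend on the starting point. The bounds for
  \<open>f\<close> from \<open>u\<close> and for \<open>g\<close> from \<open>v\<close> can
  therefore be added as if both chains started in the same point, and f + g >= 1 leaves the total
  mass of the N + 1 ball steps.\<close>

lemma overlap:
  "\<exists>\<alpha>>0. \<forall>u v f g. W u \<le> R \<longrightarrow> W v \<le> R \<longrightarrow> f \<in> borel_measurable borel \<longrightarrow>
      g \<in> borel_measurable borel \<longrightarrow> (\<forall>x. 1 \<le> f x + g x) \<longrightarrow>
      ennreal \<alpha> \<le> (rs.Tnn ^^ Suc CARD('n)) f u + (rs.Tnn ^^ Suc CARD('n)) g v"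
proof -
  obtain l0 where l0: "set l0 = (UNIV :: 'n set)" "distinct l0" using finite_distinct_list[of "UNIV :: 'n set"] by auto
  \<comment> \<open>The head of \<open>l0\<close> is chosen twice. The extra step in front still
    writes \<open>F\<close> of the starting position into its entry, but draws a position that
    ignores the start; the pass through \<open>l0\<close> then overwrites every entry, this one
    included.\<close>
  define l where "l = hd l0 # l0"
  have len: "length l = Suc CARD('n)" using l0 distinct_card[of l0] by (simp add: l_def)
  \<comment> \<open>In a sublevel set the position is at most \<open>sqrt R\<close> and each
    deviation at most \<open>sqrt (real CARD('n) * R)\<close>, since \<open>W\<close> contains the
    deviations with weight 1 / N; the remaining terms bound \<open>F\<close> at such a
    position.\<close>
  define r where "r = sqrt R + sqrt (real CARD('n) * R) + F0 + M * sqrt R"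
  have box: "in_box r u" if "W u \<le> R" for u
  proof -
    have R: "0 \<le> R" using W_nonneg[of u] that by linarith
    have "0 \<le> (1 / real CARD('n)) * (\<Sum>i\<in>UNIV. (norm (snd u $ i - F i (fst u)))\<^sup>2)" by (simp add: sum_nonneg)
    then have "(norm (fst u))\<^sup>2 \<le> R" using that unfolding W_def by linarith
    then have x: "norm (fst u) \<le> sqrt R" by (rule real_le_rsqrt)
    have "norm (snd u $ i) \<le> r" for i
    proof -
      have "(1 / real CARD('n)) * (\<Sum>i\<in>UNIV. (norm (snd u $ i - F i (fst u)))\<^sup>2) \<le> R"
        using that unfolding W_def by (smt (verit) zero_le_power2)
      then have "(\<Sum>i\<in>UNIV. (norm (snd u $ i - F i (fst u)))\<^sup>2) \<le> real CARD('n) * R"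
        using N1 by (simp add: field_simps)
      moreover have "(norm (snd u $ i - F i (fst u)))\<^sup>2 \<le> (\<Sum>i\<in>UNIV. (norm (snd u $ i - F i (fst u)))\<^sup>2)"
        by (rule member_le_sum) auto
      ultimately have "norm (snd u $ i - F i (fst u)) \<le> sqrt (real CARD('n) * R)" by (intro real_le_rsqrt) simp
      moreover have "norm (snd u $ i) \<le> norm (snd u $ i - F i (fst u)) + norm (F i (fst u))"
        using norm_triangle_ineq[of "snd u $ i - F i (fst u)" "F i (fst u)"] by simp
      moreover have "norm (F i (fst u)) \<le> F0 + M * sqrt R"
        using F_le'[of i "fst u"] mult_left_mono[OF x, of M] M by linarith
      moreover have "0 \<le> sqrt R" using R by simp
      ultimately show ?thesis unfolding r_def by linarith
    qed
    moreover have "norm (fst u) \<le> r"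
    proof -
      have "0 \<le> M * sqrt R" "0 \<le> sqrt (real CARD('n) * R)" using M R by auto
      then show ?thesis using x F0_nonneg unfolding r_def by linarith
    qed
    ultimately show ?thesis by (simp add: in_box_def)
  qed
  obtain c where c0: "c > 0" and low: "\<And>u h. in_box r u \<Longrightarrow> h \<in> borel_measurable borel \<Longrightarrow>
      ennreal c * foldr ball_step l h u \<le> (rs.Tnn ^^ Suc CARD('n)) h u"
    using Tnns_ge_ball_steps[of r l] unfolding len by blast
  define vol where "vol = measure lborel (cball (0::real^'d) 1)"
  have vol: "vol > 0" unfolding vol_def by (simp add: content_cball_pos)
  have evol: "emeasure lborel (cball (0::real^'d) 1) = ennreal vol"
    unfolding vol_def by (rule emeasure_eq_ennreal_measure) (use emeasure_bounded_finite[of "cball (0::real^'d) 1"] in \<open>auto simp: less_top\<close>)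
  have forget: "foldr ball_step l h u = foldr ball_step l h v" for h u v
  proof -
    have "foldr ball_step l0 h (y, refresh (hd l0) u) = foldr ball_step l0 h (y, refresh (hd l0) v)" for y
      by (rule ball_steps_forget) (simp add: l0)
    then show ?thesis by (simp add: l_def ball_step_def[of "hd l0" "foldr ball_step l0 h"])
  qed
  have "ennreal (c * vol ^ Suc CARD('n)) \<le> (rs.Tnn ^^ Suc CARD('n)) f u + (rs.Tnn ^^ Suc CARD('n)) g v"
    if u: "W u \<le> R" and v: "W v \<le> R" and f: "f \<in> borel_measurable borel" and g: "g \<in> borel_measurable borel"
      and fg: "\<forall>x. 1 \<le> f x + g x" for u v f g
  proof -
    have "ennreal (c * vol ^ Suc CARD('n)) = ennreal c * emeasure lborel (cball (0::real^'d) 1) ^ length l"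
      using c0 vol by (simp only: evol len ennreal_power ennreal_mult'[of c] less_imp_le)
    also have "\<dots> \<le> ennreal c * foldr ball_step l (\<lambda>x. f x + g x) u"
      using fg by (intro mult_left_mono ball_steps_ge_one) auto
    also have "\<dots> = ennreal c * foldr ball_step l f u + ennreal c * foldr ball_step l g v"
      unfolding ball_steps_add[OF f g] by (simp add: distrib_left forget[of g u v])
    also have "\<dots> \<le> (rs.Tnn ^^ Suc CARD('n)) f u + (rs.Tnn ^^ Suc CARD('n)) g v"
      by (intro add_mono low box u v f g)
    finally show ?thesis .
  qed
  moreover have "c * vol ^ Suc CARD('n) > 0" using c0 vol by simp
  ultimately show ?thesis by blast
qed

text \<open>Translates linear growth in the norm into the weight 1 + V; the table is recovered from
  its deviations and the linear growth of \<open>F\<close>.\<close>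

lemma norm_le_W: "\<exists>K. \<forall>u. 1 + norm u \<le> K * (1 + sqrt (W u))"
proof -
  define q where "q = sqrt (real CARD('n))"
  define K where "K = 2 + real CARD('n) * (q + F0 + M) + F0"
  have q0: "0 \<le> q" by (simp add: q_def)
  have "1 + norm u \<le> K * (1 + sqrt (W u))" for u
  proof -
    define V where "V = sqrt (W u)"
    have V: "0 \<le> V" using W_nonneg by (simp add: V_def)
    have "0 \<le> (1 / real CARD('n)) * (\<Sum>i\<in>UNIV. (norm (snd u $ i - F i (fst u)))\<^sup>2)" by (simp add: sum_nonneg)
    then have "(norm (fst u))\<^sup>2 \<le> W u" unfolding W_def by linarith
    then have x: "norm (fst u) \<le> V" unfolding V_def by (rule real_le_rsqrt)
    have g: "norm (snd u $ i) \<le> (q + F0 + M) * (1 + V)" for i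
    proof -
      have "(1 / real CARD('n)) * (\<Sum>i\<in>UNIV. (norm (snd u $ i - F i (fst u)))\<^sup>2) \<le> W u"
        unfolding W_def by simp
      then have "(\<Sum>i\<in>UNIV. (norm (snd u $ i - F i (fst u)))\<^sup>2) \<le> real CARD('n) * W u"
        using N1 by (simp add: field_simps)
      moreover have "(norm (snd u $ i - F i (fst u)))\<^sup>2 \<le> (\<Sum>i\<in>UNIV. (norm (snd u $ i - F i (fst u)))\<^sup>2)"
        by (rule member_le_sum) auto
      ultimately have "norm (snd u $ i - F i (fst u)) \<le> sqrt (real CARD('n) * W u)" by (intro real_le_rsqrt) simp
      also have "\<dots> = q * V" by (simp add: q_def V_def real_sqrt_mult)
      finally have "norm (snd u $ i - F i (fst u)) \<le> q * V" .
      moreover have "norm (snd u $ i) \<le> norm (snd u $ i - F i (fst u)) + norm (F i (fst u))"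
        using norm_triangle_ineq[of "snd u $ i - F i (fst u)" "F i (fst u)"] by simp
      moreover have "norm (F i (fst u)) \<le> F0 + M * V"
        using F_le'[of i "fst u"] mult_left_mono[OF x, of M] M by linarith
      moreover have "q * V + F0 + M * V \<le> (q + F0 + M) * (1 + V)"
      proof -
        have "0 \<le> F0 * V" "0 \<le> q" "0 \<le> M" using F0_nonneg V q0 M by auto
        then show ?thesis by (simp add: algebra_simps)
      qed
      ultimately show ?thesis by linarith
    qed
    define G where "G = real CARD('n) * (q + F0 + M) * (1 + V)"
    have "norm (snd u) \<le> (\<Sum>i\<in>UNIV. norm (snd u $ i))"
      unfolding norm_vec_def by (rule L2_set_le_sum) auto
    also have "\<dots> \<le> (\<Sum>i\<in>(UNIV::'n set). (q + F0 + M) * (1 + V))" by (intro sum_mono g)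
    also have "\<dots> = G" by (simp add: G_def)
    finally have nu: "norm u \<le> V + G"
      using x norm_Pair_le[of "fst u" "snd u"] by simp
    define H where "H = F0 * (1 + V)"
    have H: "0 \<le> H" using F0_nonneg V by (simp add: H_def)
    have "1 + norm u \<le> 1 + (V + G)" by (rule add_left_mono[OF nu])
    also have "\<dots> \<le> 2 * (1 + V) + G + H" using V H by simp
    also have "\<dots> = K * (1 + V)" by (simp add: K_def G_def H_def algebra_simps)
    finally show ?thesis by (simp only: V_def)
  qed
  then show ?thesis by blast
qed

end

text \<open>Centred sums with second moment of order n have first absolute moment of order sqrt n,
  and division by n leaves sqrt (K / n). Markov's inequality gives the convergence in
  probability.\<close>

lemma (in prob_space) average_converges:
  fixes X :: "nat \<Rightarrow> 'a \<Rightarrow> real"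
  assumes [measurable]: "\<And>k. X k \<in> borel_measurable M"
    and int: "\<And>n. integrable M (\<lambda>\<omega>. (\<Sum>k=1..n. X k \<omega> - c)\<^sup>2)"
    and bound: "\<And>n. expectation (\<lambda>\<omega>. (\<Sum>k=1..n. X k \<omega> - c)\<^sup>2) \<le> K * real n"
  shows "(\<lambda>n. \<integral>\<^sup>+\<omega>. ennreal \<bar>(\<Sum>k=1..n. X k \<omega>) / real n - c\<bar> \<partial>M) \<longlonglongrightarrow> 0"
    and "0 < \<epsilon> \<Longrightarrow> (\<lambda>n. prob {\<omega>\<in>space M. \<bar>(\<Sum>k=1..n. X k \<omega>) / real n - c\<bar> > \<epsilon>}) \<longlonglongrightarrow> 0"
proof -
  define A where "A n \<omega> = \<bar>(\<Sum>k=1..n. X k \<omega>) / real n - c\<bar>" for n \<omega>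
  have [measurable]: "A n \<in> borel_measurable M" for n unfolding A_def by measurable
  have A_eq: "A n \<omega> = \<bar>\<Sum>k=1..n. X k \<omega> - c\<bar> / real n" if "n \<ge> 1" for n \<omega>
  proof -
    have "(\<Sum>k=1..n. X k \<omega>) / real n - c = (\<Sum>k=1..n. X k \<omega> - c) / real n"
      using that by (simp add: sum_subtractf field_simps)
    then show ?thesis by (simp add: A_def)
  qed
  have A_int: "integrable M (A n)" and A_le: "expectation (A n) \<le> sqrt K / sqrt (real n)" if n: "n \<ge> 1" for n
  proof -
    have eq: "A n = (\<lambda>\<omega>. \<bar>\<Sum>k=1..n. X k \<omega> - c\<bar> / real n)" using A_eq[OF n] by auto
    have i2: "integrable M (\<lambda>\<omega>. \<bar>\<Sum>k=1..n. X k \<omega> - c\<bar>\<^sup>2)" using int[of n] by simp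
    have i1: "integrable M (\<lambda>\<omega>. \<bar>\<Sum>k=1..n. X k \<omega> - c\<bar>)"
      by (rule expectation_le_sqrt(1)[OF i2]) measurable
    then show "integrable M (A n)" unfolding eq by simp
    have "expectation (\<lambda>\<omega>. \<bar>\<Sum>k=1..n. X k \<omega> - c\<bar>) \<le> sqrt (expectation (\<lambda>\<omega>. \<bar>\<Sum>k=1..n. X k \<omega> - c\<bar>\<^sup>2))"
      by (rule expectation_le_sqrt(2)[OF i2]) measurable
    also have "\<dots> \<le> sqrt (K * real n)" using bound[of n] by simp
    finally have "expectation (A n) \<le> sqrt (K * real n) / real n"
      unfolding eq by (simp add: divide_right_mono)
    also have "\<dots> = sqrt K / sqrt (real n)"
      using n by (simp add: real_sqrt_mult real_div_sqrt field_simps)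
    finally show "expectation (A n) \<le> sqrt K / sqrt (real n)" .
  qed
  have lim: "(\<lambda>n. sqrt K / sqrt (real n)) \<longlonglongrightarrow> 0"
    by (intro real_tendsto_divide_at_top[OF tendsto_const] filterlim_compose[OF sqrt_at_top filterlim_real_sequentially])
  have limE: "(\<lambda>n. expectation (A n)) \<longlonglongrightarrow> 0"
  proof (rule tendsto_sandwich[OF _ _ tendsto_const lim])
    show "\<forall>\<^sub>F n in sequentially. 0 \<le> expectation (A n)"
      by (auto intro!: always_eventually integral_nonneg_AE simp: A_def)
    show "\<forall>\<^sub>F n in sequentially. expectation (A n) \<le> sqrt K / sqrt (real n)"
      using eventually_ge_at_top[of 1] by eventually_elim (rule A_le)
  qed
  have "(\<lambda>n. \<integral>\<^sup>+\<omega>. ennreal (A n \<omega>) \<partial>M) \<longlonglongrightarrow> 0"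
  proof (rule Lim_transform_eventually)
    show "(\<lambda>n. ennreal (expectation (A n))) \<longlonglongrightarrow> 0" using tendsto_ennrealI[OF limE] by simp
    show "\<forall>\<^sub>F n in sequentially. ennreal (expectation (A n)) = (\<integral>\<^sup>+\<omega>. ennreal (A n \<omega>) \<partial>M)"
      using eventually_ge_at_top[of 1]
      by eventually_elim (subst nn_integral_eq_integral, auto intro!: A_int simp: A_def)
  qed
  then show "(\<lambda>n. \<integral>\<^sup>+\<omega>. ennreal \<bar>(\<Sum>k=1..n. X k \<omega>) / real n - c\<bar> \<partial>M) \<longlonglongrightarrow> 0"
    by (simp add: A_def)
  assume e: "0 < \<epsilon>"
  have "(\<lambda>n. prob {\<omega>\<in>space M. A n \<omega> > \<epsilon>}) \<longlonglongrightarrow> 0"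
  proof (rule tendsto_sandwich[OF _ _ tendsto_const])
    show "(\<lambda>n. expectation (A n) / \<epsilon>) \<longlonglongrightarrow> 0" using tendsto_divide_zero[OF limE, of \<epsilon>] by simp
    show "\<forall>\<^sub>F n in sequentially. prob {\<omega>\<in>space M. A n \<omega> > \<epsilon>} \<le> expectation (A n) / \<epsilon>"
      using eventually_ge_at_top[of 1]
    proof eventually_elim
      case (elim n)
      have "prob {\<omega>\<in>space M. A n \<omega> > \<epsilon>} \<le> prob {\<omega>\<in>space M. A n \<omega> \<ge> \<epsilon>}"
        by (intro finite_measure_mono) auto
      also have "\<dots> \<le> expectation (A n) / \<epsilon>"
        using e by (intro integral_Markov_inequality_measure[where A="{}"] A_int[OF elim]) (auto simp: A_def)
      finally show ?case .
    qed
  qed auto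
  then show "(\<lambda>n. prob {\<omega>\<in>space M. \<bar>(\<Sum>k=1..n. X k \<omega>) / real n - c\<bar> > \<epsilon>}) \<longlonglongrightarrow> 0"
    by (simp add: A_def)
qed

subsection \<open>Independence\<close>

text \<open>
  The library notion \<open>indep_vars\<close> needs one type of values for the whole family, so the initial
  position, the Gaussian variables and the choices are all embedded in \<open>(real^'d) \<times> 'n\<close>; the other
  component is constant.
\<close>

definition source_var :: "('w \<Rightarrow> real^'d) \<Rightarrow> (nat \<Rightarrow> 'w \<Rightarrow> real^'d) \<Rightarrow> (nat \<Rightarrow> 'w \<Rightarrow> 'n) \<Rightarrow> nat + nat \<Rightarrow> 'w \<Rightarrow> (real^'d) \<times> 'n" where
  "source_var X0 \<xi> S i \<omega> = (case i of Inl k \<Rightarrow> (if k = 0 then X0 \<omega> else \<xi> k \<omega>, undefined) | Inr k \<Rightarrow> (0, S k \<omega>))"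

text \<open>Independence across the sources concerns whole sequences, independence within a source
  its single members. The product formula for the merged family uses both: first across the blocks
  \<open>e1\<close>, \<open>e2\<close>, \<open>e3\<close>, then inside the Gaussian block and the
  block of choices.\<close>

lemma (in prob_space) indep_vars_source_var:
  fixes X0 :: "'a \<Rightarrow> real^'d::finite" and \<xi> :: "nat \<Rightarrow> 'a \<Rightarrow> real^'d" and S :: "nat \<Rightarrow> 'a \<Rightarrow> 'n::finite"
  assumes X0 [measurable]: "X0 \<in> borel_measurable M"
    and \<xi>: "indep_vars (\<lambda>_. borel) \<xi> UNIV" and S: "indep_vars (\<lambda>_. count_space UNIV) S UNIV"
    and indep: "independent_sources M X0 \<xi> S"
  shows "indep_vars (\<lambda>_. borel \<Otimes>\<^sub>M count_space UNIV) (source_var X0 \<xi> S) UNIV"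
proof -
  let ?V = "source_var X0 \<xi> S" and ?M = "(borel :: (real^'d) measure) \<Otimes>\<^sub>M count_space (UNIV :: 'n set)"
  have [measurable]: "\<xi> k \<in> borel_measurable M" "S k \<in> measurable M (count_space UNIV)" for k
    using \<xi> S by (auto simp: indep_vars_def)
  have V [measurable]: "?V i \<in> measurable M ?M" for i
    unfolding source_var_def by (cases i) simp_all
  have spM: "space ?M = UNIV" by (simp add: space_pair_measure)
  have "indep_sets (\<lambda>i. {?V i -` A \<inter> space M |A. A \<in> sets ?M}) UNIV"
  proof (rule indep_setsI)
    show "{?V i -` A \<inter> space M |A. A \<in> sets ?M} \<subseteq> events" for i
      using V[of i] by (auto simp: measurable_sets)
    fix A J assume J: "J \<noteq> {}" "finite J" and A: "\<forall>j\<in>J. A j \<in> {?V j -` A \<inter> space M |A. A \<in> sets ?M}"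
    then obtain B where B: "\<And>j. j \<in> J \<Longrightarrow> B j \<in> sets ?M" "\<And>j. j \<in> J \<Longrightarrow> A j = ?V j -` B j \<inter> space M"
      by (simp add: Bex_def) (metis (mono_tags, lifting))
    \<comment> \<open>Indices outside \<open>J\<close> receive the whole space; their events are
      sure, so \<open>J\<close> can be enlarged without changing either side of the product
      formula.\<close>
    define B' where "B' j = (if j \<in> J then B j else UNIV)" for j
    have B' [measurable]: "B' j \<in> sets ?M" for j
      using B(1)[of j] sets.top[of ?M] by (auto simp: B'_def spM)
    define C where "C k = (\<lambda>x. (x, undefined)) -` B' (Inl k)" for k
    define D where "D k = (\<lambda>s. (0, s)) -` B' (Inr k)" for k
    have C [measurable]: "C k \<in> sets borel" for k
    proof -
      have "(\<lambda>x. (x, undefined)) \<in> measurable borel ?M" by measurable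
      from measurable_sets[OF this B'] show ?thesis by (simp add: C_def)
    qed
    define E where "E i = ?V i -` B' i \<inter> space M" for i
    have Einl: "E (Inl k) = (if k = 0 then X0 else \<xi> k) -` C k \<inter> space M" for k
      by (auto simp: E_def C_def source_var_def)
    have Einr: "E (Inr k) = S k -` D k \<inter> space M" for k
      by (auto simp: E_def D_def source_var_def)
    have "finite (case_sum id id ` J)" using J by simp
    then obtain m where m: "\<And>j. j \<in> J \<Longrightarrow> case_sum id id j \<le> (m::nat)"
      by (auto simp: finite_nat_set_iff_bounded_le)
    \<comment> \<open>A set of indices that splits along the three sources. The bound
      \<open>Suc m\<close> instead of \<open>m\<close> keeps \<open>{1..Suc m}\<close> nonempty, as
      the product formula for the Gaussian block requires.\<close>
    define T where "T = (Inl ` {..Suc m} \<union> Inr ` {..Suc m} :: (nat + nat) set)"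
    have JT: "J \<subseteq> T"
    proof
      fix j assume "j \<in> J"
      from m[OF this] show "j \<in> T" by (cases j) (auto simp: T_def)
    qed
    have fT: "finite T" by (simp add: T_def)
    have out: "E j = space M" if "j \<notin> J" for j using that by (simp add: E_def B'_def)
    have inJ: "A j = E j" if "j \<in> J" for j using that B(2) by (simp add: E_def B'_def)
    have E_sub: "E j \<subseteq> space M" for j by (simp add: E_def)
    have "(\<Inter>j\<in>J. A j) = (\<Inter>j\<in>T. E j)"
      using inJ out E_sub J JT by (auto simp: subset_iff) (metis subsetD E_sub out)
    define e1 where "e1 = X0 -` C 0 \<inter> space M"
    \<comment> \<open>The Gaussian block starts at 1 because the slot \<open>Inl 0\<close> holds the
      initial position.\<close>
    define e2 where "e2 = (\<Inter>k\<in>{1..Suc m}. \<xi> k -` C k \<inter> space M)"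
    define e3 where "e3 = (\<Inter>k\<in>{..Suc m}. S k -` D k \<inter> space M)"
    have "(\<Inter>j\<in>T. E j) = e1 \<inter> e2 \<inter> e3"
    proof -
      have "{..Suc m} = insert 0 {1..Suc m}" by auto
      then have "(\<Inter>j\<in>T. E j) = E (Inl 0) \<inter> (\<Inter>k\<in>{1..Suc m}. E (Inl k)) \<inter> (\<Inter>k\<in>{..Suc m}. E (Inr k))"
        unfolding T_def by auto
      then show ?thesis unfolding Einl Einr e1_def e2_def e3_def by simp
    qed
    moreover have "prob (e1 \<inter> e2 \<inter> e3) = prob e1 * prob e2 * prob e3"
    proof -
      have U: "(UNIV :: source set) = {Initial, Noise, Choice}" using source.exhaust by auto
      have m2: "{f. \<forall>k\<in>{1..Suc m}. f k \<in> C k} \<in> sets (Pi\<^sub>M UNIV (\<lambda>_::nat. (borel :: (real^'d) measure)))"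
      proof -
        have "{f. \<forall>k\<in>{1..Suc m}. f k \<in> C k} = (\<Inter>k\<in>{1..Suc m}. (\<lambda>f. f k) -` C k \<inter> space (Pi\<^sub>M UNIV (\<lambda>_::nat. (borel :: (real^'d) measure))))"
          by (auto simp: space_PiM)
        also have "\<dots> \<in> sets (Pi\<^sub>M UNIV (\<lambda>_::nat. (borel :: (real^'d) measure)))"
          by (intro sets.finite_INT measurable_sets[OF measurable_component_singleton]) auto
        finally show ?thesis .
      qed
      have m3: "{f. \<forall>k\<in>{..Suc m}. f k \<in> D k} \<in> sets (Pi\<^sub>M UNIV (\<lambda>_::nat. count_space (UNIV :: 'n set)))"
      proof -
        have "{f. \<forall>k\<in>{..Suc m}. f k \<in> D k} = (\<Inter>k\<in>{..Suc m}. (\<lambda>f. f k) -` D k \<inter> space (Pi\<^sub>M UNIV (\<lambda>_::nat. count_space (UNIV :: 'n set))))"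
          by (auto simp: space_PiM)
        also have "\<dots> \<in> sets (Pi\<^sub>M UNIV (\<lambda>_::nat. count_space (UNIV :: 'n set)))"
          by (intro sets.finite_INT measurable_sets[OF measurable_component_singleton]) auto
        finally show ?thesis .
      qed
      have e2: "e2 = (\<lambda>\<omega> n. \<xi> n \<omega>) -` {f. \<forall>k\<in>{1..Suc m}. f k \<in> C k} \<inter> space M"
        and e3: "e3 = (\<lambda>\<omega> n. S n \<omega>) -` {f. \<forall>k\<in>{..Suc m}. f k \<in> D k} \<inter> space M"
        by (auto simp: e2_def e3_def)
      have "prob (\<Inter>j\<in>UNIV. case_source e1 e2 e3 j) = (\<Prod>j\<in>UNIV. prob (case_source e1 e2 e3 j))"
      proof (rule indep_setsD[OF indep[unfolded independent_sources_def]])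
        show "\<forall>j\<in>UNIV. case_source e1 e2 e3 j \<in> (case j of
            Initial \<Rightarrow> {X0 -` A \<inter> space M |A. A \<in> sets borel}
          | Noise \<Rightarrow> {(\<lambda>\<omega> n. \<xi> n \<omega>) -` A \<inter> space M |A. A \<in> sets (Pi\<^sub>M UNIV (\<lambda>_. borel))}
          | Choice \<Rightarrow> {(\<lambda>\<omega> n. S n \<omega>) -` A \<inter> space M |A. A \<in> sets (Pi\<^sub>M UNIV (\<lambda>_. count_space UNIV))})"
        proof
          fix j
          have M1: "e1 \<in> {X0 -` A \<inter> space M |A. A \<in> sets borel}"
            unfolding e1_def using C[of 0] by blast
          have M2: "e2 \<in> {(\<lambda>\<omega> n. \<xi> n \<omega>) -` A \<inter> space M |A. A \<in> sets (Pi\<^sub>M UNIV (\<lambda>_. borel))}"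
            unfolding e2 using m2 by blast
          have M3: "e3 \<in> {(\<lambda>\<omega> n. S n \<omega>) -` A \<inter> space M |A. A \<in> sets (Pi\<^sub>M UNIV (\<lambda>_. count_space UNIV))}"
            unfolding e3 using m3 by blast
          show "case_source e1 e2 e3 j \<in> (case j of
              Initial \<Rightarrow> {X0 -` A \<inter> space M |A. A \<in> sets borel}
            | Noise \<Rightarrow> {(\<lambda>\<omega> n. \<xi> n \<omega>) -` A \<inter> space M |A. A \<in> sets (Pi\<^sub>M UNIV (\<lambda>_. borel))}
            | Choice \<Rightarrow> {(\<lambda>\<omega> n. S n \<omega>) -` A \<inter> space M |A. A \<in> sets (Pi\<^sub>M UNIV (\<lambda>_. count_space UNIV))})"
            by (cases j) (simp_all only: source.case M1 M2 M3)
        qed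
      qed (auto simp: U)
      then show ?thesis unfolding U by (simp add: Int_assoc mult.assoc)
    qed
    moreover have "prob e2 = (\<Prod>k\<in>{1..Suc m}. prob (E (Inl k)))"
    proof -
      have "prob e2 = (\<Prod>k\<in>{1..Suc m}. prob (\<xi> k -` C k \<inter> space M))"
        unfolding e2_def by (rule indep_varsD[OF \<xi>]) auto
      then show ?thesis by (simp add: Einl)
    qed
    moreover have "prob e3 = (\<Prod>k\<in>{..Suc m}. prob (E (Inr k)))"
    proof -
      have "prob e3 = (\<Prod>k\<in>{..Suc m}. prob (S k -` D k \<inter> space M))"
        unfolding e3_def by (rule indep_varsD[OF S]) auto
      then show ?thesis by (simp add: Einr)
    qed
    moreover have "(\<Prod>j\<in>T. prob (E j)) = prob (E (Inl 0)) * (\<Prod>k\<in>{1..Suc m}. prob (E (Inl k))) * (\<Prod>k\<in>{..Suc m}. prob (E (Inr k)))"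
    proof -
      have *: "{..Suc m} = insert 0 {1..Suc m}" by auto
      have "(\<Prod>j\<in>T. prob (E j)) = (\<Prod>k\<in>{..Suc m}. prob (E (Inl k))) * (\<Prod>k\<in>{..Suc m}. prob (E (Inr k)))"
        unfolding T_def by (subst prod.union_disjoint) (auto simp: prod.reindex)
      also have "(\<Prod>k\<in>{..Suc m}. prob (E (Inl k))) = prob (E (Inl 0)) * (\<Prod>k\<in>{1..Suc m}. prob (E (Inl k)))"
        unfolding * by (subst prod.insert) auto
      finally show ?thesis .
    qed
    moreover have "(\<Prod>j\<in>J. prob (A j)) = (\<Prod>j\<in>T. prob (E j))"
      using JT fT inJ out by (intro prod.mono_neutral_cong_left) (auto simp: prob_space)
    moreover have "e1 = E (Inl 0)" by (simp add: e1_def Einl)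
    ultimately show "prob (\<Inter>j\<in>J. A j) = (\<Prod>j\<in>J. prob (A j))"
      using \<open>(\<Inter>j\<in>J. A j) = (\<Inter>j\<in>T. E j)\<close> by simp
  qed
  with V show ?thesis by (simp add: indep_vars_def2)
qed

lemma law_of_choice_noise:
  fixes P :: "'w measure" and X :: "'w \<Rightarrow> real^'d::finite" and T :: "'w \<Rightarrow> 'n::finite"
  assumes P: "prob_space P"
    and \<xi>: "distr P borel X = gauss" "X \<in> borel_measurable P"
    and S: "distr P (count_space UNIV) T = uniform_count_measure UNIV" "T \<in> measurable P (count_space UNIV)"
    and indep: "\<And>A B. A \<in> sets borel \<Longrightarrow> measure P (X -` A \<inter> space P \<inter> (T -` B \<inter> space P)) = measure P (X -` A \<inter> space P) * measure P (T -` B \<inter> space P)"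
  shows "distr P noise (\<lambda>\<omega>. (X \<omega>, T \<omega>)) = (noise :: ((real^'d) \<times> 'n) measure)"
proof -
  interpret prob_space P by fact
  note [measurable] = \<xi>(2) S(2)
  have meas: "(\<lambda>\<omega>. (X \<omega>, T \<omega>)) \<in> measurable P noise"
    unfolding measurable_cong_sets[OF refl sets_noise] by measurable
  interpret u: prob_space "uniform_count_measure (UNIV :: 'n set)" by (rule prob_space_uniform)
  have "gauss \<Otimes>\<^sub>M uniform_count_measure UNIV = distr P noise (\<lambda>\<omega>. (X \<omega>, T \<omega>))"
  proof (rule pair_measure_eqI)
    show "sigma_finite_measure (gauss :: (real^'d) measure)" "sigma_finite_measure (uniform_count_measure (UNIV :: 'n set))" ..
    show "sets (gauss \<Otimes>\<^sub>M uniform_count_measure UNIV) = sets (distr P noise (\<lambda>\<omega>. (X \<omega>, T \<omega>)))"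
      by (simp add: noise_def)
    fix A :: "(real^'d) set" and B :: "'n set"
    assume "A \<in> sets gauss" "B \<in> sets (uniform_count_measure UNIV)"
    then have A [measurable]: "A \<in> sets borel" by simp
    have AB: "A \<times> B \<in> sets noise" unfolding sets_noise by measurable
    have "emeasure gauss A = emeasure P (X -` A \<inter> space P)"
      unfolding \<xi>(1)[symmetric] by (rule emeasure_distr) measurable
    moreover have "emeasure (uniform_count_measure UNIV) B = emeasure P (T -` B \<inter> space P)"
      unfolding S(1)[symmetric] by (rule emeasure_distr) measurable
    moreover have "emeasure (distr P noise (\<lambda>\<omega>. (X \<omega>, T \<omega>))) (A \<times> B) = emeasure P (X -` A \<inter> space P \<inter> (T -` B \<inter> space P))"
      by (subst emeasure_distr[OF meas AB]) (auto intro!: arg_cong[where f="emeasure P"])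
    ultimately show "emeasure gauss A * emeasure (uniform_count_measure UNIV) B = emeasure (distr P noise (\<lambda>\<omega>. (X \<omega>, T \<omega>))) (A \<times> B)"
      using indep[OF A, of B] by (simp add: emeasure_eq_measure ennreal_mult)
  qed
  then show ?thesis by (simp add: noise_def)
qed

section \<open>The chain as a function of its sources\<close>

lemma measurable_PiM_fst_snd:
  assumes "i \<in> K"
  shows "(\<lambda>v. fst (v i)) \<in> measurable (Pi\<^sub>M K (\<lambda>_. A \<Otimes>\<^sub>M B)) A"
    and "(\<lambda>v. snd (v i)) \<in> measurable (Pi\<^sub>M K (\<lambda>_. A \<Otimes>\<^sub>M B)) B"
proof -
  have *: "(\<lambda>v. v i) \<in> measurable (Pi\<^sub>M K (\<lambda>_. A \<Otimes>\<^sub>M B)) (A \<Otimes>\<^sub>M B)"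
    using assms by (rule measurable_component_singleton)
  show "(\<lambda>v. fst (v i)) \<in> measurable (Pi\<^sub>M K (\<lambda>_. A \<Otimes>\<^sub>M B)) A"
    by (rule measurable_compose[OF * measurable_fst])
  show "(\<lambda>v. snd (v i)) \<in> measurable (Pi\<^sub>M K (\<lambda>_. A \<Otimes>\<^sub>M B)) B"
    by (rule measurable_compose[OF * measurable_snd])
qed

context saga
begin

text \<open>A deterministic function of all source values. Through \<open>traj_restrict\<close> it
  shows which finitely many coordinates a state reads, so that independence can be taken from
  disjoint sets of coordinates.\<close>

primrec traj :: "nat \<Rightarrow> (nat + nat \<Rightarrow> (real^'d) \<times> 'n) \<Rightarrow> (real^'d) \<times> (real^'d^'n)" where
  "traj 0 v = (fst (v (Inl 0)), \<chi> i. F i (fst (v (Inl 0))))"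
| "traj (Suc n) v = saga_step F \<eta> (traj n v) (fst (v (Inl (Suc n))), snd (v (Inr n)))"

lemma saga_ld_eq_traj: "saga_ld F \<eta> X0 \<xi> S n \<omega> = traj n (\<lambda>i. source_var X0 \<xi> S i \<omega>)"
proof (induction n)
  case 0 then show ?case by (simp add: source_var_def)
next
  case (Suc n) then show ?case unfolding saga_ld_Suc by (simp add: source_var_def)
qed

lemma traj_restrict:
  assumes "Inl ` {..n} \<union> Inr ` {..<n} \<subseteq> K"
  shows "traj n (restrict v K) = traj n v"
  using assms
proof (induction n)
  case 0 then show ?case by (auto simp: restrict_def)
next
  case (Suc n)
  then have "Inl ` {..n} \<union> Inr ` {..<n} \<subseteq> K" "Inl (Suc n) \<in> K" "Inr n \<in> K" by auto
  with Suc.IH show ?case by simp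
qed

lemma traj_measurable:
  assumes "Inl ` {..n} \<union> Inr ` {..<n} \<subseteq> K"
  shows "traj n \<in> measurable (Pi\<^sub>M K (\<lambda>_. borel \<Otimes>\<^sub>M count_space UNIV)) borel"
  using assms
proof (induction n)
  case 0
  then have [measurable]: "(\<lambda>v. fst (v (Inl 0))) \<in> borel_measurable (Pi\<^sub>M K (\<lambda>_. (borel :: (real^'d) measure) \<Otimes>\<^sub>M count_space (UNIV :: 'n set)))"
    by (intro measurable_PiM_fst_snd) auto
  have "(\<lambda>v. (fst (v (Inl 0)), \<chi> i. F i (fst (v (Inl 0))))) \<in> measurable (Pi\<^sub>M K (\<lambda>_. (borel :: (real^'d) measure) \<Otimes>\<^sub>M count_space (UNIV :: 'n set))) (borel \<Otimes>\<^sub>M borel)"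
    by measurable
  then show ?case unfolding borel_prod traj.simps[abs_def] .
next
  case (Suc n)
  then have K: "Inl (Suc n) \<in> K" "Inr n \<in> K" by auto
  have [measurable]: "traj n \<in> measurable (Pi\<^sub>M K (\<lambda>_. borel \<Otimes>\<^sub>M count_space UNIV)) borel"
    using Suc.prems by (intro Suc.IH) auto
  have "(\<lambda>v. (fst (v (Inl (Suc n))), snd (v (Inr n)))) \<in> measurable (Pi\<^sub>M K (\<lambda>_. (borel :: (real^'d) measure) \<Otimes>\<^sub>M count_space (UNIV :: 'n set))) noise"
    unfolding measurable_cong_sets[OF refl sets_noise] by (intro measurable_Pair measurable_PiM_fst_snd K)
  with Suc show ?case unfolding traj.simps(2)[abs_def] by (intro rs.Phi_measurable') auto
qed

lemma harris_chain_saga_ld: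
  fixes P :: "'w measure" and X0 :: "'w \<Rightarrow> real^'d" and \<xi> :: "nat \<Rightarrow> 'w \<Rightarrow> real^'d" and S :: "nat \<Rightarrow> 'w \<Rightarrow> 'n"
  assumes P: "prob_space P" and X0 [measurable]: "X0 \<in> borel_measurable P"
    and \<xi>: "prob_space.indep_vars P (\<lambda>_. borel) \<xi> UNIV" "\<And>n. std_gaussian P (\<xi> n)"
    and S: "prob_space.indep_vars P (\<lambda>_. count_space UNIV) S UNIV" "\<And>n. uniformly_distributed P (S n)"
    and indep: "independent_sources P X0 \<xi> S"
    and X0_sq: "integrable P (\<lambda>\<omega>. (norm (X0 \<omega>))\<^sup>2)"
  shows "harris_chain P noise (saga_step F \<eta>) W (max (1 - \<eta> * c2) (1 - 1 / (4 * real CARD('n)))) b (Suc CARD('n))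
    (saga_ld F \<eta> X0 \<xi> S) (\<lambda>n \<omega>. (\<xi> (Suc n) \<omega>, S n \<omega>))"
proof -
  interpret prob_space P by fact
  let ?V = "source_var X0 \<xi> S" and ?M = "(borel :: (real^'d) measure) \<Otimes>\<^sub>M count_space (UNIV :: 'n set)"
  have V: "indep_vars (\<lambda>_. ?M) ?V UNIV"
    by (rule indep_vars_source_var[OF X0 \<xi>(1) S(1) indep])
  have \<xi>m [measurable]: "\<xi> k \<in> borel_measurable P" and Sm [measurable]: "S k \<in> measurable P (count_space UNIV)" for k
    using \<xi>(1) S(1) by (auto simp: indep_vars_def)
  have Zm: "(\<lambda>\<omega>. (\<xi> (Suc n) \<omega>, S n \<omega>)) \<in> measurable P noise" for n
    unfolding measurable_cong_sets[OF refl sets_noise] by measurable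
  have Um: "saga_ld F \<eta> X0 \<xi> S n \<in> borel_measurable P" for n
  proof (induction n)
    case 0
    have "(\<lambda>\<omega>. (X0 \<omega>, \<chi> i. F i (X0 \<omega>))) \<in> measurable P (borel \<Otimes>\<^sub>M borel)" by measurable
    then show ?case by (simp add: borel_prod)
  next
    case (Suc n)
    have "(\<lambda>\<omega>. saga_step F \<eta> (saga_ld F \<eta> X0 \<xi> S n \<omega>) (\<xi> (Suc n) \<omega>, S n \<omega>)) \<in> borel_measurable P"
      by (rule rs.Phi_measurable'[OF Suc.IH Zm])
    then show ?case by (subst measurable_cong[OF saga_ld_Suc])
  qed
  have Z_law: "distr P noise (\<lambda>\<omega>. (\<xi> (Suc n) \<omega>, S n \<omega>)) = noise" for n
  proof (rule law_of_choice_noise[OF P])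
    show "distr P borel (\<xi> (Suc n)) = gauss"
    proof -
      have "distr P borel (\<xi> (Suc n)) = distr P lborel (\<xi> (Suc n))" by (rule distr_cong) simp_all
      also have "\<dots> = gauss"
        unfolding gauss_def by (rule distributed_distr_eq_density[OF \<xi>(2)[unfolded std_gaussian_def]])
      finally show ?thesis .
    qed
    show "distr P (count_space UNIV) (S n) = uniform_count_measure UNIV"
      using S(2)[of n] by (simp add: uniformly_distributed_def)
    fix A :: "(real^'d) set" and B :: "'n set" assume A [measurable]: "A \<in> sets borel"
    \<comment> \<open>Each set leaves the dummy component free, so independence of the embedded
      variables becomes independence of the original ones.\<close>
    let ?E = "case_sum (\<lambda>_. A \<times> UNIV) (\<lambda>_. UNIV \<times> B) :: nat + nat \<Rightarrow> _"
    have "prob (\<Inter>i\<in>{Inl (Suc n), Inr n}. ?V i -` ?E i \<inter> space P) = (\<Prod>i\<in>{Inl (Suc n), Inr n}. prob (?V i -` ?E i \<inter> space P))"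
      by (rule indep_varsD[OF V]) auto
    moreover have "?V (Inl (Suc n)) -` ?E (Inl (Suc n)) \<inter> space P = \<xi> (Suc n) -` A \<inter> space P"
      "?V (Inr n) -` ?E (Inr n) \<inter> space P = S n -` B \<inter> space P"
      by (auto simp: source_var_def)
    ultimately show "prob (\<xi> (Suc n) -` A \<inter> space P \<inter> (S n -` B \<inter> space P)) = prob (\<xi> (Suc n) -` A \<inter> space P) * prob (S n -` B \<inter> space P)"
      by simp
  qed measurable
  have joint: "distr P ((borel \<Otimes>\<^sub>M borel) \<Otimes>\<^sub>M noise) (\<lambda>\<omega>. ((saga_ld F \<eta> X0 \<xi> S j \<omega>, saga_ld F \<eta> X0 \<xi> S n \<omega>), (\<xi> (Suc n) \<omega>, S n \<omega>)))
      = distr P (borel \<Otimes>\<^sub>M borel) (\<lambda>\<omega>. (saga_ld F \<eta> X0 \<xi> S j \<omega>, saga_ld F \<eta> X0 \<xi> S n \<omega>)) \<Otimes>\<^sub>M noise" if jn: "j \<le> n" for j n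
  proof -
    \<comment> \<open>Up to time \<open>n\<close> the chain reads Gaussian slots up to
      \<open>n\<close> and choices below \<open>n\<close>; the next step reads slot
      \<open>Suc n\<close> and choice \<open>n\<close>. So the two sets are disjoint, and the first
      one also covers the earlier time \<open>j\<close>.\<close>
    define K1 where "K1 = (Inl ` {..n} \<union> Inr ` {..<n} :: (nat + nat) set)"
    define K2 where "K2 = ({Inl (Suc n), Inr n} :: (nat + nat) set)"
    let ?R = "\<lambda>K \<omega>. restrict (\<lambda>i. ?V i \<omega>) K"
    let ?M1 = "Pi\<^sub>M K1 (\<lambda>_. ?M)" and ?M2 = "Pi\<^sub>M K2 (\<lambda>_. ?M)"
    have "indep_var ?M1 (?R K1) ?M2 (?R K2)"
      by (rule indep_var_restrict[OF V]) (auto simp: K1_def K2_def)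
    then have R1 [measurable]: "?R K1 \<in> measurable P ?M1" and R2 [measurable]: "?R K2 \<in> measurable P ?M2"
      and eq: "distr P ?M1 (?R K1) \<Otimes>\<^sub>M distr P ?M2 (?R K2) = distr P (?M1 \<Otimes>\<^sub>M ?M2) (\<lambda>\<omega>. (?R K1 \<omega>, ?R K2 \<omega>))"
      unfolding indep_var_distribution_eq by auto
    define f where "f v = (traj j v, traj n v)" for v
    define g where "g v = (fst (v (Inl (Suc n))), snd (v (Inr n)))" for v :: "nat + nat \<Rightarrow> (real^'d) \<times> 'n"
    have f [measurable]: "f \<in> measurable ?M1 (borel \<Otimes>\<^sub>M borel)"
      unfolding f_def using jn by (intro measurable_Pair traj_measurable) (auto simp: K1_def)
    have g [measurable]: "g \<in> measurable ?M2 noise"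
      unfolding g_def measurable_cong_sets[OF refl sets_noise]
      by (intro measurable_Pair measurable_PiM_fst_snd) (auto simp: K2_def)
    have fR: "f (?R K1 \<omega>) = (saga_ld F \<eta> X0 \<xi> S j \<omega>, saga_ld F \<eta> X0 \<xi> S n \<omega>)" for \<omega>
      using jn unfolding f_def saga_ld_eq_traj by (subst (1 2) traj_restrict) (auto simp: K1_def)
    have gR: "g (?R K2 \<omega>) = (\<xi> (Suc n) \<omega>, S n \<omega>)" for \<omega>
      by (simp add: g_def K2_def source_var_def)
    have d1: "distr (distr P ?M1 (?R K1)) (borel \<Otimes>\<^sub>M borel) f = distr P (borel \<Otimes>\<^sub>M borel) (\<lambda>\<omega>. (saga_ld F \<eta> X0 \<xi> S j \<omega>, saga_ld F \<eta> X0 \<xi> S n \<omega>))"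
      by (subst distr_distr[OF f R1]) (simp add: comp_def fR)
    have d2: "distr (distr P ?M2 (?R K2)) noise g = noise"
      by (subst distr_distr[OF g R2]) (simp add: comp_def gR Z_law)
    have "distr P (borel \<Otimes>\<^sub>M borel) (\<lambda>\<omega>. (saga_ld F \<eta> X0 \<xi> S j \<omega>, saga_ld F \<eta> X0 \<xi> S n \<omega>)) \<Otimes>\<^sub>M noise
        = distr (distr P ?M1 (?R K1)) (borel \<Otimes>\<^sub>M borel) f \<Otimes>\<^sub>M distr (distr P ?M2 (?R K2)) noise g"
      by (simp only: d1 d2)
    also have "\<dots> = distr (distr P ?M1 (?R K1) \<Otimes>\<^sub>M distr P ?M2 (?R K2)) ((borel \<Otimes>\<^sub>M borel) \<Otimes>\<^sub>M noise) (\<lambda>(v, v'). (f v, g v'))"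
    proof (rule pair_measure_distr)
      show "sigma_finite_measure (distr (distr P ?M2 (?R K2)) noise g)" unfolding d2 ..
    qed measurable
    also have "\<dots> = distr P ((borel \<Otimes>\<^sub>M borel) \<Otimes>\<^sub>M noise) (\<lambda>\<omega>. (f (?R K1 \<omega>), g (?R K2 \<omega>)))"
      unfolding eq by (subst distr_distr) (auto simp: comp_def)
    finally show ?thesis by (simp add: fR gR)
  qed
  show ?thesis
  proof (intro harris_chain.intro harris_system.intro harris_system_axioms.intro harris_chain_axioms.intro)
    show "integrable P (\<lambda>\<omega>. W (saga_ld F \<eta> X0 \<xi> S 0 \<omega>))" using X0_sq by (simp add: W_def)
    show "saga_ld F \<eta> X0 \<xi> S (Suc n) \<omega> = saga_step F \<eta> (saga_ld F \<eta> X0 \<xi> S n \<omega>) (\<xi> (Suc n) \<omega>, S n \<omega>)" for n \<omega>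
      by (rule saga_ld_Suc)
    show "distr P ((borel \<Otimes>\<^sub>M borel) \<Otimes>\<^sub>M noise) (\<lambda>\<omega>. ((saga_ld F \<eta> X0 \<xi> S j \<omega>, saga_ld F \<eta> X0 \<xi> S n \<omega>), (\<xi> (Suc n) \<omega>, S n \<omega>)))
      = distr P (borel \<Otimes>\<^sub>M borel) (\<lambda>\<omega>. (saga_ld F \<eta> X0 \<xi> S j \<omega>, saga_ld F \<eta> X0 \<xi> S n \<omega>)) \<Otimes>\<^sub>M noise" if "j \<le> n" for j n
      by (rule joint[OF that])
  qed (fact P rs.random_system_axioms overlap Um Zm | simp)+
qed

end

theorem theorem2p4:
  fixes P :: "'w measure"
    and F :: "'n::finite \<Rightarrow> real^'d::finite \<Rightarrow> real^'d"
    and X0 :: "'w \<Rightarrow> real^'d"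
    and \<xi> :: "nat \<Rightarrow> 'w \<Rightarrow> real^'d"
    and S :: "nat \<Rightarrow> 'w \<Rightarrow> 'n"
    and c1 c2 M :: real
  assumes "prob_space P"
    and "X0 \<in> borel_measurable P"
    and "prob_space.indep_vars P (\<lambda>_. borel) \<xi> UNIV"
    and "\<And>n. std_gaussian P (\<xi> n)"
    and "prob_space.indep_vars P (\<lambda>_. count_space UNIV) S UNIV"
    and "\<And>n. uniformly_distributed P (S n)"
    and "independent_sources P X0 \<xi> S"
    and "integrable P (\<lambda>\<omega>. (norm (X0 \<omega>))\<^sup>2)"
    and "c1 > 0" and "c2 > 0"
    and "\<And>x. ((1 / real CARD('n)) *\<^sub>R (\<Sum>i\<in>UNIV. F i x)) \<bullet> x \<ge> c2 * (norm x)\<^sup>2 - c1"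
    and "M > 0"
    and "\<And>i x y. norm (F i x - F i y) \<le> M * norm (x - y)"
  shows "\<exists>\<eta>0>0. \<forall>\<eta>. 0 < \<eta> \<and> \<eta> \<le> \<eta>0 \<longrightarrow>
    (\<exists>\<mu> :: ((real^'d) \<times> (real^'d^'n)) measure.
      prob_space \<mu> \<and> sets \<mu> = sets borel \<and>
      (\<lambda>n. d_TV (distr P borel (saga_ld F \<eta> X0 \<xi> S n)) \<mu>) \<longlonglongrightarrow> 0 \<and>
      (\<forall>\<phi> \<in> borel_measurable borel. (\<exists>C>0. \<forall>u. \<bar>\<phi> u\<bar> \<le> C * (1 + norm u)) \<longrightarrow>
        integrable \<mu> \<phi> \<and>
        (\<lambda>n. \<integral>\<^sup>+ \<omega>. ennreal \<bar>(\<Sum>k=1..n. \<phi> (saga_ld F \<eta> X0 \<xi> S k \<omega>)) / real n - (\<integral>u. \<phi> u \<partial>\<mu>)\<bar> \<partial>P)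
          \<longlonglongrightarrow> 0 \<and>
        (\<forall>\<epsilon>>0. (\<lambda>n. measure P {\<omega> \<in> space P.
            \<bar>(\<Sum>k=1..n. \<phi> (saga_ld F \<eta> X0 \<xi> S k \<omega>)) / real n - (\<integral>u. \<phi> u \<partial>\<mu>)\<bar> > \<epsilon>})
          \<longlonglongrightarrow> 0)))"
proof -
  define N where "N = real CARD('n)"
  define L where "L = 2 + 2 * (1 + 2 * N) * M\<^sup>2"
  \<comment> \<open>The bound 1 gives \<eta>^2 <= \<eta> and makes the second condition in
    \<open>small\<close> linear; the other three entries are the conditions of the locale
    \<open>saga\<close> solved for \<eta>.\<close>
  define \<eta>0 where "\<eta>0 = Min {1, 2 / c2, c2 / (4 * L * M\<^sup>2), 1 / (4 * N * L)}"
  have N: "N > 0" by (simp add: N_def)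
  have L: "L > 0" using N by (auto simp: L_def intro!: add_pos_nonneg)
  have "\<eta>0 > 0" unfolding \<eta>0_def using N L \<open>c2 > 0\<close> \<open>M > 0\<close> by simp
  moreover have "\<exists>\<mu> :: ((real^'d) \<times> (real^'d^'n)) measure.
      prob_space \<mu> \<and> sets \<mu> = sets borel \<and>
      (\<lambda>n. d_TV (distr P borel (saga_ld F \<eta> X0 \<xi> S n)) \<mu>) \<longlonglongrightarrow> 0 \<and>
      (\<forall>\<phi> \<in> borel_measurable borel. (\<exists>C>0. \<forall>u. \<bar>\<phi> u\<bar> \<le> C * (1 + norm u)) \<longrightarrow>
        integrable \<mu> \<phi> \<and>
        (\<lambda>n. \<integral>\<^sup>+ \<omega>. ennreal \<bar>(\<Sum>k=1..n. \<phi> (saga_ld F \<eta> X0 \<xi> S k \<omega>)) / real n - (\<integral>u. \<phi> u \<partial>\<mu>)\<bar> \<partial>P)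
          \<longlonglongrightarrow> 0 \<and>
        (\<forall>\<epsilon>>0. (\<lambda>n. measure P {\<omega> \<in> space P.
            \<bar>(\<Sum>k=1..n. \<phi> (saga_ld F \<eta> X0 \<xi> S k \<omega>)) / real n - (\<integral>u. \<phi> u \<partial>\<mu>)\<bar> > \<epsilon>})
          \<longlonglongrightarrow> 0))" if \<eta>: "0 < \<eta>" "\<eta> \<le> \<eta>0" for \<eta>
  proof -
    have le: "\<eta> \<le> 1" "\<eta> \<le> 2 / c2" "\<eta> \<le> c2 / (4 * L * M\<^sup>2)" "\<eta> \<le> 1 / (4 * N * L)"
      using \<eta> by (auto simp: \<eta>0_def)
    interpret saga F c1 c2 M \<eta>
    proof
      show "\<eta> * c2 \<le> 2" using le(2) \<open>c2 > 0\<close> by (simp add: pos_le_divide_eq)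
      have "\<eta> * (4 * L * M\<^sup>2) \<le> c2" using le(3) L \<open>M > 0\<close> by (simp add: pos_le_divide_eq)
      then show "(2 + 2 * (1 + 2 * real CARD('n)) * M\<^sup>2) * (\<eta> * (2 * M\<^sup>2)) \<le> c2 / 2"
        unfolding N_def[symmetric] L_def[symmetric] by (simp add: mult_ac)
      have "L * \<eta>\<^sup>2 \<le> L * \<eta>"
        using L \<eta> le(1) by (simp add: power2_eq_square mult_left_le)
      also have "\<dots> \<le> 1 / (4 * N)" using le(4) L N by (simp add: field_simps)
      finally show "(2 + 2 * (1 + 2 * real CARD('n)) * M\<^sup>2) * \<eta>\<^sup>2 \<le> 1 / (4 * real CARD('n))"
        unfolding N_def L_def by simp
    qed (use assms \<eta> in auto)
    interpret ch: harris_chain P noise "saga_step F \<eta>" W "max (1 - \<eta> * c2) (1 - 1 / (4 * real CARD('n)))" b "Suc CARD('n)"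
        "saga_ld F \<eta> X0 \<xi> S" "\<lambda>n \<omega>. (\<xi> (Suc n) \<omega>, S n \<omega>)"
      by (rule harris_chain_saga_ld) fact+
    obtain \<mu> where mu: "prob_space \<mu>" "sets \<mu> = sets borel" "(\<lambda>n. d_TV (distr P borel (saga_ld F \<eta> X0 \<xi> S n)) \<mu>) \<longlonglongrightarrow> 0"
      and erg: "\<And>\<phi>. rs.wbounded \<phi> \<Longrightarrow> integrable \<mu> \<phi> \<and> (\<exists>K. \<forall>n. (\<integral>\<omega>. (\<Sum>k=1..n. \<phi> (saga_ld F \<eta> X0 \<xi> S k \<omega>) - (\<integral>u. \<phi> u \<partial>\<mu>))\<^sup>2 \<partial>P) \<le> K * real n)"
      using ch.ergodic by blast
    have "integrable \<mu> \<phi> \<and>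
        (\<lambda>n. \<integral>\<^sup>+ \<omega>. ennreal \<bar>(\<Sum>k=1..n. \<phi> (saga_ld F \<eta> X0 \<xi> S k \<omega>)) / real n - (\<integral>u. \<phi> u \<partial>\<mu>)\<bar> \<partial>P)
          \<longlonglongrightarrow> 0 \<and>
        (\<forall>\<epsilon>>0. (\<lambda>n. measure P {\<omega> \<in> space P.
            \<bar>(\<Sum>k=1..n. \<phi> (saga_ld F \<eta> X0 \<xi> S k \<omega>)) / real n - (\<integral>u. \<phi> u \<partial>\<mu>)\<bar> > \<epsilon>})
          \<longlonglongrightarrow> 0)"
      if \<phi> [measurable]: "\<phi> \<in> borel_measurable borel" and lin: "\<exists>C>0. \<forall>u. \<bar>\<phi> u\<bar> \<le> C * (1 + norm u)" for \<phi>
    proof -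
      obtain C where C: "C > 0" "\<And>u. \<bar>\<phi> u\<bar> \<le> C * (1 + norm u)" using lin by blast
      obtain K where K: "\<And>u :: (real^'d) \<times> (real^'d^'n). 1 + norm u \<le> K * (1 + sqrt (W u))"
        using norm_le_W by blast
      have wb: "rs.wbounded \<phi>"
      proof (rule rs.wboundedI[OF \<phi>])
        fix u
        have "C * (1 + norm u) \<le> C * (K * (1 + sqrt (W u)))"
          using C(1) by (intro mult_left_mono K) auto
        with C(2)[of u] show "\<bar>\<phi> u\<bar> \<le> C * K * (1 + rs.V u)" by (simp add: rs.V_def mult.assoc)
      qed
      obtain B where B: "\<And>n. (\<integral>\<omega>. (\<Sum>k=1..n. \<phi> (saga_ld F \<eta> X0 \<xi> S k \<omega>) - (\<integral>u. \<phi> u \<partial>\<mu>))\<^sup>2 \<partial>P) \<le> B * real n"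
        using erg[OF wb] by blast
      have int: "integrable P (\<lambda>\<omega>. (\<Sum>k=1..n. \<phi> (saga_ld F \<eta> X0 \<xi> S k \<omega>) - (\<integral>u. \<phi> u \<partial>\<mu>))\<^sup>2)" for n
        unfolding power2_eq_square sum_product
        by (intro Bochner_Integration.integrable_sum ch.integrable_U_mult[of "\<lambda>u. \<phi> u - (\<integral>u. \<phi> u \<partial>\<mu>)" "\<lambda>u. \<phi> u - (\<integral>u. \<phi> u \<partial>\<mu>)"]
            rs.wbounded_diff wb rs.wbounded_const)
      have meas: "(\<lambda>\<omega>. \<phi> (saga_ld F \<eta> X0 \<xi> S k \<omega>)) \<in> borel_measurable P" for k
        by (rule measurable_compose[OF ch.U_rv \<phi>])
      show ?thesis
        using erg[OF wb] ch.average_converges[of "\<lambda>k \<omega>. \<phi> (saga_ld F \<eta> X0 \<xi> S k \<omega>)", OF meas int B] by blast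
    qed
    with mu show ?thesis by blast
  qed
  ultimately show ?thesis by blast
qed

end
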